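(* Let $P$ be an open polygon which is either convex, or concave and has no pair of its vertex wedges that form a special pair. Then for every integer $k\ge 2$ there exists a number $m_k(P)$ such that every $m_k(P)$-fold covering of the plane by translates of $P$ can be decomposed into $k$ coverings of the plane.
   Context: A collection of translates of $P$ (repetitions allowed) is an $m$-fold covering of the plane if every point of the plane lies in at least $m$ members; it can be decomposed into $k$ coverings if it can be partitioned into $k$ subcollections each covering the whole plane. A wedge is one of the two closed/open regions into which two halflines with common endpoint (the apex) divide the plane; its angle is the angle between the halflines measured inside it. The wedge of $P$ at a vertex $v$ is the wedge with apex $v$ bounded by the halflines containing the two sides of $P$ incident to $v$, chosen so that it contains $P$ near $v$. Two wedges $V,W$, both of angle less than $\pi$, form a special pair if, after translating both so that their apices are at the origin and rotating so that $W$ contains the positive $x$-axis, and letting the two lines extending the boundary halflines of $W$ divide the plane into four regions Right $(=W)$, Left (the region opposite to $W$), Upper and Lower, one of the following holds (for some labeling of the two wedges as $V$ and $W$): (i) one boundary halfline of $V$ lies in Right and the other in Upper or Lower; (ii) both boundary halflines of $V$ lie in Upper; (iii) both boundary halflines of $V$ lie in Lower. (Equivalently, the union of the two wedges lies in an open halfplane whose boundary passes through the common apex, but neither wedge contains the other.) *)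

theory Defs
  imports "HOL-Analysis.Analysis"
begin

text \<open>The Euclidean plane is the type \<^typ>\<open>complex\<close>.\<close>

section \<open>Coverings by translates\<close>

definition translate :: "complex set \<Rightarrow> complex \<Rightarrow> complex set" where
  "translate P v = (\<lambda>x. v + x) ` P"

text \<open>A collection of translates of \<open>P\<close>, repetitions allowed, is an indexed family
  \<open>translate P (c i)\<close>, \<open>i \<in> I\<close>.\<close>

definition fold_covering :: "nat \<Rightarrow> complex set \<Rightarrow> 'i set \<Rightarrow> ('i \<Rightarrow> complex) \<Rightarrow> bool" where
  "fold_covering m P I c \<longleftrightarrow>
     (\<forall>x. \<exists>A. A \<subseteq> {i \<in> I. x \<in> translate P (c i)} \<and> finite A \<and> card A = m)"

definition decomposable :: "nat \<Rightarrow> complex set \<Rightarrow> 'i set \<Rightarrow> ('i \<Rightarrow> complex) \<Rightarrow> bool" where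
  "decomposable k P I c \<longleftrightarrow>
     (\<exists>J :: nat \<Rightarrow> 'i set. disjoint_family_on J {..<k} \<and> (\<Union>j<k. J j) = I \<and>
        (\<forall>j<k. (\<Union>i\<in>J j. translate P (c i)) = UNIV))"

text \<open>A bound \<open>m\<close> has to be uniform over all families, but an index type cannot be quantified
  after \<open>m\<close>.  Nothing is lost by taking indices in \<^typ>\<open>complex \<times> nat\<close>: a bound that works for
  all such families works, unchanged, for families over every index type.\<close>

lemma decomposable_index_type:
  fixes P :: "complex set" and I :: "'i set" and c :: "'i \<Rightarrow> complex"
  assumes dec: "\<And>(I' :: (complex \<times> nat) set) c'. fold_covering m P I' c' \<Longrightarrow> decomposable k P I' c'"
    and k: "k \<ge> 1" and cov: "fold_covering m P I c"
  shows "decomposable k P I c"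
proof -
  define F where "F v = {i \<in> I. c i = v}" for v
  have "\<exists>S. S \<subseteq> F v \<and> countable S \<and> (finite (F v) \<longrightarrow> S = F v) \<and> (infinite (F v) \<longrightarrow> infinite S)" for v
  proof (cases "finite (F v)")
    case True
    then show ?thesis by (intro exI[of _ "F v"]) (auto intro: countable_finite)
  next
    case False
    then show ?thesis using infinite_countable_subset'[OF False] by auto
  qed
  then obtain S where S: "\<And>v. S v \<subseteq> F v" "\<And>v. countable (S v)"
      "\<And>v. finite (F v) \<Longrightarrow> S v = F v" "\<And>v. infinite (F v) \<Longrightarrow> infinite (S v)"
    by metis
  define U where "U = {i \<in> I. i \<in> S (c i)}"
  define f where "f i = (c i, to_nat_on (S (c i)) i)" for i
  have SU: "S v \<subseteq> U" for v using S(1)[of v] by (auto simp: U_def F_def)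
  have injf: "inj_on f U"
  proof (rule inj_onI)
    fix i j assume "i \<in> U" "j \<in> U" and e: "f i = f j"
    then have "c i = c j" "i \<in> S (c i)" "j \<in> S (c i)" by (auto simp: f_def U_def)
    with e show "i = j" using inj_on_to_nat_on[OF S(2)[of "c i"]] by (auto simp: f_def inj_on_def)
  qed
  have covU: "\<exists>A. A \<subseteq> {i \<in> U. x \<in> translate P (c i)} \<and> finite A \<and> card A = m" for x
  proof -
    obtain A where A: "A \<subseteq> {i \<in> I. x \<in> translate P (c i)}" "finite A" "card A = m"
      using cov by (auto simp: fold_covering_def)
    show ?thesis
    proof (cases "\<exists>i\<in>A. infinite (F (c i))")
      case True
      then obtain i where i: "i \<in> A" "infinite (S (c i))" using S(4) by blast
      obtain B where B: "B \<subseteq> S (c i)" "finite B" "card B = m"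
        using infinite_arbitrarily_large[OF i(2)] by metis
      have "\<forall>j\<in>B. c j = c i" using B(1) S(1) by (auto simp: F_def)
      then have "B \<subseteq> {j \<in> U. x \<in> translate P (c j)}" using B(1) SU A(1) i(1) by auto
      then show ?thesis using B by blast
    next
      case False
      then have "A \<subseteq> U" using A(1) S(3) by (auto simp: U_def F_def)
      then show ?thesis using A by blast
    qed
  qed
  have "fold_covering m P (f ` U) fst"
    unfolding fold_covering_def
  proof
    fix x
    obtain A where A: "A \<subseteq> {i \<in> U. x \<in> translate P (c i)}" "finite A" "card A = m"
      using covU by blast
    have "inj_on f A" using injf A(1) by (auto intro: inj_on_subset)
    then have "card (f ` A) = m" using A(3) by (simp add: card_image)
    moreover have "f ` A \<subseteq> {i \<in> f ` U. x \<in> translate P (fst i)}" using A(1) by (auto simp: f_def)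
    ultimately show "\<exists>A. A \<subseteq> {i \<in> f ` U. x \<in> translate P (fst i)} \<and> finite A \<and> card A = m"
      using A(2) by blast
  qed
  from dec[OF this] obtain J where J: "disjoint_family_on J {..<k}" "(\<Union>j<k. J j) = f ` U"
      "\<And>j. j < k \<Longrightarrow> (\<Union>i\<in>J j. translate P (fst i)) = UNIV"
    by (auto simp: decomposable_def)
  define K where "K j = {i \<in> U. f i \<in> J j} \<union> (if j = 0 then I - U else {})" for j
  have disj: "disjoint_family_on K {..<k}"
    using J(1) unfolding disjoint_family_on_def K_def by (auto split: if_splits)
  have UI: "U \<subseteq> I" by (auto simp: U_def)
  have un: "(\<Union>j<k. K j) = I"
  proof
    show "(\<Union>j<k. K j) \<subseteq> I" using UI by (auto simp: K_def split: if_splits)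
    show "I \<subseteq> (\<Union>j<k. K j)"
    proof
      fix i assume i: "i \<in> I"
      show "i \<in> (\<Union>j<k. K j)"
      proof (cases "i \<in> U")
        case True
        then obtain j where j: "j < k" "f i \<in> J j" using J(2) by blast
        then have "i \<in> K j" using True by (simp add: K_def)
        then show ?thesis using j(1) by blast
      next
        case False
        then have "i \<in> K 0" using i by (simp add: K_def)
        then show ?thesis using k by (intro UN_I[of 0]) auto
      qed
    qed
  qed
  have "(\<Union>i\<in>K j. translate P (c i)) = UNIV" if j: "j < k" for j
  proof -
    have "x \<in> (\<Union>i\<in>K j. translate P (c i))" for x
    proof -
      obtain p where p: "p \<in> J j" "x \<in> translate P (fst p)" using J(3)[OF j] by blast
      then obtain i where i: "i \<in> U" "p = f i" using J(2) j by blast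
      then have "i \<in> K j" "x \<in> translate P (c i)" using p by (auto simp: K_def f_def)
      then show ?thesis by blast
    qed
    then show ?thesis by blast
  qed
  then show ?thesis unfolding decomposable_def using disj un by blast
qed


section \<open>Polygons\<close>

fun polygonal_path :: "complex list \<Rightarrow> real \<Rightarrow> complex" where
  "polygonal_path [] = linepath 0 0"
| "polygonal_path [a] = linepath a a"
| "polygonal_path [a, b] = linepath a b"
| "polygonal_path (a # b # c # xs) = linepath a b +++ polygonal_path (b # c # xs)"

definition boundary_path :: "complex list \<Rightarrow> real \<Rightarrow> complex" where
  "boundary_path vs = polygonal_path (vs @ [hd vs])"

definition next_vertex :: "complex list \<Rightarrow> nat \<Rightarrow> complex" where
  "next_vertex vs i = vs ! (Suc i mod length vs)"

definition prev_vertex :: "complex list \<Rightarrow> nat \<Rightarrow> complex" where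
  "prev_vertex vs i = vs ! ((i + length vs - 1) mod length vs)"

text \<open>The list \<open>vs\<close> enumerates the vertices in cyclic order, in either orientation.  The last
  condition says that each of them is a genuine vertex, not an inner point of a side.\<close>

definition simple_polygon :: "complex list \<Rightarrow> bool" where
  "simple_polygon vs \<longleftrightarrow> 3 \<le> length vs \<and> simple_path (boundary_path vs) \<and>
     (\<forall>i<length vs. \<not> collinear {prev_vertex vs i, vs ! i, next_vertex vs i})"

definition open_polygon :: "complex list \<Rightarrow> complex set" where
  "open_polygon vs = inside (path_image (boundary_path vs))"


section \<open>Wedges\<close>

text \<open>The set of points \<open>\<noteq> 0\<close> whose direction is one of the angles in \<open>T\<close>.\<close>

definition cone_of :: "real set \<Rightarrow> complex set" where
  "cone_of T = {rcis r t | r t. 0 < r \<and> t \<in> T}"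

definition halfline :: "complex \<Rightarrow> complex \<Rightarrow> complex set" where
  "halfline a d = {a + r *\<^sub>R d | r. 0 \<le> r}"

text \<open>A wedge is swept counterclockwise, from the halfline of direction \<open>start\<close> to the one of
  direction \<open>start + angle\<close>; \<open>start\<close> matters only modulo \<open>2 * pi\<close>.\<close>

datatype wedge = Wedge (apex: complex) (start: real) (angle: real)

definition wedge_region :: "wedge \<Rightarrow> complex set" where
  "wedge_region W = (\<lambda>x. apex W + x) ` cone_of {start W <..< start W + angle W}"

definition boundary_halflines :: "wedge \<Rightarrow> complex set set" where
  "boundary_halflines W =
     {halfline (apex W) (cis (start W)), halfline (apex W) (cis (start W + angle W))}"

definition vertex_wedge :: "complex list \<Rightarrow> nat \<Rightarrow> wedge \<Rightarrow> bool" where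
  "vertex_wedge vs i W \<longleftrightarrow>
     apex W = vs ! i \<and> 0 < angle W \<and> angle W < 2 * pi \<and>
     boundary_halflines W =
       {halfline (vs ! i) (prev_vertex vs i - vs ! i), halfline (vs ! i) (next_vertex vs i - vs ! i)} \<and>
     (\<exists>e>0. open_polygon vs \<inter> ball (vs ! i) e \<subseteq> wedge_region W)"


section \<open>Special pairs\<close>

text \<open>The four open regions into which the lines through the boundary halflines of \<open>W\<close>, translated
  to apex \<open>0\<close>, divide the plane, if \<open>angle W < pi\<close>.  Rotating \<open>W\<close> so that it contains the positive
  x-axis only serves to name them, so it is omitted.  Left is not needed.\<close>

definition region_right :: "wedge \<Rightarrow> complex set" where
  "region_right W = cone_of {start W <..< start W + angle W}"

definition region_upper :: "wedge \<Rightarrow> complex set" where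
  "region_upper W = cone_of {start W + angle W <..< start W + pi}"

definition region_lower :: "wedge \<Rightarrow> complex set" where
  "region_lower W = cone_of {start W + angle W + pi <..< start W + 2 * pi}"

text \<open>The boundary halflines of \<open>V\<close>, translated to apex \<open>0\<close>, are represented by their directions
  \<open>p\<close> and \<open>q\<close>; since the regions are cones, the halfline without its apex lies in a region iff its
  direction does.  A halfline of \<open>V\<close> may also fall on one of the two lines.  This is settled so that,
  for closed wedges of angle less than \<open>pi\<close>, being special means that the union without the apex lies
  in an open halfplane with the common apex on its boundary, and neither wedge contains the other:
  wedges that merely share a boundary halfline are not excluded by this, hence the additional cones
  in cases (ii) and (iii), whereas a halfline opposite to one of \<open>W\<close> is excluded.\<close>

definition special_for :: "wedge \<Rightarrow> wedge \<Rightarrow> bool" where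
  "special_for V W \<longleftrightarrow>
     (let p = cis (start V); q = cis (start V + angle V) in
        (p \<in> region_right W \<and> q \<in> region_upper W \<union> region_lower W) \<or>
        (q \<in> region_right W \<and> p \<in> region_upper W \<union> region_lower W) \<or>
        {p, q} \<subseteq> region_upper W \<union> cone_of {start W + angle W} \<or>
        {p, q} \<subseteq> region_lower W \<union> cone_of {start W})"

definition special_pair :: "wedge \<Rightarrow> wedge \<Rightarrow> bool" where
  "special_pair V W \<longleftrightarrow> angle V < pi \<and> angle W < pi \<and> (special_for V W \<or> special_for W V)"

definition has_special_pair :: "complex list \<Rightarrow> bool" where
  "has_special_pair vs \<longleftrightarrow>
     (\<exists>i<length vs. \<exists>j<length vs. \<exists>V W.
        i \<noteq> j \<and> vertex_wedge vs i V \<and> vertex_wedge vs j W \<and> special_pair V W)"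

end

theory Submission
  imports Defs
begin

text \<open>
  Replacing the centres \<open>c i\<close> by the points \<open>- c i\<close>, the translates covering a point \<open>x\<close> become the points
  lying in a translate of \<open>P\<close>.  In a cell much smaller than \<open>P\<close>, a translate of \<open>P\<close> looks like a
  translate of one of finitely many wedges or half-planes, and by compactness each cell may be
  assumed to contain finitely many points.  So it suffices to colour a finite point set such that
  every translate of each of these wedges that contains many points contains all colours.

  For one type of wedge this is an easy sweep.  In general the points are first distributed among
  the types such that every translate of a wedge with many points keeps many points of its own
  type; for this it is enough to separate any two types.  A wedge is determined by the arc of
  directions of its dual cone, and a pair of wedges is special iff these arcs cross.  Nested and
  disjoint arcs leave three combinatorial situations, according to the order of the bounding
  directions of one arc and of the opposite of the other: nested, disjoint and crossing.
\<close>

section \<open>Quadrants in finite point sets\<close>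

text \<open>Geometry enters the combinatorics only through implications between the orders induced
  by linear functionals, all of them consequences of \<open>proj_between\<close>; separations are
  therefore proved for arbitrary real functions satisfying such implications. The arguments rest on
  depth: a quadrant with at least \<open>m\<close> points has at least \<open>m\<close> points
  dominated by fewer than \<open>m\<close> others (\<open>shallow_card\<close>). So a type can live
  on its shallow points alone, and in the nested and disjoint situations all deeper points are
  handed to the other type at once; the conflict is about the shallow ones. A separation keeps
  \<open>N\<close> points rather than one, because the types are added one at a time and each new
  type splits the classes of all earlier ones again. Inner points of sides and reflex vertices
  contribute only half-planes, whose degenerate arcs cross no other arc. Hence only pairs of convex
  vertices matter; in a convex polygon their arcs do not overlap, because the closed wedge at each
  vertex contains the whole polygon.\<close>

definition quad :: "'a set \<Rightarrow> ('a \<Rightarrow> real) \<Rightarrow> ('a \<Rightarrow> real) \<Rightarrow> real \<Rightarrow> real \<Rightarrow> 'a set" where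
  "quad S F G a b = {s \<in> S. a < F s \<and> b < G s}"

lemma finite_quad [simp]: "finite S \<Longrightarrow> finite (quad S F G a b)"
  by (simp add: quad_def)

lemma quad_subset: "quad S F G a b \<subseteq> S"
  by (auto simp: quad_def)

lemma quad_commute: "quad S F G a b = quad S G F b a"
  by (auto simp: quad_def)

lemma finite_has_max_image:
  fixes F :: "'a \<Rightarrow> real"
  assumes "finite A" "A \<noteq> {}"
  shows "\<exists>z\<in>A. \<forall>y\<in>A. F y \<le> F z"
  using assms Max_in[of "F ` A"] Max_ge[of "F ` A"] by fastforce

lemma top_subset:
  fixes F :: "'a \<Rightarrow> real"
  assumes "finite A" "m \<le> card A"
  shows "\<exists>T\<subseteq>A. card T = m \<and> (\<forall>x\<in>T. \<forall>y\<in>A - T. F y \<le> F x)"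
  using assms(2)
proof (induction m)
  case 0
  then show ?case by (intro exI[of _ "{}"]) auto
next
  case (Suc m)
  then obtain T where T: "T \<subseteq> A" "card T = m" "\<forall>x\<in>T. \<forall>y\<in>A - T. F y \<le> F x" by auto
  have fT: "finite T" using T(1) assms(1) finite_subset by blast
  have ne: "A - T \<noteq> {}" using T(2) Suc.prems T(1) by auto
  obtain z where z: "z \<in> A - T" "\<And>y. y \<in> A - T \<Longrightarrow> F y \<le> F z"
    using finite_has_max_image[of "A - T" F] ne assms(1) by auto
  show ?case
    by (rule exI[of _ "insert z T"]) (use T z fT in auto)
qed

text \<open>All strictly larger rivals of a member of a top set of size \<open>m\<close> belong to
  that set. Ties may add further points, hence an inequality.\<close>

lemma ord_rank_less_card:
  fixes F :: "'a \<Rightarrow> real"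
  assumes "finite A" "m \<le> card A"
  shows "m \<le> card {q \<in> A. card {p \<in> A. F q < F p} < m}"
proof -
  obtain T where T: "T \<subseteq> A" "card T = m" "\<forall>x\<in>T. \<forall>y\<in>A - T. F y \<le> F x"
    using top_subset[OF assms] by blast
  have fT: "finite T" using T(1) assms(1) finite_subset by blast
  have sub: "T \<subseteq> {q \<in> A. card {p \<in> A. F q < F p} < m}"
  proof
    fix q assume q: "q \<in> T"
    have "{p \<in> A. F q < F p} \<subset> T" using T q by force
    then have "card {p \<in> A. F q < F p} < m" using psubset_card_mono[OF fT] T(2) by auto
    then show "q \<in> {q \<in> A. card {p \<in> A. F q < F p} < m}" using q T(1) by auto
  qed
  then show ?thesis using card_mono[OF _ sub] T(2) assms(1) by auto
qed

text \<open>The number of points dominating \<open>q\<close>. By \<open>depth_less\<close>, points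
  of equal depth form an antichain for domination.\<close>

definition depth :: "'a set \<Rightarrow> ('a \<Rightarrow> real) \<Rightarrow> ('a \<Rightarrow> real) \<Rightarrow> 'a \<Rightarrow> nat" where
  "depth S F G q = card {p \<in> S. F q < F p \<and> G q < G p}"

lemma card_le_depth:
  assumes "finite S" "Z \<subseteq> S" "\<And>p. p \<in> Z \<Longrightarrow> F q < F p \<and> G q < G p"
  shows "card Z \<le> depth S F G q"
  unfolding depth_def using assms by (intro card_mono) auto

lemma depth_less:
  assumes "finite S" "q \<in> S" "F p < F q" "G p < G q"
  shows "depth S F G q < depth S F G p"
  unfolding depth_def using assms by (intro psubset_card_mono) auto

text \<open>A quadrant is closed upwards, so the dominators of one of its points lie in it and have
  larger \<open>F\<close>; inside the quadrant the depth is at most the rank by decreasing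
  \<open>F\<close>.\<close>

lemma shallow_card:
  assumes "finite S" "m \<le> card (quad S F G a b)"
  shows "m \<le> card {q \<in> quad S F G a b. depth S F G q < m}"
proof -
  let ?A = "quad S F G a b"
  have fA: "finite ?A" using assms by simp
  have "{q \<in> ?A. card {p \<in> ?A. F q < F p} < m} \<subseteq> {q \<in> ?A. depth S F G q < m}"
  proof clarify
    fix q assume q: "q \<in> ?A" "card {p \<in> ?A. F q < F p} < m"
    have "depth S F G q \<le> card {p \<in> ?A. F q < F p}" unfolding depth_def
      using assms(1) q by (intro card_mono) (auto simp: quad_def)
    then show "depth S F G q < m" using q by simp
  qed
  then have "card {q \<in> ?A. card {p \<in> ?A. F q < F p} < m} \<le> card {q \<in> ?A. depth S F G q < m}"
    using fA by (intro card_mono) auto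
  then show ?thesis using ord_rank_less_card[OF fA assms(2), of F] by linarith
qed

text \<open>Insert the points by decreasing \<open>F\<close>; a point entering the set \<open>D\<close> of the \<open>k\<close> points with the
  largest values of \<open>G\<close> inherits the colour of the point that it pushes out.\<close>

lemma quad_colouring:
  fixes F G :: "'a \<Rightarrow> real"
  assumes "finite S" and k: "k > 0"
  shows "\<exists>col :: 'a \<Rightarrow> nat. \<forall>a b. k \<le> card (quad S F G a b) \<longrightarrow> {..<k} \<subseteq> col ` quad S F G a b"
proof -
  define Inv where "Inv S col D \<longleftrightarrow>
       (\<forall>a b. k \<le> card (quad S F G a b) \<longrightarrow> {..<k} \<subseteq> col ` quad S F G a b)
     \<and> D \<subseteq> S \<and> card D = min k (card S) \<and> inj_on col D \<and> col ` D \<subseteq> {..<k}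
     \<and> (\<forall>x\<in>D. \<forall>y\<in>S - D. G y \<le> G x)" for S and col :: "'a \<Rightarrow> nat" and D
  have "\<exists>col D. Inv S col D"
    using assms(1)
  proof (induction S rule: finite_ranking_induct[where f = "\<lambda>x. - F x"])
    case empty
    show ?case by (rule exI[of _ "\<lambda>_. 0"], rule exI[of _ "{}"]) (use k in \<open>simp add: Inv_def quad_def\<close>)
  next
    case (insert s S)
    show ?case
    proof (cases "s \<in> S")
      case True
      then have "insert s S = S" by blast
      then show ?thesis using insert.IH by (simp only:)
    next
      case s: False
      obtain col D where IH: "Inv S col D" using insert.IH by blast
      then have I: "\<And>a b. k \<le> card (quad S F G a b) \<Longrightarrow> {..<k} \<subseteq> col ` quad S F G a b"
        "D \<subseteq> S" "card D = min k (card S)" "inj_on col D" "col ` D \<subseteq> {..<k}"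
        "\<And>x y. x \<in> D \<Longrightarrow> y \<in> S - D \<Longrightarrow> G y \<le> G x"
        unfolding Inv_def by auto
      have fD: "finite D" using I(2) insert(1) finite_subset by blast
      have sD: "s \<notin> D" using s I(2) by auto
      have cS: "card (insert s S) = Suc (card S)" using s insert(1) by simp
      have "\<exists>c D'. D' \<subseteq> insert s S \<and> card D' = min k (card (insert s S)) \<and> inj_on (col(s := c)) D'
          \<and> (col(s := c)) ` D' \<subseteq> {..<k} \<and> (\<forall>x\<in>D'. \<forall>y\<in>insert s S - D'. G y \<le> G x)"
      proof (cases "card S < k")
        case True
        then have DS: "D = S" using I(2,3) insert(1) by (intro card_subset_eq) auto
        have "card (col ` D) < k" using I(4) True DS by (simp add: card_image)
        then have "\<not> {..<k} \<subseteq> col ` D"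
          by (metis card_lessThan card_mono finite_imageI fD not_le)
        then obtain c where c: "c < k" "c \<notin> col ` D" by auto
        show ?thesis
          by (rule exI[of _ c], rule exI[of _ "insert s D"])
            (use c I DS s True cS insert(1) in \<open>auto simp: inj_on_def\<close>)
      next
        case False
        then have cD: "card D = k" using I(3) by simp
        then have ne: "D \<noteq> {}" using k by auto
        obtain d where d: "d \<in> D" "\<And>x. x \<in> D \<Longrightarrow> G d \<le> G x"
          using finite_has_max_image[OF fD ne, of "\<lambda>x. - G x"] by auto
        show ?thesis
        proof (cases "G s \<le> G d")
          case True
          show ?thesis
            by (rule exI[of _ 0], rule exI[of _ D])
              (use True False d I sD cD cS in \<open>auto simp: inj_on_def intro: order_trans\<close>)
        next
          case gs: False
          let ?D = "insert s (D - {d})"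
          have "card ?D = k" using fD d(1) sD cD k by simp
          moreover have "inj_on (col(s := col d)) ?D" using I(4) d(1) sD by (auto simp: inj_on_def)
          moreover have "G y \<le> G x" if "x \<in> ?D" "y \<in> insert s S - ?D" for x y
          proof -
            have "y = d \<or> y \<in> S - D" using that by auto
            then have "G y \<le> G d" using I(6)[OF d(1)] by auto
            moreover have "G d \<le> G x" using that(1) d(2) gs by force
            ultimately show ?thesis by linarith
          qed
          ultimately show ?thesis
            by (intro exI[of _ "col d"] exI[of _ ?D])
              (use False d I cD cS sD in \<open>auto split: if_splits\<close>)
        qed
      qed
      then obtain c D' where D': "D' \<subseteq> insert s S" "card D' = min k (card (insert s S))"
        "inj_on (col(s := c)) D'" "(col(s := c)) ` D' \<subseteq> {..<k}"
        "\<forall>x\<in>D'. \<forall>y\<in>insert s S - D'. G y \<le> G x" by (elim exE conjE) (rule that)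
      have fD': "finite D'" using D'(1) insert(1) by (meson finite_insert finite_subset)
      have "{..<k} \<subseteq> (col(s := c)) ` quad (insert s S) F G a b"
        if q: "k \<le> card (quad (insert s S) F G a b)" for a b
      proof (cases "s \<in> quad (insert s S) F G a b")
        case False
        then have "quad (insert s S) F G a b = quad S F G a b" by (auto simp: quad_def)
        moreover have "(col(s := c)) ` quad S F G a b = col ` quad S F G a b"
          using s by (auto simp: quad_def)
        ultimately show ?thesis using I(1) q by metis
      next
        case True
        let ?Q = "quad (insert s S) F G a b"
        \<comment> \<open>The new point has the least \<open>F\<close> so far, so a quadrant
          containing it is cut off by \<open>G\<close> alone, and having \<open>k\<close> points it
          contains the top set \<open>D'\<close>. All other quadrants are old ones.\<close>
        have Q: "?Q = {x \<in> insert s S. b < G x}"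
          using True insert(2) by (fastforce simp: quad_def)
        have kS: "k \<le> card (insert s S)" using q card_mono[of "insert s S" ?Q] insert(1)
          by (simp add: quad_subset)
        then have cD': "card D' = k" using D'(2) by simp
        have "D' \<subseteq> ?Q"
        proof (rule ccontr)
          assume "\<not> D' \<subseteq> ?Q"
          then obtain x where x: "x \<in> D'" "G x \<le> b" using Q D'(1) by force
          have "?Q \<subseteq> D' - {x}" using x D'(5) Q by force
          then have "card ?Q \<le> card (D' - {x})" using fD' by (intro card_mono) auto
          then show False using x fD' cD' q k by (simp add: card_Diff_singleton)
        qed
        moreover have "(col(s := c)) ` D' = {..<k}"
          using card_subset_eq[OF finite_lessThan D'(4)] card_image[OF D'(3)] cD' by simp
        ultimately show ?thesis by blast
      qed
      then have "Inv (insert s S) (col(s := c)) D'" using D' by (simp add: Inv_def)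
      then show ?thesis by blast
    qed
  qed
  then show ?thesis by (auto simp: Inv_def)
qed

section \<open>Ranks, blocks of consecutive ranks and medians\<close>

definition ord_rank :: "'a set \<Rightarrow> ('a \<Rightarrow> real) \<Rightarrow> 'a \<Rightarrow> nat" where
  "ord_rank S X q = card {p \<in> S. X p < X q}"

lemma ord_rank_mono: "finite S \<Longrightarrow> X p \<le> X q \<Longrightarrow> ord_rank S X p \<le> ord_rank S X q"
  unfolding ord_rank_def by (intro card_mono) auto

lemma ord_rank_strict_mono: "finite S \<Longrightarrow> p \<in> S \<Longrightarrow> X p < X q \<Longrightarrow> ord_rank S X p < ord_rank S X q"
  unfolding ord_rank_def by (intro psubset_card_mono) auto

lemma ord_rank_less_iff: "finite S \<Longrightarrow> p \<in> S \<Longrightarrow> ord_rank S X p < ord_rank S X q \<longleftrightarrow> X p < X q"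
  using ord_rank_mono[of S X q p] ord_rank_strict_mono[of S p X q] by (meson not_le)

lemma ord_rank_bij:
  assumes "finite S" "inj_on X S"
  shows "bij_betw (ord_rank S X) S {..<card S}"
proof -
  have inj: "inj_on (ord_rank S X) S"
  proof (rule inj_onI)
    fix p q assume "p \<in> S" "q \<in> S" "ord_rank S X p = ord_rank S X q"
    then have "X p = X q" using ord_rank_strict_mono[OF assms(1), of _ X] by (metis less_irrefl linorder_neqE)
    then show "p = q" using assms(2) \<open>p \<in> S\<close> \<open>q \<in> S\<close>
      by (auto dest: inj_onD)
  qed
  have "ord_rank S X q < card S" if "q \<in> S" for q
    unfolding ord_rank_def using assms(1) that by (intro psubset_card_mono) auto
  then have "ord_rank S X ` S \<subseteq> {..<card S}" by auto
  then have "ord_rank S X ` S = {..<card S}" using inj by (intro card_subset_eq) (auto simp: card_image)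
  then show ?thesis using inj by (simp add: bij_betw_def)
qed

lemma card_rank_vimage:
  assumes "finite S" "inj_on X S" "B \<subseteq> {..<card S}"
  shows "card {q \<in> S. ord_rank S X q \<in> B} = card B"
proof -
  have b: "bij_betw (ord_rank S X) S {..<card S}" using ord_rank_bij assms by blast
  then have "ord_rank S X ` {q \<in> S. ord_rank S X q \<in> B} = B"
    using assms(3) by (auto simp: bij_betw_def image_iff)
  moreover have "inj_on (ord_rank S X) {q \<in> S. ord_rank S X q \<in> B}"
    using b by (auto simp: bij_betw_def intro: inj_on_subset)
  ultimately show ?thesis by (metis card_image)
qed

lemma pigeonhole_fibre:
  fixes m k :: nat
  assumes "finite B" "\<And>q. q \<in> B \<Longrightarrow> h q \<in> D" "finite D" "card D * k < card B"
  shows "\<exists>d\<in>D. k < card {q \<in> B. h q = d}"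
proof (rule ccontr)
  assume "\<not> ?thesis"
  then have le: "\<And>d. d \<in> D \<Longrightarrow> card {q \<in> B. h q = d} \<le> k" by force
  have "B = (\<Union>d\<in>D. {q \<in> B. h q = d})" using assms(2) by auto
  then have "card B \<le> (\<Sum>d\<in>D. card {q \<in> B. h q = d})"
    using card_UN_le[OF assms(3), of "\<lambda>d. {q \<in> B. h q = d}"] by simp
  also have "\<dots> \<le> card D * k" using sum_bounded_above[of D _ k] le by auto
  finally show False using assms(4) by simp
qed

lemma nat_div_eq_iff:
  fixes K n j :: nat
  assumes "K > 0"
  shows "n div K = j \<longleftrightarrow> j * K \<le> n \<and> n < (j + 1) * K"
  using less_eq_div_iff_mult_less_eq[OF assms, of j n] div_less_iff_less_mult[OF assms, of n "j + 1"]
    by linarith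

text \<open>An interval occupies consecutive ranks. The blocks of its first and last point may stick
  out of it, which costs the two extra blocks; \<open>(j + 1) * K \<le> card S\<close> records that
  block \<open>j\<close> is complete.\<close>

lemma interval_contains_blocks:
  fixes X :: "'a \<Rightarrow> real"
  assumes fin: "finite S" and inj: "inj_on X S" and K: "K > 0"
    and card: "(t + 2) * K \<le> card {p \<in> S. l < X p \<and> X p \<le> h}"
  shows "\<exists>J. finite J \<and> card J = t \<and>
    (\<forall>j\<in>J. (j + 1) * K \<le> card S \<and> {q \<in> S. ord_rank S X q div K = j} \<subseteq> {p \<in> S. l < X p \<and> X p \<le> h})"
proof -
  let ?I = "{p \<in> S. l < X p \<and> X p \<le> h}"
  have fI: "finite ?I" using fin by simp
  have "card ?I > 0" using card K by (metis add_is_0 gr0I le_0_eq mult_is_0 not_gr0 zero_neq_numeral)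
  then have ne: "?I \<noteq> {}" by force
  obtain p where p: "p \<in> ?I" "\<And>x. x \<in> ?I \<Longrightarrow> X p \<le> X x"
    using finite_has_max_image[OF fI ne, of "\<lambda>x. - X x"] by auto
  obtain q where q: "q \<in> ?I" "\<And>x. x \<in> ?I \<Longrightarrow> X x \<le> X q"
    using finite_has_max_image[OF fI ne, of X] by auto
  let ?r = "ord_rank S X"
  have b: "bij_betw ?r S {..<card S}" using ord_rank_bij[OF fin inj] .
  have "?r ` ?I \<subseteq> {?r p..?r q}" using p(2) q(2) ord_rank_mono[OF fin] by auto
  moreover have "inj_on ?r ?I" using b by (auto simp: bij_betw_def intro: inj_on_subset)
  ultimately have cI: "card ?I \<le> ?r q + 1 - ?r p"
    using card_inj_on_le[of ?r ?I "{?r p..?r q}"] by auto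
  have rq: "?r q < card S" using b q(1) by (auto simp: bij_betw_def)
  define A where "A = ?r p div K"
  have A1: "A * K \<le> ?r p" and A2: "?r p < (A + 1) * K"
    using nat_div_eq_iff[OF K, of "?r p" A] by (auto simp: A_def)
  have tot: "(A + 1 + t) * K \<le> ?r q"
  proof -
    have "?r p + (t + 2) * K \<le> ?r q + 1" using cI card K by (cases "?r p \<le> ?r q + 1") auto
    moreover have "(A + 1 + t) * K + K = A * K + (t + 2) * K" by (simp add: algebra_simps)
    ultimately show ?thesis using A1 K by linarith
  qed
  have "(j + 1) * K \<le> card S \<and> {x \<in> S. ?r x div K = j} \<subseteq> ?I" if j: "j \<in> {A + 1..<A + 1 + t}" for j
  proof
    have "(j + 1) * K \<le> (A + 1 + t) * K" using j by (intro mult_le_mono1) auto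
    then have jt: "(j + 1) * K \<le> ?r q" using tot by linarith
    then show "(j + 1) * K \<le> card S" using rq by linarith
    show "{x \<in> S. ?r x div K = j} \<subseteq> ?I"
    proof
      fix x assume "x \<in> {x \<in> S. ?r x div K = j}"
      then have x: "x \<in> S" "?r x div K = j" by auto
      have "j * K \<le> ?r x" "?r x < (j + 1) * K"
        using nat_div_eq_iff[OF K, of "?r x" j] x(2) by auto
      moreover have "(A + 1) * K \<le> j * K" using j by (intro mult_le_mono1) auto
      ultimately have "?r p < ?r x" "?r x < ?r q" using A2 jt by linarith+
      then have "X p < X x" "X x < X q" using ord_rank_less_iff[OF fin] p(1) x(1) by auto
      then show "x \<in> ?I" using p(1) q(1) x(1) by auto
    qed
  qed
  then show ?thesis by (intro exI[of _ "{A + 1..<A + 1 + t}"]) auto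
qed

lemma exists_median:
  fixes X :: "'a \<Rightarrow> real"
  assumes "finite E" "inj_on X E" "card E = 2 * N + 1"
  shows "\<exists>c\<in>E. card {e \<in> E. X e < X c} = N \<and> card {e \<in> E. X c < X e} = N"
proof -
  have "N \<in> ord_rank E X ` E" using ord_rank_bij[OF assms(1,2)] assms(3) by (auto simp: bij_betw_def)
  then obtain c where c: "c \<in> E" "card {e \<in> E. X e < X c} = N" by (auto simp: ord_rank_def)
  have "E = insert c ({e \<in> E. X e < X c} \<union> {e \<in> E. X c < X e})"
    using c(1) assms(2) by (auto dest: inj_onD) (metis inj_onD linorder_neqE)
  then have "card E = card (insert c ({e \<in> E. X e < X c} \<union> {e \<in> E. X c < X e}))" by simp
  also have "\<dots> = Suc (card ({e \<in> E. X e < X c} \<union> {e \<in> E. X c < X e}))"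
    using assms(1) by (subst card_insert_disjoint) auto
  also have "card ({e \<in> E. X e < X c} \<union> {e \<in> E. X c < X e}) = N + card {e \<in> E. X c < X e}"
    using assms(1) c(2) by (subst card_Un_disjoint) auto
  finally have "card {e \<in> E. X c < X e} = N" using assms(3) by simp
  then show ?thesis using c by blast
qed

text \<open>One point is chosen from each block of \<open>K\<close> consecutive points of \<open>S0\<close>: the median \<open>c\<close> of \<open>2 * N + 1\<close>
  points of equal depth, which form an antichain.  If a quadrant contains \<open>c\<close> but few other points of
  the block, it misses antichain points \<open>e\<close> and \<open>e'\<close> on both sides of \<open>c\<close>; its points outside the block
  dominate \<open>e\<close> or \<open>e'\<close>, so if there are many of them, the depth of \<open>c\<close> is large.  But the quadrant
  contains many points of small depth.\<close>

lemma thin_transversal: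
  fixes X f g :: "'a \<Rightarrow> real"
  assumes fin: "finite S" and inj: "inj_on X S" and N: "N > 0"
    and t1: "\<And>p q. \<lbrakk>p \<in> S; q \<in> S; X p < X q; f p < f q\<rbrakk> \<Longrightarrow> g p < g q"
    and t2: "\<And>p q. \<lbrakk>p \<in> S; q \<in> S; X q < X p; g p < g q\<rbrakk> \<Longrightarrow> f p < f q"
    and S0: "S0 = {q \<in> S. depth S f g q < 3 * N}" and K: "K = 3 * N * (2 * N + 1)"
  shows "\<exists>C\<subseteq>S0. (\<forall>l h t. (t + 2) * K \<le> card {p \<in> S0. l < X p \<and> X p \<le> h} \<longrightarrow>
                        t \<le> card {p \<in> C. l < X p \<and> X p \<le> h}) \<and>
          (\<forall>a b. 3 * N \<le> card (quad S f g a b) \<longrightarrow> N \<le> card (quad S f g a b \<inter> S0 - C))"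
proof -
  let ?dep = "depth S f g" and ?r = "ord_rank S0 X"
  have S0S: "S0 \<subseteq> S" using S0 by auto
  have fin0: "finite S0" using fin S0S finite_subset by blast
  have inj0: "inj_on X S0" using inj S0S inj_on_subset by blast
  have K0: "K > 0" using K N by simp
  define Bl where "Bl j = {q \<in> S0. ?r q div K = j}" for j
  have BlS: "Bl j \<subseteq> S0" for j by (auto simp: Bl_def)
  define Q where "Q j c E \<longleftrightarrow> c \<in> E \<and> E \<subseteq> Bl j \<and> (\<forall>e\<in>E. ?dep e = ?dep c) \<and>
      card {e \<in> E. X e < X c} = N \<and> card {e \<in> E. X c < X e} = N" for j c E
  have "\<exists>c E. Q j c E" if j: "(j + 1) * K \<le> card S0" for j
  proof -
    have Blj: "Bl j = {q \<in> S0. ?r q \<in> {j * K..<(j + 1) * K}}"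
      by (simp add: Bl_def nat_div_eq_iff[OF K0])
    have "{j * K..<(j + 1) * K} \<subseteq> {..<card S0}" using j by auto
    then have "card (Bl j) = card {j * K..<(j + 1) * K}"
      unfolding Blj by (rule card_rank_vimage[OF fin0 inj0])
    then have "card (Bl j) = K" by simp
    \<comment> \<open>Only \<open>3 * N\<close> depths occur in \<open>S0\<close>, so the choice of
      \<open>K\<close> forces one of them on \<open>2 * N + 1\<close> points of the block; the odd
      number gives a median with \<open>N\<close> points on each side.\<close>
    then have "card {..<3 * N} * (2 * N) < card (Bl j)" using K N by simp
    moreover have "finite (Bl j)" using BlS fin0 finite_subset by blast
    ultimately obtain d where d: "2 * N < card {q \<in> Bl j. ?dep q = d}"
      using pigeonhole_fibre[of "Bl j" ?dep "{..<3 * N}" "2 * N"] BlS[of j] S0 by auto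
    then obtain E where E: "E \<subseteq> {q \<in> Bl j. ?dep q = d}" "card E = 2 * N + 1" "finite E"
      using obtain_subset_with_card_n[of "2 * N + 1" "{q \<in> Bl j. ?dep q = d}"] by auto
    have "inj_on X E" using E(1) BlS[of j] by (intro inj_on_subset[OF inj0]) auto
    then obtain c where "c \<in> E" "card {e \<in> E. X e < X c} = N" "card {e \<in> E. X c < X e} = N"
      using exists_median[OF E(3) _ E(2)] by blast
    then have "Q j c E" using E(1) by (auto simp: Q_def)
    then show ?thesis by blast
  qed
  then obtain c E where "\<And>j. (j + 1) * K \<le> card S0 \<Longrightarrow> Q j (c j) (E j)" by metis
  then have cE: "c j \<in> E j" "E j \<subseteq> Bl j" "\<And>e. e \<in> E j \<Longrightarrow> ?dep e = ?dep (c j)"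
      "card {e \<in> E j. X e < X (c j)} = N" "card {e \<in> E j. X (c j) < X e} = N"
    if "(j + 1) * K \<le> card S0" for j using that unfolding Q_def by blast+
  define Js where "Js = {j. (j + 1) * K \<le> card S0}"
  define C where "C = c ` Js"
  have CB: "c j \<in> Bl j" if "j \<in> Js" for j using cE(1,2)[of j] that by (auto simp: Js_def)
  then have CS0: "C \<subseteq> S0" using BlS by (auto simp: C_def)
  have CBl: "C \<inter> Bl j \<subseteq> {c j}" for j using CB by (force simp: C_def Bl_def)
  show ?thesis
  proof (intro exI[of _ C] conjI allI impI)
    show "C \<subseteq> S0" by fact
    fix l h t assume "(t + 2) * K \<le> card {p \<in> S0. l < X p \<and> X p \<le> h}"
    from interval_contains_blocks[OF fin0 inj0 K0 this] obtain J where J: "finite J" "card J = t"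
      "\<And>j. j \<in> J \<Longrightarrow> j \<in> Js" "\<And>j. j \<in> J \<Longrightarrow> Bl j \<subseteq> {p \<in> S0. l < X p \<and> X p \<le> h}"
      by (auto simp: Js_def Bl_def)
    have "ord_rank S0 X (c j) div K = j" if "j \<in> J" for j using CB[OF J(3)[OF that]] by (simp add: Bl_def)
    then have "inj_on c J" by (rule inj_on_inverseI)
    then have "t = card (c ` J)" using J by (simp add: card_image)
    also have "\<dots> \<le> card {p \<in> C. l < X p \<and> X p \<le> h}"
    proof (rule card_mono)
      show "finite {p \<in> C. l < X p \<and> X p \<le> h}" using CS0
        by (intro finite_subset[OF _ fin0]) auto
      show "c ` J \<subseteq> {p \<in> C. l < X p \<and> X p \<le> h}"
        proof
        fix p assume "p \<in> c ` J"
        then obtain j where j: "j \<in> J" "p = c j" by blast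
        then show "p \<in> {p \<in> C. l < X p \<and> X p \<le> h}"
          using J(3)[OF j(1)] J(4)[OF j(1)] CB[OF J(3)[OF j(1)]] by (auto simp: C_def)
      qed
    qed
    finally show "t \<le> card {p \<in> C. l < X p \<and> X p \<le> h}" .
  next
    fix a b assume big: "3 * N \<le> card (quad S f g a b)"
    define B where "B = quad S f g a b"
    have fB: "finite B" using fin by (simp add: B_def)
    have BS: "B \<subseteq> S" by (simp add: B_def quad_subset)
    have BI: "x \<in> B \<longleftrightarrow> x \<in> S \<and> a < f x \<and> b < g x" for x
      by (auto simp: B_def quad_def)
    show "N \<le> card (quad S f g a b \<inter> S0 - C)"
    proof (rule ccontr)
      assume "\<not> ?thesis"
      then have few: "card (B \<inter> S0 - C) < N" by (simp add: B_def)
      have fewI: False if "Z \<subseteq> B \<inter> S0 - C" "N \<le> card Z" for Z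
        using card_mono[OF _ that(1)] fB that(2) few by auto
      have "3 * N \<le> card (B \<inter> S0)"
        using shallow_card[OF fin big] by (simp add: B_def S0 Int_def quad_def conj_ac)
      moreover have "card (B \<inter> S0) = card (B \<inter> S0 - C) + card (B \<inter> C)"
      proof -
        have "B \<inter> S0 \<inter> C = B \<inter> C" using CS0 by blast
        then show ?thesis using card_Int_Diff[of "B \<inter> S0" C] fB by simp
      qed
      ultimately have BC: "2 * N \<le> card (B \<inter> C)" using few by linarith
      have deep: "N \<le> ?dep x" if x: "x \<in> B" "x \<in> C" for x
      proof -
        obtain j where j: "j \<in> Js" "x = c j" using x(2) by (auto simp: C_def)
        note J = cE[OF j(1)[unfolded Js_def mem_Collect_eq], folded j(2)]
        have EC: "Z \<inter> C = {}" if "Z \<subseteq> E j" "x \<notin> Z" for Z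
          using that CBl[of j] J(2) j(2) by blast
        have ES: "E j \<subseteq> S" using J(2) BlS S0S by blast
        obtain e where e: "e \<in> E j" "X e < X x" "e \<notin> B"
          using fewI[of "{e \<in> E j. X e < X x}"] J(2,4) BlS[of j] EC[of "{e \<in> E j. X e < X x}"]
            by blast
        obtain e' where e': "e' \<in> E j" "X x < X e'" "e' \<notin> B"
          using fewI[of "{e \<in> E j. X x < X e}"] J(2,5) BlS[of j] EC[of "{e \<in> E j. X x < X e}"]
            by blast
        have eS: "e \<in> S" "e' \<in> S" "x \<in> S" using e(1) e'(1) ES x(1) BS by auto
        have de: "?dep e = ?dep x" "?dep e' = ?dep x" using J(3) e(1) e'(1) by auto
        \<comment> \<open>A missed point to the left of \<open>x\<close> fails by \<open>g\<close>,
          one to the right by \<open>f\<close>: with the other failure, \<open>t1\<close> or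
          \<open>t2\<close> would make \<open>x\<close> dominate it, against equal depth.\<close>
        have "a < f e"
        proof (rule ccontr)
          assume "\<not> ?thesis"
          then have "f e < f x" using x(1) BI by auto
          moreover have "g e < g x" using t1[OF eS(1,3) e(2)] calculation by blast
          ultimately show False using depth_less[OF fin eS(3), of f e g] de by auto
        qed
        then have ge: "g e \<le> b" using e(3) BI eS by auto
        have "b < g e'"
        proof (rule ccontr)
          assume "\<not> ?thesis"
          then have "g e' < g x" using x(1) BI by auto
          moreover have "f e' < f x" using t2[OF eS(2,3) e'(2)] calculation by blast
          ultimately show False using depth_less[OF fin eS(3), of f e' g] de by auto
        qed
        then have fe: "f e' \<le> a" using e'(3) BI eS by auto
        have "card {z \<in> B. X z < X e} \<le> ?dep e"
          using fin BS eS ge BI t2[of e] by (intro card_le_depth) fastforce+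
        moreover have "card {z \<in> B. X e' < X z} \<le> ?dep e'"
          using fin BS eS fe BI t1[of e'] by (intro card_le_depth) fastforce+
        moreover have "B \<inter> C \<subseteq> insert x ({z \<in> B. X z < X e} \<union> {z \<in> B. X e' < X z})"
        proof (rule subsetI, rule ccontr)
          fix z assume "z \<in> B \<inter> C" "z \<notin> insert x ({z \<in> B. X z < X e} \<union> {z \<in> B. X e' < X z})"
          then have z: "z \<in> B" "z \<in> C" "X e \<le> X z" "X z \<le> X e'" "z \<noteq> x" by auto
          then have "?r e \<le> ?r z" "?r z \<le> ?r e'" using ord_rank_mono[OF fin0] by auto
          then have "?r e div K \<le> ?r z div K" "?r z div K \<le> ?r e' div K"
            by (auto intro: div_le_mono)
          moreover have "e \<in> Bl j" "e' \<in> Bl j" using e(1) e'(1) J(2) by auto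
          ultimately have "z \<in> Bl j" using z(2) CS0 by (auto simp: Bl_def)
          then show False using z(2,5) CBl[of j] j(2) by auto
        qed
        then have "card (B \<inter> C) \<le> card (insert x ({z \<in> B. X z < X e} \<union> {z \<in> B. X e' < X z}))"
          using fB by (intro card_mono) auto
        ultimately have "card (B \<inter> C) \<le> 1 + (?dep x + ?dep x)"
          using card_Un_le[of "{z \<in> B. X z < X e}" "{z \<in> B. X e' < X z}"] de
            card_insert_le_m1[of "Suc (?dep x + ?dep x)" "{z \<in> B. X z < X e} \<union> {z \<in> B. X e' < X z}" x]
          by linarith
        \<comment> \<open>For the depth d of \<open>x\<close> this is 2 * N \<le> 1 + 2 * d, and
          parity yields N \<le> d.\<close>
        then show ?thesis using BC by linarith
      qed
      have "N \<le> card {q \<in> B. ?dep q < N}" using shallow_card[OF fin, of N f g a b] big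
        by (simp add: B_def)
      moreover have "{q \<in> B. ?dep q < N} \<subseteq> B \<inter> S0 - C"
        using deep BS N by (force simp: S0)
      ultimately show False using fewI by blast
    qed
  qed
qed

section \<open>Separating two types of quadrants\<close>

text \<open>The set \<open>V\<close> is what the first type keeps, its complement what the second
  type keeps. Demanding \<open>N\<close> points on either side makes separations iterable.\<close>

definition separable :: "nat \<Rightarrow> nat \<Rightarrow> 'a set \<Rightarrow> ('a \<Rightarrow> real) \<Rightarrow> ('a \<Rightarrow> real) \<Rightarrow> ('a \<Rightarrow> real) \<Rightarrow> ('a \<Rightarrow> real) \<Rightarrow> bool" where
  "separable N M S F G f g \<longleftrightarrow> (\<exists>V\<subseteq>S.
     (\<forall>a b. M \<le> card (quad S F G a b) \<longrightarrow> N \<le> card (quad S F G a b \<inter> V)) \<and>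
     (\<forall>a b. M \<le> card (quad S f g a b) \<longrightarrow> N \<le> card (quad S f g a b - V)))"

lemma separableE:
  assumes "separable N M S F G f g"
  obtains V where "V \<subseteq> S"
    "\<And>a b. M \<le> card (quad S F G a b) \<Longrightarrow> N \<le> card (quad S F G a b \<inter> V)"
    "\<And>a b. M \<le> card (quad S f g a b) \<Longrightarrow> N \<le> card (quad S f g a b - V)"
proof -
  from assms show ?thesis unfolding separable_def by (elim exE conjE) (erule that; simp)
qed

lemma separable_swap:
  assumes "separable N M S F G f g"
  shows "separable N M S f g F G"
proof (rule separableE[OF assms])
  fix V assume V: "V \<subseteq> S"
    and "\<And>a b. M \<le> card (quad S F G a b) \<Longrightarrow> N \<le> card (quad S F G a b \<inter> V)"
    and "\<And>a b. M \<le> card (quad S f g a b) \<Longrightarrow> N \<le> card (quad S f g a b - V)"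
  moreover have "quad S F G a b - (S - V) = quad S F G a b \<inter> V"
    "quad S f g a b \<inter> (S - V) = quad S f g a b - V" for a b by (auto simp: quad_def)
  ultimately show ?thesis unfolding separable_def by (intro exI[of _ "S - V"]) auto
qed

lemma separable_commute:
  assumes "separable N M S F G f g"
  shows "separable N M S F G g f"
proof (rule separableE[OF assms])
  fix V assume "V \<subseteq> S"
    and "\<And>a b. M \<le> card (quad S F G a b) \<Longrightarrow> N \<le> card (quad S F G a b \<inter> V)"
    and "\<And>a b. M \<le> card (quad S f g a b) \<Longrightarrow> N \<le> card (quad S f g a b - V)"
  then show ?thesis unfolding separable_def quad_commute[of S g f] by (intro exI[of _ V]) simp
qed

lemma separable_mono:
  assumes "separable N M S F G f g" "M \<le> M'"
  shows "separable N M' S F G f g"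
proof (rule separableE[OF assms(1)])
  fix V assume "V \<subseteq> S"
    and "\<And>a b. M \<le> card (quad S F G a b) \<Longrightarrow> N \<le> card (quad S F G a b \<inter> V)"
    and "\<And>a b. M \<le> card (quad S f g a b) \<Longrightarrow> N \<le> card (quad S f g a b - V)"
  then show ?thesis using assms(2) unfolding separable_def by (intro exI[of _ V]) simp
qed

text \<open>The second type lives on its shallow points \<open>S0\<close> minus a thin transversal
  \<open>C\<close>; the first type gets \<open>C\<close> and all deep points. In the bound,
  \<open>N\<close> pays for deep points, \<open>3 * N\<close> for the points set aside above
  \<open>z\<close>, and the rest yields \<open>4 * N\<close> points of \<open>C\<close>, at most
  \<open>3 * N\<close> of which the quadrant misses.\<close>

lemma separable_nested:
  fixes F G f g :: "'a \<Rightarrow> real"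
  assumes fin: "finite S" and inj: "inj_on F S" and N: "N > 0"
    and t1: "\<And>p q. \<lbrakk>p \<in> S; q \<in> S; F p < F q; f p < f q\<rbrakk> \<Longrightarrow> g p < g q"
    and t2: "\<And>p q. \<lbrakk>p \<in> S; q \<in> S; F q < F p; g p < g q\<rbrakk> \<Longrightarrow> f p < f q"
    and h: "(\<forall>p\<in>S. \<forall>q\<in>S. F p < F q \<longrightarrow> G p < G q \<longrightarrow> f q < f p \<and> g q < g p) \<or>
            (\<forall>p\<in>S. \<forall>q\<in>S. F p < F q \<longrightarrow> G p < G q \<longrightarrow> f p < f q \<and> g p < g q)"
    and K: "K = 3 * N * (2 * N + 1)"
  shows "separable N (4 * N + (4 * N + 2) * K) S F G f g"
proof -
  define S0 where "S0 = {q \<in> S. depth S f g q < 3 * N}"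
  obtain C where C: "C \<subseteq> S0"
    "\<And>l h t. (t + 2) * K \<le> card {p \<in> S0. l < F p \<and> F p \<le> h} \<Longrightarrow> t \<le> card {p \<in> C. l < F p \<and> F p \<le> h}"
    "\<And>a b. 3 * N \<le> card (quad S f g a b) \<Longrightarrow> N \<le> card (quad S f g a b \<inter> S0 - C)"
    using thin_transversal[OF fin inj N t1 t2 S0_def K] by blast
  have S0S: "S0 \<subseteq> S" by (auto simp: S0_def)
  have fin0: "finite S0" using fin S0S finite_subset by blast
  let ?V = "S - S0 \<union> C"
  have "N \<le> card (quad S F G a b \<inter> ?V)" if big: "4 * N + (4 * N + 2) * K \<le> card (quad S F G a b)" for a b
  proof -
    define A where "A = quad S F G a b"
    have fA: "finite A" using fin by (simp add: A_def)
    have AS: "A \<subseteq> S" by (simp add: A_def quad_subset)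
    have AI: "x \<in> A \<longleftrightarrow> x \<in> S \<and> a < F x \<and> b < G x" for x
      by (auto simp: A_def quad_def)
    show ?thesis
    proof (cases "N \<le> card (A - S0)")
      case True
      also have "card (A - S0) \<le> card (A \<inter> ?V)" using fA AS by (intro card_mono) auto
      finally show ?thesis by (simp add: A_def)
    next
      case False
      have "card A = card (A - S0) + card (A \<inter> S0)" using fA
        using card_Int_Diff[of A S0] by simp
      then have big0: "3 * N + (4 * N + 2) * K \<le> card (A \<inter> S0)" using big False
        by (simp add: A_def)
      have injA: "inj_on F (A \<inter> S0)" using inj AS by (auto intro: inj_on_subset)
      have "3 * N < card (A \<inter> S0)" using big0 K N by (simp add: algebra_simps)
      \<comment> \<open>Setting aside the \<open>3 * N\<close> points of largest \<open>F\<close>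
        leaves an interval ending at \<open>z\<close>; each alternative of \<open>h\<close> uses
        this number to bound the part of the interval outside the quadrant.\<close>
      then have "3 * N \<in> ord_rank (A \<inter> S0) (\<lambda>x. - F x) ` (A \<inter> S0)"
        using ord_rank_bij[of "A \<inter> S0" "\<lambda>x. - F x"] injA fA
          by (auto simp: bij_betw_def inj_on_def)
      then obtain z where z: "z \<in> A" "z \<in> S0" "card {p \<in> A \<inter> S0. F z < F p} = 3 * N"
        by (auto simp: ord_rank_def)
      let ?I = "{p \<in> S0. a < F p \<and> F p \<le> F z}"
      have "A \<inter> S0 \<subseteq> {p \<in> A \<inter> S0. F z < F p} \<union> ?I" using AI by auto
      then have "card (A \<inter> S0) \<le> card ({p \<in> A \<inter> S0. F z < F p} \<union> ?I)"
        using fin0 by (intro card_mono) auto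
      also have "\<dots> \<le> 3 * N + card ?I"
        using z(3) card_Un_le[of "{p \<in> A \<inter> S0. F z < F p}" ?I] by simp
      finally have "(4 * N + 2) * K \<le> card ?I" using big0 by linarith
      then have CI: "4 * N \<le> card {p \<in> C. a < F p \<and> F p \<le> F z}" using C(2) by blast
      have "card (?I - A) \<le> 3 * N"
      proof -
        have gz: "G p < G z" "F p < F z" if "p \<in> ?I - A" for p
        proof -
          show "G p < G z" using that AI z(1) S0S by (force simp: not_less)
          moreover have "p \<noteq> z" using calculation by auto
          ultimately show "F p < F z" using that inj z(2) S0S by (auto dest: inj_onD simp: less_le)
        qed
        from h show ?thesis
        proof
          \<comment> \<open>A missed point is dominated by \<open>z\<close> in the first type, so it
            dominates \<open>z\<close> in the second; as \<open>z\<close> is shallow, there are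
            fewer than \<open>3 * N\<close> of them.\<close>
          assume h1: "\<forall>p\<in>S. \<forall>q\<in>S. F p < F q \<longrightarrow> G p < G q \<longrightarrow> f q < f p \<and> g q < g p"
          have "card (?I - A) \<le> depth S f g z"
          proof (intro card_le_depth fin conjI)
            show "?I - A \<subseteq> S" using S0S by auto
            fix p assume p: "p \<in> ?I - A"
            then have "p \<in> S" "z \<in> S" using S0S z(2) by auto
            then show "f z < f p" "g z < g p" using h1 gz[OF p] by blast+
          qed
          then show ?thesis using z(2) by (simp add: S0_def)
        next
          \<comment> \<open>A missed point would be dominated in both types by all
            \<open>3 * N\<close> points set aside, against its being shallow.\<close>
          assume h2: "\<forall>p\<in>S. \<forall>q\<in>S. F p < F q \<longrightarrow> G p < G q \<longrightarrow> f p < f q \<and> g p < g q"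
          have "?I - A = {}"
          proof (rule ccontr)
            assume "?I - A \<noteq> {}"
            then obtain p where p: "p \<in> ?I - A" by blast
            have pS: "p \<in> S" using p S0S by auto
            have "G p \<le> b" using p AI pS by (auto simp: not_less)
            then have "card {q \<in> A \<inter> S0. F z < F q} \<le> depth S f g p"
              using fin S0S h2 gz[OF p] pS AI by (intro card_le_depth) fastforce+
            then show False using z(3) p by (auto simp: S0_def)
          qed
          then show ?thesis by (metis card.empty zero_le)
        qed
      qed
      moreover have "{p \<in> C. a < F p \<and> F p \<le> F z} \<subseteq> (?I - A) \<union> (A \<inter> ?V)" using C(1) by auto
      then have "card {p \<in> C. a < F p \<and> F p \<le> F z} \<le> card ((?I - A) \<union> (A \<inter> ?V))"
        using fin0 fA by (intro card_mono) auto
      ultimately have "4 * N \<le> 3 * N + card (A \<inter> ?V)"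
        using CI card_Un_le[of "?I - A" "A \<inter> ?V"] by linarith
      then show ?thesis by (simp add: A_def)
    qed
  qed
  moreover have "N \<le> card (quad S f g a b - ?V)" if "4 * N + (4 * N + 2) * K \<le> card (quad S f g a b)" for a b
  proof -
    have "quad S f g a b - ?V = quad S f g a b \<inter> S0 - C" using quad_subset[of S f g a b] by auto
    then show ?thesis using C(3)[of a b] that by auto
  qed
  ultimately show ?thesis unfolding separable_def using C(1) S0S by (intro exI[of _ ?V]) auto
qed

text \<open>The common shallow points \<open>L\<close> of both types are among the first \<open>6 * N\<close> points by decreasing \<open>F\<close>, so
  a larger quadrant meets \<open>L\<close> in a set cut off by \<open>G\<close> alone.\<close>

lemma separable_disjoint:
  fixes F G f g :: "'a \<Rightarrow> real"
  assumes fin: "finite S" and injG: "inj_on G S"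
    and d: "\<And>p q. \<lbrakk>p \<in> S; q \<in> S; F q < F p; G p < G q\<rbrakk> \<Longrightarrow> f q < f p \<and> g q < g p"
  shows "separable N (6 * N + 1) S F G f g"
proof -
  define Wsh where "Wsh = {q \<in> S. depth S f g q < 3 * N}"
  define L where "L = {q \<in> Wsh. depth S F G q < 3 * N}"
  have sub: "L \<subseteq> Wsh" "Wsh \<subseteq> S" by (auto simp: Wsh_def L_def)
  have fL: "finite L" using fin sub finite_subset by (metis)
  obtain T where T: "T \<subseteq> L" "card T = min N (card L)" "\<forall>x\<in>T. \<forall>y\<in>L - T. G y \<le> G x"
    using top_subset[OF fL, of "min N (card L)" G] by auto
  have fT: "finite T" using T(1) fL finite_subset by blast
  have early: "card {p \<in> S. F q < F p} < 6 * N" if q: "q \<in> L" for q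
  proof -
    have qS: "q \<in> S" using q sub by auto
    \<comment> \<open>A point with larger \<open>F\<close> either dominates \<open>q\<close> in the
      first type or, by \<open>d\<close>, in the second; both depths are below
      \<open>3 * N\<close>.\<close>
    have "{p \<in> S. F q < F p} \<subseteq> {p \<in> S. F q < F p \<and> G q < G p} \<union> {p \<in> S. f q < f p \<and> g q < g p}"
    proof
      fix p assume "p \<in> {p \<in> S. F q < F p}"
      then have p: "p \<in> S" "F q < F p" "p \<noteq> q" by auto
      then have "G p \<noteq> G q" using injG qS by (auto dest: inj_onD)
      then show "p \<in> {p \<in> S. F q < F p \<and> G q < G p} \<union> {p \<in> S. f q < f p \<and> g q < g p}"
        using d[OF p(1) qS p(2)] p by (auto simp: neq_iff)
    qed
    then have "card {p \<in> S. F q < F p} \<le> card ({p \<in> S. F q < F p \<and> G q < G p} \<union> {p \<in> S. f q < f p \<and> g q < g p})"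
      using fin by (intro card_mono) auto
    also have "\<dots> \<le> depth S F G q + depth S f g q" unfolding depth_def by (rule card_Un_le)
    also have "\<dots> < 6 * N" using q by (auto simp: L_def Wsh_def)
    finally show ?thesis .
  qed
  let ?V = "S - Wsh \<union> T"
  have "N \<le> card (quad S F G a b \<inter> ?V)" if big: "6 * N + 1 \<le> card (quad S F G a b)" for a b
  proof -
    define A where "A = quad S F G a b"
    have fA: "finite A" using fin by (simp add: A_def)
    have AS: "A \<subseteq> S" by (simp add: A_def quad_subset)
    have AI: "x \<in> A \<longleftrightarrow> x \<in> S \<and> a < F x \<and> b < G x" for x
      by (auto simp: A_def quad_def)
    show ?thesis
    proof (cases "N \<le> card (A - Wsh)")
      case True
      also have "card (A - Wsh) \<le> card (A \<inter> ?V)" using fA AS by (intro card_mono) auto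
      finally show ?thesis by (simp add: A_def)
    next
      case False
      have "3 * N \<le> card {q \<in> A. depth S F G q < 3 * N}"
        using shallow_card[OF fin, of "3 * N" F G a b] big by (simp add: A_def)
      also have "\<dots> \<le> card ((A - Wsh) \<union> (A \<inter> L))"
        using fA AS by (intro card_mono) (auto simp: L_def)
      also have "\<dots> \<le> card (A - Wsh) + card (A \<inter> L)" by (rule card_Un_le)
      finally have AL: "N \<le> card (A \<inter> L)" using False by linarith
      also have "card (A \<inter> L) \<le> card L" using fL by (intro card_mono) auto
      finally have cT: "card T = N" using T(2) by simp
      have Fl: "a < F l" if l: "l \<in> L" for l
      proof (rule ccontr)
        assume "\<not> ?thesis"
        then have Fla: "F l \<le> a" by simp
        have "A \<subseteq> {p \<in> S. F l < F p}"
        proof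
          fix x assume "x \<in> A"
          then show "x \<in> {p \<in> S. F l < F p}" using AI[of x] Fla by simp
        qed
        then have "card A \<le> card {p \<in> S. F l < F p}" using fin by (intro card_mono) auto
        then show False using early[OF l] big by (simp add: A_def)
      qed
      have "T \<subseteq> A"
      proof (rule ccontr)
        assume "\<not> T \<subseteq> A"
        then obtain t where t: "t \<in> T" "t \<notin> A" by blast
        then have "G t \<le> b" using AI Fl[of t] T(1) sub by (auto simp: not_less)
        then have "A \<inter> L \<subseteq> T - {t}" using T(3) t AI by force
        then have "card (A \<inter> L) \<le> card (T - {t})" using fT by (intro card_mono) auto
        also have "\<dots> < card T" using t(1) fT by (intro psubset_card_mono) auto
        finally show False using AL cT by linarith
      qed
      then have "T \<subseteq> A \<inter> ?V" by auto
      then have "card T \<le> card (A \<inter> ?V)" using fA by (intro card_mono) auto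
      then show ?thesis using cT by (simp add: A_def)
    qed
  qed
  moreover have "N \<le> card (quad S f g a b - ?V)" if big: "6 * N + 1 \<le> card (quad S f g a b)" for a b
  proof -
    \<comment> \<open>The second type starts with \<open>3 * N\<close> shallow points and loses at
      most the \<open>N\<close> points of \<open>T\<close>.\<close>
    let ?B = "{q \<in> quad S f g a b. depth S f g q < 3 * N}"
    have "3 * N \<le> card ?B" using shallow_card[OF fin, of "3 * N" f g a b] big by simp
    also have "\<dots> \<le> card ((quad S f g a b - ?V) \<union> T)"
      using fin fT quad_subset[of S f g a b] by (intro card_mono) (auto simp: Wsh_def)
    also have "\<dots> \<le> card (quad S f g a b - ?V) + card T" by (rule card_Un_le)
    finally show ?thesis using T(2) by linarith
  qed
  ultimately show ?thesis unfolding separable_def using T(1) sub by (intro exI[of _ ?V]) auto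
qed

text \<open>The points of \<open>R\<close> belong to \<open>T\<close> only at one time.  Among those sharing also the time at which they enter
  \<open>U\<close>, the \<open>N\<close> lowest ones by \<open>f\<close> can be given away: any \<open>U i\<close> containing one of them contains the \<open>N\<close>
  higher ones, which stay.\<close>

lemma swap_select:
  fixes f :: "'a \<Rightarrow> real"
  assumes fin: "finite S" and R: "R \<subseteq> S" and injf: "inj_on f S" and N: "N > 0"
    and T: "\<And>i q. q \<in> R \<Longrightarrow> q \<in> T i \<Longrightarrow> i = jT q"
    and near: "\<And>i q. q \<in> R \<Longrightarrow> q \<in> T i \<Longrightarrow> jT q \<le> jU q + 1 \<and> jU q \<le> jT q + (1 :: nat)"
    and U1: "\<And>i q. q \<in> U i \<Longrightarrow> jU q \<le> i"
    and U2: "\<And>i q q'. \<lbrakk>q \<in> U i; q' \<in> S; jU q' \<le> i; f q < f q'\<rbrakk> \<Longrightarrow> q' \<in> U i"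
  shows "\<exists>C\<subseteq>R. (\<forall>i. 6 * N \<le> card (T i \<inter> R) \<longrightarrow> N \<le> card (T i \<inter> C)) \<and>
               (\<forall>i. U i \<inter> C \<noteq> {} \<longrightarrow> N \<le> card (U i \<inter> R - C))"
proof -
  have finR: "finite R" using R fin finite_subset by blast
  define Q where "Q i E H \<longleftrightarrow> E \<subseteq> T i \<inter> R \<and> H \<subseteq> E \<and> card (E - H) = N \<and> card H = N \<and>
      (\<forall>c\<in>E. \<forall>y\<in>E. jU c = jU y) \<and> (\<forall>y\<in>H. \<forall>c\<in>E - H. f c < f y)" for i E H
  have "\<exists>E H. Q i E H" if big: "6 * N \<le> card (T i \<inter> R)" for i
  proof -
    let ?B = "T i \<inter> R"
    have fB: "finite ?B" using finR by simp
    \<comment> \<open>Membership in \<open>T i\<close> fixes \<open>jT\<close> to be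
      \<open>i\<close>, so \<open>near\<close> leaves three values for \<open>jU\<close>, and
      \<open>6 * N\<close> points contain \<open>2 * N\<close> that share one.\<close>
    have "jU q \<in> {i - 1..i + 1}" if "q \<in> ?B" for q using near[of q i] T[of q i] that by auto
    moreover have "card {i - 1..i + 1} \<le> 3" by simp
    then have "card {i - 1..i + 1} * (2 * N - 1) < card ?B"
      using big N mult_le_mono1[of "card {i - 1..i + 1}" 3 "2 * N - 1"] by linarith
    ultimately obtain d where "2 * N - 1 < card {q \<in> ?B. jU q = d}"
      using pigeonhole_fibre[OF fB, of jU "{i - 1..i + 1}" "2 * N - 1"] by blast
    then have "2 * N \<le> card {q \<in> ?B. jU q = d}" by linarith
    then obtain E where E: "E \<subseteq> {q \<in> ?B. jU q = d}" "card E = 2 * N" "finite E"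
      by (rule obtain_subset_with_card_n)
    obtain H where H: "H \<subseteq> E" "card H = N" "\<forall>x\<in>H. \<forall>y\<in>E - H. f y \<le> f x"
      using top_subset[OF E(3), of N f] E(2) by auto
    have "card (E - H) = N" using H E by (simp add: card_Diff_subset finite_subset)
    moreover have "f c < f y" if "y \<in> H" "c \<in> E - H" for y c
    proof -
      have "c \<noteq> y" "c \<in> S" "y \<in> S" using that E(1) H(1) R by auto
      then have "f c \<noteq> f y" using injf by (auto dest: inj_onD)
      then show ?thesis using H(3) that by force
    qed
    ultimately have "Q i E H" unfolding Q_def using E(1) H(1,2) by auto
    then show ?thesis by blast
  qed
  then obtain E H where EH: "\<And>i. 6 * N \<le> card (T i \<inter> R) \<Longrightarrow> Q i (E i) (H i)"
    by metis
  define C where "C = (\<Union>i\<in>{i. 6 * N \<le> card (T i \<inter> R)}. E i - H i)"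
  have CR: "C \<subseteq> R" using EH by (fastforce simp: C_def Q_def)
  have fC: "finite C" using CR finR finite_subset by blast
  show ?thesis
  proof (intro exI[of _ C] conjI allI impI CR)
    fix i assume i: "6 * N \<le> card (T i \<inter> R)"
    have "E i - H i \<subseteq> T i \<inter> C" using EH[OF i] i by (auto simp: C_def Q_def)
    then have "card (E i - H i) \<le> card (T i \<inter> C)" using fC by (intro card_mono) auto
    then show "N \<le> card (T i \<inter> C)" using EH[OF i] by (simp add: Q_def)
  next
    fix i' assume "U i' \<inter> C \<noteq> {}"
    then obtain c i where c: "c \<in> U i'" "c \<in> E i - H i" and i: "6 * N \<le> card (T i \<inter> R)"
      by (auto simp: C_def)
    note q = EH[OF i, unfolded Q_def]
    have "H i \<subseteq> U i' \<inter> R - C"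
    proof
      fix y assume y: "y \<in> H i"
      have yR: "y \<in> R" "y \<in> T i" "y \<in> S" using q y R by auto
      have "jU y \<le> i'" using U1[OF c(1)] q y c(2) by (metis DiffD1 subsetD)
      moreover have "f c < f y" using q y c(2) by blast
      ultimately have "y \<in> U i'" using U2[OF c(1) yR(3)] by blast
      \<comment> \<open>Since \<open>y\<close> belongs to no other \<open>T k\<close>, only the
        choice made for \<open>i\<close> could have given it away.\<close>
      moreover have "y \<notin> C"
      proof
        assume "y \<in> C"
        then obtain k where k: "6 * N \<le> card (T k \<inter> R)" "y \<in> E k - H k" by (auto simp: C_def)
        then have "y \<in> T k" using EH[OF k(1)] by (auto simp: Q_def)
        then have "k = i" using T[OF yR(1)] yR(2) by metis
        then show False using k(2) y by simp
      qed
      ultimately show "y \<in> U i' \<inter> R - C" using yR(1) by simp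
    qed
    then have "card (H i) \<le> card (U i' \<inter> R - C)" using finR by (intro card_mono) auto
    then show "N \<le> card (U i' \<inter> R - C)" using q by simp
  qed
qed

text \<open>Here \<open>T i\<close> and \<open>U i\<close> stand for the leaders of two sweeps, and
  \<open>jT\<close>, \<open>jU\<close> for the times of entry. By \<open>short\<close> each point
  occurs in one of the two families at its entry time only, and it is first assigned to the other
  family, where it may last. With \<open>7 * N\<close> points, a set having fewer than
  \<open>N\<close> of its own colour has \<open>6 * N\<close> of the other, and
  \<open>swap_select\<close> gives it \<open>N\<close> of those without starving any set that loses
  points.\<close>

lemma swap_colouring:
  fixes G f :: "'a \<Rightarrow> real" and jT jU :: "'a \<Rightarrow> nat"
  assumes fin: "finite S" and inj: "inj_on G S" "inj_on f S" and N: "N > 0"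
    and TS: "\<And>i. T i \<subseteq> S" and US: "\<And>i. U i \<subseteq> S"
    and T1: "\<And>i q. q \<in> T i \<Longrightarrow> jT q \<le> i"
    and T2: "\<And>i q q'. \<lbrakk>q \<in> T i; q' \<in> S; jT q' \<le> i; G q < G q'\<rbrakk> \<Longrightarrow> q' \<in> T i"
    and U1: "\<And>i q. q \<in> U i \<Longrightarrow> jU q \<le> i"
    and U2: "\<And>i q q'. \<lbrakk>q \<in> U i; q' \<in> S; jU q' \<le> i; f q < f q'\<rbrakk> \<Longrightarrow> q' \<in> U i"
    and near: "\<And>i i' q. \<lbrakk>q \<in> T i; q \<in> U i'\<rbrakk> \<Longrightarrow> jT q \<le> jU q + 1 \<and> jU q \<le> jT q + 1"
    and short: "\<And>i i' q. \<lbrakk>q \<in> T i; q \<in> U i'\<rbrakk> \<Longrightarrow> i = jT q \<or> i' = jU q"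
  shows "\<exists>V\<subseteq>S. (\<forall>i. 7 * N \<le> card (T i) \<longrightarrow> N \<le> card (T i \<inter> V)) \<and>
                (\<forall>i. 7 * N \<le> card (U i) \<longrightarrow> N \<le> card (U i - V))"
proof -
  define VB where "VB = {q \<in> S. (\<exists>i. q \<in> T i) \<and> (\<forall>i. q \<in> U i \<longrightarrow> i = jU q)}"
  define WB where "WB = S - VB"
  have sub: "VB \<subseteq> S" "WB \<subseteq> S" by (auto simp: VB_def WB_def)
  have split: "card A = card (A \<inter> VB) + card (A \<inter> WB)" if "A \<subseteq> S" for A
  proof -
    have "A - VB = A \<inter> WB" using that by (auto simp: WB_def)
    then show ?thesis using card_Int_Diff[of A VB] finite_subset[OF that fin] by simp
  qed
  have WT: "i = jT q" "jT q \<le> jU q + 1 \<and> jU q \<le> jT q + 1" if q: "q \<in> WB" "q \<in> T i" for q i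
  proof -
    obtain i' where i': "q \<in> U i'" "i' \<noteq> jU q" using q unfolding WB_def VB_def by blast
    show "i = jT q" using short[OF q(2) i'(1)] i'(2) by simp
    show "jT q \<le> jU q + 1 \<and> jU q \<le> jT q + 1" using near[OF q(2) i'(1)] .
  qed
  have VU: "i = jU q" "jU q \<le> jT q + 1 \<and> jT q \<le> jU q + 1" if q: "q \<in> VB" "q \<in> U i" for q i
  proof -
    show "i = jU q" using q by (auto simp: VB_def)
    obtain k where "q \<in> T k" using q(1) by (auto simp: VB_def)
    then show "jU q \<le> jT q + 1 \<and> jT q \<le> jU q + 1" using near[OF _ q(2)] by blast
  qed
  obtain C where C: "C \<subseteq> WB" "\<forall>i. 6 * N \<le> card (T i \<inter> WB) \<longrightarrow> N \<le> card (T i \<inter> C)"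
      "\<forall>i. U i \<inter> C \<noteq> {} \<longrightarrow> N \<le> card (U i \<inter> WB - C)"
  proof -
    have "\<exists>C\<subseteq>WB. (\<forall>i. 6 * N \<le> card (T i \<inter> WB) \<longrightarrow> N \<le> card (T i \<inter> C)) \<and>
        (\<forall>i. U i \<inter> C \<noteq> {} \<longrightarrow> N \<le> card (U i \<inter> WB - C))"
      by (rule swap_select[where jT = jT and jU = jU and f = f and S = S]) (fact fin sub inj N WT U1 U2)+
    then show ?thesis by (elim exE conjE) (rule that)
  qed
  obtain C' where C': "C' \<subseteq> VB" "\<forall>i. 6 * N \<le> card (U i \<inter> VB) \<longrightarrow> N \<le> card (U i \<inter> C')"
      "\<forall>i. T i \<inter> C' \<noteq> {} \<longrightarrow> N \<le> card (T i \<inter> VB - C')"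
  proof -
    have "\<exists>C\<subseteq>VB. (\<forall>i. 6 * N \<le> card (U i \<inter> VB) \<longrightarrow> N \<le> card (U i \<inter> C)) \<and>
        (\<forall>i. T i \<inter> C \<noteq> {} \<longrightarrow> N \<le> card (T i \<inter> VB - C))"
      by (rule swap_select[where jT = jU and jU = jT and f = G and S = S]) (fact fin sub inj N VU T1 T2)+
    then show ?thesis by (elim exE conjE) (rule that)
  qed
  \<comment> \<open>Both exchanges are carried out at once: they take from disjoint classes, so
    neither disturbs what the other one leaves behind.\<close>
  define V where "V = (VB - C') \<union> C"
  have mono: "N \<le> card B" if "N \<le> card A" "A \<subseteq> B" "B \<subseteq> S" for A B
    using that card_mono[of B A] finite_subset[OF _ fin] by fastforce
  have disj: "VB \<inter> WB = {}" by (auto simp: WB_def)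
  show ?thesis
  proof (intro exI[of _ V] conjI allI impI)
    show "V \<subseteq> S" using sub C(1) by (auto simp: V_def)
    fix i assume big: "7 * N \<le> card (T i)"
    have TV: "T i \<inter> V \<subseteq> S" using TS by auto
    show "N \<le> card (T i \<inter> V)"
    proof (cases "T i \<inter> C' = {}")
      case False
      then have "N \<le> card (T i \<inter> VB - C')" using C'(3) by blast
      then show ?thesis by (rule mono[OF _ _ TV]) (auto simp: V_def)
    next
      case True
      show ?thesis
      proof (cases "N \<le> card (T i \<inter> VB)")
        case True
        then show ?thesis by (rule mono[OF _ _ TV]) (use \<open>T i \<inter> C' = {}\<close> in \<open>auto simp: V_def\<close>)
      next
        case False
        then have "6 * N \<le> card (T i \<inter> WB)" using split[OF TS[of i]] big by linarith
        then have "N \<le> card (T i \<inter> C)" using C(2) by blast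
        then show ?thesis by (rule mono[OF _ _ TV]) (auto simp: V_def)
      qed
    qed
  next
    fix i assume big: "7 * N \<le> card (U i)"
    have UV: "U i - V \<subseteq> S" using US by auto
    show "N \<le> card (U i - V)"
    proof (cases "U i \<inter> C = {}")
      case False
      then have "N \<le> card (U i \<inter> WB - C)" using C(3) by blast
      then show ?thesis by (rule mono[OF _ _ UV]) (use disj in \<open>auto simp: V_def\<close>)
    next
      case True
      show ?thesis
      proof (cases "N \<le> card (U i \<inter> WB)")
        case True
        then show ?thesis
          by (rule mono[OF _ _ UV]) (use disj \<open>U i \<inter> C = {}\<close> in \<open>auto simp: V_def\<close>)
      next
        case False
        then have "6 * N \<le> card (U i \<inter> VB)" using split[OF US[of i]] big by linarith
        then have "N \<le> card (U i \<inter> C')" using C'(2) by blast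
        then show ?thesis
          by (rule mono[OF _ _ UV]) (use disj C(1) C'(1) in \<open>auto simp: V_def\<close>)
      qed
    qed
  qed
qed

text \<open>Checkpoints of a sweep by decreasing \<open>F\<close>, with \<open>K\<close> points between any two.  The leaders are the top
  \<open>r\<close> by \<open>G\<close> among the points swept so far; any large quadrant contains the leaders of a checkpoint.\<close>

definition swept :: "'a set \<Rightarrow> ('a \<Rightarrow> real) \<Rightarrow> nat \<Rightarrow> nat \<Rightarrow> 'a set" where
  "swept S F K i = {p \<in> S. ord_rank S (\<lambda>x. - F x) p < i * K}"

text \<open>Incomplete checkpoints have no leaders, so a nonempty set of leaders is always taken
  among exactly \<open>i * K\<close> swept points when \<open>F\<close> is injective; the counting
  of late points relies on this.\<close>

definition leaders :: "'a set \<Rightarrow> ('a \<Rightarrow> real) \<Rightarrow> ('a \<Rightarrow> real) \<Rightarrow> nat \<Rightarrow> nat \<Rightarrow> nat \<Rightarrow> 'a set" where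
  "leaders S F G K r i = (if i * K \<le> card S
     then {q \<in> swept S F K i. card {p \<in> swept S F K i. G q < G p} < r} else {})"

text \<open>The first checkpoint by which \<open>q\<close> is swept; the \<open>+ 1\<close> is there
  because checkpoint 0 is empty.\<close>

definition step :: "'a set \<Rightarrow> ('a \<Rightarrow> real) \<Rightarrow> nat \<Rightarrow> 'a \<Rightarrow> nat" where
  "step S F K q = ord_rank S (\<lambda>x. - F x) q div K + 1"

lemma swept_iff: "K > 0 \<Longrightarrow> q \<in> swept S F K i \<longleftrightarrow> q \<in> S \<and> step S F K q \<le> i"
  by (auto simp: swept_def step_def div_less_iff_less_mult Suc_le_eq)

lemma swept_subset: "swept S F K i \<subseteq> S"
  by (auto simp: swept_def)

lemma card_swept:
  assumes "finite S" "inj_on F S" "i * K \<le> card S"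
  shows "card (swept S F K i) = i * K"
proof -
  have "inj_on (\<lambda>x. - F x) S" using assms(2) by (auto simp: inj_on_def)
  then show ?thesis using card_rank_vimage[OF assms(1), of "\<lambda>x. - F x" "{..<i * K}"] assms(3)
    by (simp add: swept_def)
qed

lemma leaders_subset: "leaders S F G K r i \<subseteq> S"
  by (auto simp: leaders_def swept_def)

lemma leadersD:
  assumes "q \<in> leaders S F G K r i"
  shows "q \<in> swept S F K i" "i * K \<le> card S" "card {p \<in> swept S F K i. G q < G p} < r"
  using assms by (auto simp: leaders_def split: if_splits)

lemma leaders_up:
  assumes "finite S" "K > 0" "q \<in> leaders S F G K r i" "q' \<in> S" "step S F K q' \<le> i" "G q < G q'"
  shows "q' \<in> leaders S F G K r i"
proof -
  have "q' \<in> swept S F K i" using assms by (simp add: swept_iff)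
  moreover have "card {p \<in> swept S F K i. G q' < G p} \<le> card {p \<in> swept S F K i. G q < G p}"
    using assms(1,6) swept_subset[of S F K i] by (intro card_mono) (auto intro: finite_subset)
  ultimately show ?thesis using leadersD[OF assms(3)] by (simp add: leaders_def)
qed

lemma card_leaders:
  assumes "finite S" "inj_on F S" "r \<le> K" "1 \<le> i" "i * K \<le> card S"
  shows "r \<le> card (leaders S F G K r i)"
proof -
  have "r \<le> card (swept S F K i)" using card_swept[OF assms(1,2,5)] assms(3,4)
    by (metis mult_le_mono mult_1 order_trans le_refl)
  then show ?thesis using ord_rank_less_card[of "swept S F K i" r G] assms(1,5) swept_subset[of S F K i]
    by (auto simp: leaders_def intro: finite_subset)
qed

text \<open>Dominators have larger \<open>F\<close>, so they are swept no later than
  \<open>q\<close> and compete with it.\<close>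

lemma leaders_depth:
  assumes "finite S" "q \<in> leaders S F G K r i"
  shows "depth S F G q < r"
proof -
  have "{p \<in> S. F q < F p \<and> G q < G p} \<subseteq> {p \<in> swept S F K i. G q < G p}"
  proof
    fix p assume p: "p \<in> {p \<in> S. F q < F p \<and> G q < G p}"
    then have "ord_rank S (\<lambda>x. - F x) p \<le> ord_rank S (\<lambda>x. - F x) q"
      by (intro ord_rank_mono assms(1)) auto
    then show "p \<in> {p \<in> swept S F K i. G q < G p}"
      using p leadersD(1)[OF assms(2)] by (auto simp: swept_def)
  qed
  then have "depth S F G q \<le> card {p \<in> swept S F K i. G q < G p}"
    unfolding depth_def using assms(1) swept_subset[of S F K i]
    by (intro card_mono) (auto intro: finite_subset)
  then show ?thesis using leadersD(3)[OF assms(2)] by simp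
qed

text \<open>Take the last checkpoint inside the half-plane given by \<open>a\<close>; fewer than
  \<open>K\<close> points of the half-plane are still unswept. A leader outside the quadrant would
  be too low in \<open>G\<close>, hence below all \<open>r + K\<close> quadrant points, at least
  \<open>r\<close> of which are swept.\<close>

lemma leaders_in_quad:
  assumes fin: "finite S" and inj: "inj_on F S" and K: "K > 0"
    and big: "r + K \<le> card (quad S F G a b)"
  shows "\<exists>i\<ge>1. i * K \<le> card S \<and> leaders S F G K r i \<subseteq> quad S F G a b"
proof -
  define A where "A = quad S F G a b"
  have fA: "finite A" using fin by (simp add: A_def)
  have AI: "x \<in> A \<longleftrightarrow> x \<in> S \<and> a < F x \<and> b < G x" for x
    by (auto simp: A_def quad_def)
  define H where "H = {p \<in> S. a < F p}"
  have fH: "finite H" and HS: "H \<subseteq> S" and AH: "A \<subseteq> H" using fin AI by (auto simp: H_def)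
  define i where "i = card H div K"
  have AleH: "card A \<le> card H" using fH AH by (rule card_mono)
  have "K \<le> card H" using AleH big by (simp add: A_def)
  then have i1: "1 \<le> i" using K by (simp add: i_def Suc_le_eq div_greater_zero_iff)
  have iH: "i * K \<le> card H" "card H < i * K + K"
    using nat_div_eq_iff[OF K, of "card H" i] by (auto simp: i_def)
  have iS: "i * K \<le> card S" using iH(1) card_mono[OF fin HS] by linarith
  have sH: "swept S F K i \<subseteq> H"
  proof
    fix p assume p: "p \<in> swept S F K i"
    show "p \<in> H"
    proof (rule ccontr)
      assume "p \<notin> H"
      then have "F p \<le> a" using p swept_subset[of S F K i] by (auto simp: H_def)
      then have "H \<subseteq> {x \<in> S. - F x < - F p}" by (auto simp: H_def)
      then have "card H \<le> ord_rank S (\<lambda>x. - F x) p" unfolding ord_rank_def using fin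
        by (intro card_mono) auto
      then show False using p iH(1) by (simp add: swept_def)
    qed
  qed
  have rest: "card (H - swept S F K i) < K"
    using card_Diff_subset[OF _ sH] card_swept[OF fin inj iS] finite_subset[OF sH fH] iH by linarith
  have "leaders S F G K r i \<subseteq> A"
  proof
    fix q assume q: "q \<in> leaders S F G K r i"
    show "q \<in> A"
    proof (rule ccontr)
      assume "q \<notin> A"
      moreover have "q \<in> H" using leadersD(1)[OF q] sH by blast
      ultimately have Gq: "G q \<le> b" using AI by (auto simp: H_def)
      have "A \<subseteq> {p \<in> swept S F K i. G q < G p} \<union> (H - swept S F K i)"
        using AH AI Gq by fastforce
      then have "card A \<le> card ({p \<in> swept S F K i. G q < G p} \<union> (H - swept S F K i))"
        using fH sH by (intro card_mono) (auto intro: finite_subset)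
      also have "\<dots> \<le> card {p \<in> swept S F K i. G q < G p} + card (H - swept S F K i)"
        by (rule card_Un_le)
      finally show False using leadersD(3)[OF q] rest big by (simp add: A_def)
    qed
  qed
  then show ?thesis using i1 iS by (auto simp: A_def)
qed


text \<open>A point that precedes \<open>q\<close> in the order of \<open>F\<close> but not in that
  of \<open>g\<close> dominates \<open>q\<close>.\<close>

lemma ord_rank_le_rank_plus_depth:
  fixes F G g :: "'a \<Rightarrow> real"
  assumes "finite S" "inj_on g S" "q \<in> S"
    and inv: "\<And>p. \<lbrakk>p \<in> S; F q < F p; g p < g q\<rbrakk> \<Longrightarrow> G q < G p"
  shows "ord_rank S (\<lambda>x. - F x) q \<le> ord_rank S (\<lambda>x. - g x) q + depth S F G q"
proof -
  have "{p \<in> S. - F p < - F q} \<subseteq> {p \<in> S. - g p < - g q} \<union> {p \<in> S. F q < F p \<and> G q < G p}"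
  proof
    fix p assume p: "p \<in> {p \<in> S. - F p < - F q}"
    then have "g p \<noteq> g q" using assms(2,3) by (auto dest: inj_onD)
    then show "p \<in> {p \<in> S. - g p < - g q} \<union> {p \<in> S. F q < F p \<and> G q < G p}"
      using inv[of p] p by (auto simp: neq_iff)
  qed
  then have "ord_rank S (\<lambda>x. - F x) q \<le> card ({p \<in> S. - g p < - g q} \<union> {p \<in> S. F q < F p \<and> G q < G p})"
    unfolding ord_rank_def using assms(1) by (intro card_mono) auto
  then show ?thesis unfolding ord_rank_def depth_def
    using card_Un_le[of "{p \<in> S. - g p < - g q}" "{p \<in> S. F q < F p \<and> G q < G p}"] by linarith
qed

text \<open>The key fact \<open>short\<close>: no point remains a leader across a checkpoint in both sweeps.  Otherwise among
  the points swept after \<open>q\<close> there are \<open>p1\<close>, above \<open>q\<close> in \<open>f\<close> but below in \<open>G\<close>, and \<open>p2\<close>, above \<open>q\<close> in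
  \<open>G\<close> but below in \<open>f\<close>, which the two sweeps meet in different order, against \<open>c1\<close>.\<close>

lemma separable_crossing:
  fixes F G f g :: "'a \<Rightarrow> real"
  assumes fin: "finite S" and inj: "inj_on F S" "inj_on G S" "inj_on f S" "inj_on g S" and N: "N > 0"
    and c1: "\<And>p q. \<lbrakk>p \<in> S; q \<in> S; F p < F q; g q < g p\<rbrakk> \<Longrightarrow> G p < G q \<and> f q < f p"
    and c2: "\<And>p q. \<lbrakk>p \<in> S; q \<in> S; F p < F q; G p < G q\<rbrakk> \<Longrightarrow> f q < f p"
    and c3: "\<And>p q. \<lbrakk>p \<in> S; q \<in> S; g p < g q; f p < f q\<rbrakk> \<Longrightarrow> G q < G p"
  shows "separable N (28 * N) S F G f g"
proof -
  \<comment> \<open>The number \<open>7 * N\<close> is what \<open>swap_colouring\<close> requires.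
    Taking \<open>K = 3 * r\<close> leaves \<open>r\<close> late points after two sets of fewer than
    \<open>r\<close> are discarded, and \<open>leaders_in_quad\<close> needs
    \<open>r + K = 28 * N\<close> points.\<close>
  define r where "r = 7 * N"
  define K where "K = 3 * r"
  have K: "K > 0" "r > 0" "r \<le> K" using N by (auto simp: K_def r_def)
  let ?T = "leaders S F G K r" and ?U = "leaders S g f K r"
  let ?pF = "ord_rank S (\<lambda>x. - F x)" and ?pg = "ord_rank S (\<lambda>x. - g x)"
  have neq: "F p \<noteq> F q \<and> G p \<noteq> G q \<and> f p \<noteq> f q \<and> g p \<noteq> g q" if "p \<in> S" "q \<in> S" "p \<noteq> q" for p q
    using inj that by (auto dest: inj_onD)
  have pF: "?pF p < ?pF q \<longleftrightarrow> F q < F p" if "p \<in> S" for p q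
    using ord_rank_less_iff[OF fin that, of "\<lambda>x. - F x"] by simp
  have pg: "?pg p < ?pg q \<longleftrightarrow> g q < g p" if "p \<in> S" for p q
    using ord_rank_less_iff[OF fin that, of "\<lambda>x. - g x"] by simp
  have near: "step S F K q \<le> step S g K q + 1 \<and> step S g K q \<le> step S F K q + 1"
    if q: "q \<in> ?T i" "q \<in> ?U i'" for q i i'
  proof -
    have qS: "q \<in> S" by (rule subsetD[OF leaders_subset q(1)])
    \<comment> \<open>A leader has depth below \<open>r\<close>, so its ranks in the two sweeps
      differ by at most \<open>K\<close> and its entry steps by at most one.\<close>
    have "?pF q \<le> ?pg q + depth S F G q"
      by (rule ord_rank_le_rank_plus_depth[OF fin inj(4) qS]) (use c1 qS in blast)
    then have a: "?pF q \<le> ?pg q + K" using leaders_depth[OF fin q(1)] K(3) by linarith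
    have "?pg q \<le> ?pF q + depth S g f q"
      by (rule ord_rank_le_rank_plus_depth[OF fin inj(1) qS]) (use c1 qS in blast)
    then have b: "?pg q \<le> ?pF q + K" using leaders_depth[OF fin q(2)] K(3) by linarith
    show ?thesis using div_le_mono[OF a, of K] div_le_mono[OF b, of K] K(1) by (simp add: step_def)
  qed
  have short: "i = step S F K q \<or> i' = step S g K q" if q: "q \<in> ?T i" "q \<in> ?U i'" for q i i'
  proof (rule ccontr)
    assume neg: "\<not> ?thesis"
    have qS: "q \<in> S" by (rule subsetD[OF leaders_subset q(1)])
    have iS: "i * K \<le> card S" "i' * K \<le> card S" using leadersD(2)[OF q(1)] leadersD(2)[OF q(2)]
      by auto
    have "step S F K q < i" "step S g K q < i'"
      using neg leadersD(1)[OF q(1)] leadersD(1)[OF q(2)] swept_iff[OF K(1)] by (metis le_neq_implies_less)+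
    then have st: "?pF q div K < i - 1" "?pg q div K < i' - 1" "1 \<le> i" "1 \<le> i'"
      by (auto simp: step_def)
    then have st': "?pF q < (i - 1) * K" "?pg q < (i' - 1) * K" using K(1)
      by (simp_all add: div_less_iff_less_mult)
    let ?X = "{p \<in> swept S F K i. G q < G p}" and ?Y = "{p \<in> swept S g K i'. f q < f p}"
    have XY: "card ?X < r" "card ?Y < r" using leadersD(3)[OF q(1)] leadersD(3)[OF q(2)] by auto
    have fX: "finite ?X" "finite ?Y" using fin finite_subset[OF swept_subset fin] by auto
    have late: "K \<le> card {p \<in> S. H q > H p \<and> ord_rank S (\<lambda>x. - H x) p < l * K}"
      if H: "inj_on H S" and l: "1 \<le> l" "l * K \<le> card S" "ord_rank S (\<lambda>x. - H x) q < (l - 1) * K" for H :: "'a \<Rightarrow> real" and l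
    proof -
      have "inj_on (\<lambda>x. - H x) S" using H by (auto simp: inj_on_def)
      then have "card {p \<in> S. ord_rank S (\<lambda>x. - H x) p \<in> {(l - 1) * K..<l * K}} = card {(l - 1) * K..<l * K}"
        using l(2) by (intro card_rank_vimage[OF fin]) auto
      also have "\<dots> = K" using l(1) by (cases l) auto
      finally have "K = card {p \<in> S. ord_rank S (\<lambda>x. - H x) p \<in> {(l - 1) * K..<l * K}}" ..
      also have "\<dots> \<le> card {p \<in> S. H q > H p \<and> ord_rank S (\<lambda>x. - H x) p < l * K}"
      proof (rule card_mono)
        show "{p \<in> S. ord_rank S (\<lambda>x. - H x) p \<in> {(l - 1) * K..<l * K}}
            \<subseteq> {p \<in> S. H q > H p \<and> ord_rank S (\<lambda>x. - H x) p < l * K}"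
          using l(3) ord_rank_less_iff[OF fin qS, of "\<lambda>x. - H x"] by fastforce
      qed (use fin in auto)
      finally show ?thesis .
    qed
    let ?ZF = "{p \<in> S. F q > F p \<and> ?pF p < i * K}" and ?Zg = "{p \<in> S. g q > g p \<and> ?pg p < i' * K}"
    have dF: "card {p \<in> S. F q < F p \<and> G q < G p} < r"
      using leaders_depth[OF fin q(1)] by (simp add: depth_def)
    have dg: "card {p \<in> S. g q < g p \<and> f q < f p} < r"
      using leaders_depth[OF fin q(2)] by (simp add: depth_def)
    have big: "r \<le> card Z1" if sub: "Z \<subseteq> A \<union> B \<union> Z1" and c: "K \<le> card Z" "card A < r" "card B < r"
        and fi: "finite A" "finite B" "finite Z1" for Z A B Z1 :: "'a set"
    proof -
      have "card Z \<le> card (A \<union> B \<union> Z1)" using sub fi by (intro card_mono) auto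
      also have "\<dots> \<le> card A + card B + card Z1"
        using card_Un_le[of "A \<union> B" Z1] card_Un_le[of A B] by linarith
      finally show ?thesis using c by (simp add: K_def)
    qed
    \<comment> \<open>Of the at least \<open>K\<close> points swept after \<open>q\<close> up to
      checkpoint \<open>i\<close>, fewer than \<open>r\<close> lie above \<open>q\<close> in
      \<open>G\<close> and fewer than \<open>r\<close> dominate it in the second type; by
      \<open>c2\<close> all others are in \<open>Z1\<close>. The set \<open>Z2\<close> arises in the
      same way from the other sweep and \<open>c3\<close>.\<close>
    define Z1 where "Z1 = {p \<in> ?ZF. G p < G q \<and> f q < f p \<and> g p < g q}"
    define Z2 where "Z2 = {p \<in> ?Zg. f p < f q \<and> G q < G p \<and> F p < F q}"
    have "?ZF \<subseteq> ?X \<union> {p \<in> S. g q < g p \<and> f q < f p} \<union> Z1"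
    proof
      fix p assume p: "p \<in> ?ZF"
      then have "G p \<noteq> G q" "g p \<noteq> g q" using neq[of p q] qS by auto
      then show "p \<in> ?X \<union> {p \<in> S. g q < g p \<and> f q < f p} \<union> Z1"
        using p c2[of p q] qS by (auto simp: Z1_def swept_def neq_iff)
    qed
    then have cZ1: "r \<le> card Z1"
      by (rule big[OF _ late[OF inj(1) st(3) iS(1) st'(1)] XY(1) dg]) (use fin fX in \<open>auto simp: Z1_def\<close>)
    have "?Zg \<subseteq> ?Y \<union> {p \<in> S. F q < F p \<and> G q < G p} \<union> Z2"
    proof
      fix p assume p: "p \<in> ?Zg"
      then have "f p \<noteq> f q" "F p \<noteq> F q" using neq[of p q] qS by auto
      then show "p \<in> ?Y \<union> {p \<in> S. F q < F p \<and> G q < G p} \<union> Z2"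
        using p c3[of p q] qS by (auto simp: Z2_def swept_def neq_iff)
    qed
    then have cZ2: "r \<le> card Z2"
      by (rule big[OF _ late[OF inj(4) st(4) iS(2) st'(2)] XY(2) dF]) (use fin fX in \<open>auto simp: Z2_def\<close>)
    \<comment> \<open>All of \<open>Z2\<close> lies above \<open>q\<close> in \<open>G\<close>, but
      fewer than \<open>r\<close> such points are swept by checkpoint \<open>i\<close>. So some
      \<open>p2\<close> comes later in the first sweep than all of \<open>Z1\<close>; likewise some
      \<open>p1\<close> comes later in the second sweep than all of \<open>Z2\<close>.\<close>
    have "\<not> Z2 \<subseteq> ?X" using cZ2 XY(1) card_mono[OF fX(1)] by (meson leD le_trans)
    then obtain p2 where "p2 \<in> Z2" "p2 \<notin> ?X" by blast
    then have p2: "p2 \<in> Z2" "i * K \<le> ?pF p2" by (auto simp: Z2_def swept_def)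
    have "\<not> Z1 \<subseteq> ?Y" using cZ1 XY(2) card_mono[OF fX(2)] by (meson leD le_trans)
    then obtain p1 where "p1 \<in> Z1" "p1 \<notin> ?Y" by blast
    then have p1: "p1 \<in> Z1" "i' * K \<le> ?pg p1" by (auto simp: Z1_def swept_def)
    have S12: "p1 \<in> S" "p2 \<in> S" using p1(1) p2(1) by (auto simp: Z1_def Z2_def)
    have "?pF p1 < ?pF p2" using p1(1) p2(2) by (auto simp: Z1_def)
    then have "F p2 < F p1" using pF S12 by blast
    moreover have "?pg p2 < ?pg p1" using p2(1) p1(2) by (auto simp: Z2_def)
    then have "g p1 < g p2" using pg S12 by blast
    ultimately have "G p2 < G p1" using c1 S12 by blast
    then show False using p1(1) p2(1) by (auto simp: Z1_def Z2_def)
  qed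
  have st1: "step S H K q \<le> i" if "q \<in> leaders S H H' K r i" for H H' :: "'a \<Rightarrow> real" and q i
    using leadersD(1)[OF that] by (simp add: swept_iff[OF K(1)])
  obtain V where V: "V \<subseteq> S" "\<forall>i. 7 * N \<le> card (?T i) \<longrightarrow> N \<le> card (?T i \<inter> V)"
      "\<forall>i. 7 * N \<le> card (?U i) \<longrightarrow> N \<le> card (?U i - V)"
  proof -
    have "\<exists>V\<subseteq>S. (\<forall>i. 7 * N \<le> card (?T i) \<longrightarrow> N \<le> card (?T i \<inter> V)) \<and>
        (\<forall>i. 7 * N \<le> card (?U i) \<longrightarrow> N \<le> card (?U i - V))"
      by (rule swap_colouring[where jT = "step S F K" and jU = "step S g K" and G = G and f = f])
        (fact fin inj N leaders_subset st1 leaders_up[OF fin K(1)] near short)+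
    then show ?thesis by (elim exE conjE) (rule that)
  qed
  have M: "r + K = 28 * N" by (simp add: r_def K_def)
  have "N \<le> card (quad S F G a b \<inter> V)" if AN: "28 * N \<le> card (quad S F G a b)" for a b
  proof -
    obtain i where i: "1 \<le> i" "i * K \<le> card S" "?T i \<subseteq> quad S F G a b"
      using leaders_in_quad[OF fin inj(1) K(1), of r G a b] AN M by auto
    have "7 * N \<le> card (?T i)" using card_leaders[OF fin inj(1) K(3) i(1,2)] by (simp add: r_def)
    then have "N \<le> card (?T i \<inter> V)" using V(2) by blast
    also have "\<dots> \<le> card (quad S F G a b \<inter> V)" using fin i(3) by (intro card_mono) auto
    finally show ?thesis .
  qed
  moreover have "N \<le> card (quad S f g a b - V)" if AN: "28 * N \<le> card (quad S f g a b)" for a b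
  proof -
    obtain i where i: "1 \<le> i" "i * K \<le> card S" "?U i \<subseteq> quad S f g a b"
      using leaders_in_quad[OF fin inj(4) K(1), of r f b a] AN M quad_commute[of S f g a b] by auto
    have "7 * N \<le> card (?U i)" using card_leaders[OF fin inj(4) K(3) i(1,2)] by (simp add: r_def)
    then have "N \<le> card (?U i - V)" using V(3) by blast
    also have "\<dots> \<le> card (quad S f g a b - V)" using fin i(3) by (intro card_mono) auto
    finally show ?thesis .
  qed
  ultimately show ?thesis unfolding separable_def using V(1) by blast
qed

section \<open>Arcs of directions\<close>

text \<open>Inner product with \<open>cis \<theta>\<close>. Turning by \<open>pi\<close> negates the
  functional, so an order relation in either direction becomes negativity of some functional at the
  difference of two points.\<close>

definition proj :: "real \<Rightarrow> complex \<Rightarrow> real" where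
  "proj \<theta> z = Re z * cos \<theta> + Im z * sin \<theta>"

lemma proj_diff: "proj \<theta> (z - w) = proj \<theta> z - proj \<theta> w"
  by (simp add: proj_def algebra_simps)

lemma proj_add: "proj \<theta> (z + w) = proj \<theta> z + proj \<theta> w"
  by (simp add: proj_def algebra_simps)

lemma proj_scaleR: "proj \<theta> (r *\<^sub>R z) = r * proj \<theta> z"
  by (simp add: proj_def algebra_simps)

lemma proj_minus: "proj \<theta> (- z) = - proj \<theta> z"
  by (simp add: proj_def)

lemma proj_add_pi: "proj (\<theta> + pi) z = - proj \<theta> z"
  by (simp add: proj_def)

lemma proj_add_2pi: "proj (\<theta> + 2 * pi * of_int n) z = proj \<theta> z"
proof -
  have "cos (\<theta> + 2 * pi * of_int n) = cos \<theta>" "sin (\<theta> + 2 * pi * of_int n) = sin \<theta>"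
    using sin_integer_2pi[of "of_int n"] cos_integer_2pi[of "of_int n"] by (simp_all add: sin_add cos_add)
  then show ?thesis by (simp add: proj_def)
qed

lemma abs_proj_le: "\<bar>proj \<theta> z\<bar> \<le> norm z"
proof -
  have "proj \<theta> z = Re (z * cnj (cis \<theta>))" by (simp add: proj_def)
  then have "\<bar>proj \<theta> z\<bar> \<le> norm (z * cnj (cis \<theta>))" using abs_Re_le_cmod by metis
  then show ?thesis by (simp add: norm_mult)
qed

lemma proj_rcis: "proj \<theta> (rcis r t) = r * cos (t - \<theta>)"
  by (simp add: proj_def cos_diff algebra_simps)

text \<open>The middle direction is a nonnegative combination of the outer ones, with sines as
  coefficients; at an opening of exactly \<open>pi\<close> the two hypotheses contradict each
  other.\<close>

lemma proj_between:
  assumes "\<theta>1 \<le> \<theta>2" "\<theta>2 \<le> \<theta>3" "\<theta>3 \<le> \<theta>1 + pi" and neg: "proj \<theta>1 z < 0" "proj \<theta>3 z < 0"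
  shows "proj \<theta>2 z < 0"
proof -
  consider "\<theta>2 = \<theta>1" | "\<theta>3 = \<theta>1 + pi" | "\<theta>1 < \<theta>2" "\<theta>3 < \<theta>1 + pi" using assms by linarith
  then show ?thesis
  proof cases
    case 3
    have e: "sin (\<theta>3 - \<theta>1) * proj \<theta>2 z = sin (\<theta>3 - \<theta>2) * proj \<theta>1 z + sin (\<theta>2 - \<theta>1) * proj \<theta>3 z"
    proof -
      have "sin (\<theta>3 - \<theta>1) * cos \<theta>2 = sin (\<theta>3 - \<theta>2) * cos \<theta>1 + sin (\<theta>2 - \<theta>1) * cos \<theta>3"
        "sin (\<theta>3 - \<theta>1) * sin \<theta>2 = sin (\<theta>3 - \<theta>2) * sin \<theta>1 + sin (\<theta>2 - \<theta>1) * sin \<theta>3"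
        by (simp_all add: sin_diff algebra_simps)
      note cs = this
      have "sin (\<theta>3 - \<theta>1) * proj \<theta>2 z = Re z * (sin (\<theta>3 - \<theta>1) * cos \<theta>2) + Im z * (sin (\<theta>3 - \<theta>1) * sin \<theta>2)"
        by (simp add: proj_def ring_distribs mult_ac)
      also have "\<dots> = sin (\<theta>3 - \<theta>2) * proj \<theta>1 z + sin (\<theta>2 - \<theta>1) * proj \<theta>3 z"
        unfolding cs by (simp add: proj_def ring_distribs mult_ac)
      finally show ?thesis .
    qed
    have s: "sin (\<theta>3 - \<theta>1) > 0" "sin (\<theta>2 - \<theta>1) > 0" "sin (\<theta>3 - \<theta>2) \<ge> 0"
      using sin_gt_zero[of "\<theta>3 - \<theta>1"] sin_gt_zero[of "\<theta>2 - \<theta>1"] sin_ge_zero[of "\<theta>3 - \<theta>2"] 3 assms(1-3)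
      by linarith+
    have "sin (\<theta>3 - \<theta>2) * proj \<theta>1 z \<le> 0" "sin (\<theta>2 - \<theta>1) * proj \<theta>3 z < 0"
      using s neg by (auto simp: mult_le_0_iff mult_less_0_iff)
    then have "sin (\<theta>3 - \<theta>1) * proj \<theta>2 z < 0" using e by linarith
    then show ?thesis using s(1) by (auto simp: mult_less_0_iff)
  qed (use neg in \<open>auto simp: proj_add_pi\<close>)
qed

text \<open>The pair \<open>(\<theta>, w)\<close> encodes the quadrants \<open>{z. a < proj \<theta> z \<and> b < proj (\<theta> + w) z}\<close>, the
  translates of a wedge of angle \<open>pi - w\<close>; the arc of directions from \<open>\<theta>\<close> to \<open>\<theta> + w\<close> spans the dual
  cone of that wedge.  Half-planes are the case \<open>w = 0\<close>.\<close>

type_synonym arc = "real \<times> real"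

abbreviation arc_lo :: "arc \<Rightarrow> complex \<Rightarrow> real" where
  "arc_lo \<tau> \<equiv> proj (fst \<tau>)"

abbreviation arc_hi :: "arc \<Rightarrow> complex \<Rightarrow> real" where
  "arc_hi \<tau> \<equiv> proj (fst \<tau> + snd \<tau>)"

definition proper :: "arc \<Rightarrow> bool" where
  "proper \<tau> \<longleftrightarrow> 0 \<le> snd \<tau> \<and> snd \<tau> < pi"

text \<open>For the dual arcs of two wedges this says that they do not form a special pair.\<close>

definition uncrossed :: "arc \<Rightarrow> arc \<Rightarrow> bool" where
  "uncrossed \<tau> \<sigma> \<longleftrightarrow> (\<exists>n :: int. let t = fst \<sigma> + 2 * pi * n in
     (fst \<tau> \<le> t \<and> t + snd \<sigma> \<le> fst \<tau> + snd \<tau>) \<or>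
     (t \<le> fst \<tau> \<and> fst \<tau> + snd \<tau> \<le> t + snd \<sigma>) \<or>
     (t + snd \<sigma> \<le> fst \<tau> \<and> fst \<tau> + snd \<tau> \<le> t + 2 * pi))"

text \<open>The sum of the bounds for crossing, disjoint and nested arcs, so that each case follows
  by monotonicity.\<close>

definition pair_bound :: "nat \<Rightarrow> nat" where
  "pair_bound N = 28 * N + 6 * N + 1 + (4 * N + (4 * N + 2) * (3 * N * (2 * N + 1)))"

lemma separable_nested_arcs:
  fixes x :: "'a \<Rightarrow> complex"
  assumes fin: "finite S" and N: "N > 0" and arcs: "\<alpha> \<le> \<gamma>" "\<gamma> \<le> \<delta>" "\<delta> \<le> \<beta>" "\<beta> \<le> \<alpha> + pi"
    and inj: "inj_on (\<lambda>s. proj \<alpha> (x s)) S"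
  shows "separable N (pair_bound N) S (\<lambda>s. proj \<alpha> (x s)) (\<lambda>s. proj \<beta> (x s))
    (\<lambda>s. proj \<gamma> (x s)) (\<lambda>s. proj \<delta> (x s))"
proof -
  have less: "proj \<theta> (x p) < proj \<theta> (x q) \<longleftrightarrow> proj \<theta> (x p - x q) < 0" for \<theta> p q
    by (simp add: proj_diff)
  have gr: "proj \<theta> (x q) < proj \<theta> (x p) \<longleftrightarrow> proj (\<theta> + pi) (x p - x q) < 0" for \<theta> p q
    by (simp add: proj_diff proj_add_pi)
  have outer: "proj \<delta> (x p) < proj \<delta> (x q) \<and> proj \<gamma> (x p) < proj \<gamma> (x q)"
    if "proj \<alpha> (x p) < proj \<alpha> (x q)" "proj \<beta> (x p) < proj \<beta> (x q)" for p q
    using that proj_between[of \<alpha> \<gamma> \<beta> "x p - x q"] proj_between[of \<alpha> \<delta> \<beta> "x p - x q"] arcs by (auto simp: less[of _ p q] gr[of _ q p])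
  \<comment> \<open>The ends of the inner arc are interchanged, because \<open>t1\<close> wants
    \<open>\<gamma>\<close> between \<open>\<alpha>\<close> and \<open>\<delta>\<close>, and
    \<open>t2\<close> wants \<open>\<delta>\<close> between \<open>\<gamma>\<close> and
    \<open>\<alpha> + pi\<close>. The second alternative of \<open>separable_nested\<close>
    holds.\<close>
  have "separable N (4 * N + (4 * N + 2) * (3 * N * (2 * N + 1))) S (\<lambda>s. proj \<alpha> (x s)) (\<lambda>s. proj \<beta> (x s))
    (\<lambda>s. proj \<delta> (x s)) (\<lambda>s. proj \<gamma> (x s))"
  proof (rule separable_nested[OF fin inj N])
    fix p q
    show "proj \<gamma> (x p) < proj \<gamma> (x q)" if "proj \<alpha> (x p) < proj \<alpha> (x q)" "proj \<delta> (x p) < proj \<delta> (x q)"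
      using that proj_between[of \<alpha> \<gamma> \<delta> "x p - x q"] arcs
        by (auto simp: less[of _ p q] gr[of _ q p])
    show "proj \<delta> (x p) < proj \<delta> (x q)" if "proj \<alpha> (x q) < proj \<alpha> (x p)" "proj \<gamma> (x p) < proj \<gamma> (x q)"
      using that proj_between[of \<gamma> \<delta> "\<alpha> + pi" "x p - x q"] arcs
        by (auto simp: less[of _ p q] gr[of _ q p])
  qed (use outer in auto)
  then have "separable N (4 * N + (4 * N + 2) * (3 * N * (2 * N + 1))) S (\<lambda>s. proj \<alpha> (x s))
    (\<lambda>s. proj \<beta> (x s)) (\<lambda>s. proj \<gamma> (x s)) (\<lambda>s. proj \<delta> (x s))" by (rule separable_commute)
  then show ?thesis by (rule separable_mono) (simp add: pair_bound_def)
qed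

text \<open>Here \<open>\<gamma>\<close> and \<open>\<delta>\<close> bound the arc opposite to that of the second wedge.\<close>

lemma separable_opposite_arcs:
  fixes x :: "'a \<Rightarrow> complex"
  assumes fin: "finite S" and N: "N > 0" and arcs: "\<alpha> \<le> \<gamma>" "\<gamma> \<le> \<delta>" "\<alpha> \<le> \<beta>" "\<beta> \<le> \<alpha> + pi" "\<delta> \<le> \<alpha> + pi"
    and inj: "\<And>\<theta>. \<theta> \<in> {\<alpha>, \<beta>, \<gamma>, \<delta>} \<Longrightarrow> inj_on (\<lambda>s. proj \<theta> (x s)) S"
  shows "separable N (pair_bound N) S (\<lambda>s. proj \<alpha> (x s)) (\<lambda>s. proj \<beta> (x s))
    (\<lambda>s. - proj \<gamma> (x s)) (\<lambda>s. - proj \<delta> (x s))"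
proof -
  let ?sep = "\<lambda>M. separable N M S (\<lambda>s. proj \<alpha> (x s)) (\<lambda>s. proj \<beta> (x s))
      (\<lambda>s. - proj \<gamma> (x s)) (\<lambda>s. - proj \<delta> (x s))"
  have less: "proj \<theta> (x p) < proj \<theta> (x q) \<longleftrightarrow> proj \<theta> (x p - x q) < 0" for \<theta> p q
    by (simp add: proj_diff)
  have gr: "proj \<theta> (x q) < proj \<theta> (x p) \<longleftrightarrow> proj (\<theta> + pi) (x p - x q) < 0" for \<theta> p q
    by (simp add: proj_diff proj_add_pi)
  have pi2: "proj (\<theta> + 2 * pi) z = proj \<theta> z" for \<theta> z by (simp add: proj_def)
  have inj': "inj_on (\<lambda>s. - proj \<theta> (x s)) S" if "\<theta> \<in> {\<alpha>, \<beta>, \<gamma>, \<delta>}" for \<theta>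
    using inj[OF that] by (auto simp: inj_on_def)
  \<comment> \<open>All directions lie in the half circle starting at \<open>\<alpha>\<close>, so
    only the position of \<open>\<beta>\<close> relative to \<open>\<gamma>\<close> and
    \<open>\<delta>\<close> is left to distinguish.\<close>
  consider "\<delta> \<le> \<beta>" | "\<gamma> \<le> \<beta>" "\<beta> \<le> \<delta>" | "\<beta> \<le> \<gamma>" using arcs by linarith
  then show ?thesis
  proof cases
    case 1
    have outer: "- proj \<gamma> (x q) < - proj \<gamma> (x p) \<and> - proj \<delta> (x q) < - proj \<delta> (x p)"
      if "proj \<alpha> (x p) < proj \<alpha> (x q)" "proj \<beta> (x p) < proj \<beta> (x q)" for p q
      using that proj_between[of \<alpha> \<gamma> \<beta> "x p - x q"] proj_between[of \<alpha> \<delta> \<beta> "x p - x q"] arcs 1 by (auto simp: less[of _ p q] gr[of _ q p])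
    have "?sep (4 * N + (4 * N + 2) * (3 * N * (2 * N + 1)))"
    proof (rule separable_nested[OF fin inj N])
      fix p q
      show "- proj \<delta> (x p) < - proj \<delta> (x q)"
        if "proj \<alpha> (x p) < proj \<alpha> (x q)" "- proj \<gamma> (x p) < - proj \<gamma> (x q)"
        using that proj_between[of "\<gamma> + pi" "\<delta> + pi" "\<alpha> + 2 * pi" "x p - x q", unfolded pi2] arcs by (auto simp: less[of _ p q] gr[of _ q p])
      show "- proj \<gamma> (x p) < - proj \<gamma> (x q)"
        if "proj \<alpha> (x q) < proj \<alpha> (x p)" "- proj \<delta> (x p) < - proj \<delta> (x q)"
        using that proj_between[of "\<alpha> + pi" "\<gamma> + pi" "\<delta> + pi" "x p - x q"] arcs
          by (auto simp: less[of _ p q] gr[of _ q p])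
    qed (use outer in auto)
    then show ?thesis by (rule separable_mono) (simp add: pair_bound_def)
  next
    case 2
    have "?sep (28 * N)"
    proof (rule separable_crossing[OF fin inj inj inj' inj' N])
      fix p q
      show "proj \<beta> (x p) < proj \<beta> (x q) \<and> - proj \<gamma> (x q) < - proj \<gamma> (x p)"
        if "proj \<alpha> (x p) < proj \<alpha> (x q)" "- proj \<delta> (x q) < - proj \<delta> (x p)"
        using that proj_between[of \<alpha> \<beta> \<delta> "x p - x q"] proj_between[of \<alpha> \<gamma> \<delta> "x p - x q"] arcs 2 by (auto simp: less[of _ p q] gr[of _ q p])
      show "- proj \<gamma> (x q) < - proj \<gamma> (x p)"
        if "proj \<alpha> (x p) < proj \<alpha> (x q)" "proj \<beta> (x p) < proj \<beta> (x q)"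
        using that proj_between[of \<alpha> \<gamma> \<beta> "x p - x q"] arcs 2
          by (auto simp: less[of _ p q] gr[of _ q p])
      show "proj \<beta> (x q) < proj \<beta> (x p)"
        if "- proj \<delta> (x p) < - proj \<delta> (x q)" "- proj \<gamma> (x p) < - proj \<gamma> (x q)"
        using that proj_between[of \<gamma> \<beta> \<delta> "x q - x p"] arcs 2
          by (auto simp: less[of _ q p])
    qed auto
    then show ?thesis by (rule separable_mono) (simp add: pair_bound_def)
  next
    case 3
    have "?sep (6 * N + 1)"
    proof (rule separable_disjoint[OF fin inj])
      fix p q
      show "- proj \<gamma> (x q) < - proj \<gamma> (x p) \<and> - proj \<delta> (x q) < - proj \<delta> (x p)"
        if "proj \<alpha> (x q) < proj \<alpha> (x p)" "proj \<beta> (x p) < proj \<beta> (x q)"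
        using that proj_between[of \<beta> \<gamma> "\<alpha> + pi" "x p - x q"] proj_between[of \<beta> \<delta> "\<alpha> + pi" "x p - x q"] arcs 3 by (auto simp: less[of _ p q] gr[of _ q p])
    qed auto
    then show ?thesis by (rule separable_mono) (simp add: pair_bound_def)
  qed
qed

text \<open>The injectivity assumption excludes ties. Nested arcs are treated directly; if the arcs
  do not overlap, one of them is turned by \<open>pi\<close>, which negates its functionals.\<close>

lemma separable_arcs_generic:
  fixes x :: "'a \<Rightarrow> complex"
  assumes fin: "finite S" and N: "N > 0" and prp: "proper \<tau>" "proper \<sigma>" and unc: "uncrossed \<tau> \<sigma>"
    and inj: "\<And>\<theta>. \<theta> \<in> {fst \<tau>, fst \<tau> + snd \<tau>, fst \<sigma>, fst \<sigma> + snd \<sigma>} \<Longrightarrow> inj_on (\<lambda>s. proj \<theta> (x s)) S"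
  shows "separable N (pair_bound N) S (\<lambda>s. arc_lo \<tau> (x s)) (\<lambda>s. arc_hi \<tau> (x s))
    (\<lambda>s. arc_lo \<sigma> (x s)) (\<lambda>s. arc_hi \<sigma> (x s))"
proof -
  define \<alpha> where "\<alpha> = fst \<tau>"
  define \<beta> where "\<beta> = fst \<tau> + snd \<tau>"
  obtain n :: int where n: "let t = fst \<sigma> + 2 * pi * n in
     (fst \<tau> \<le> t \<and> t + snd \<sigma> \<le> fst \<tau> + snd \<tau>) \<or>
     (t \<le> fst \<tau> \<and> fst \<tau> + snd \<tau> \<le> t + snd \<sigma>) \<or>
     (t + snd \<sigma> \<le> fst \<tau> \<and> fst \<tau> + snd \<tau> \<le> t + 2 * pi)"
    using unc unfolding uncrossed_def by blast
  define t where "t = fst \<sigma> + 2 * pi * n"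
  define u where "u = t + snd \<sigma>"
  have lo: "arc_lo \<sigma> = proj t" by (rule ext) (simp only: t_def proj_add_2pi)
  have "u = fst \<sigma> + snd \<sigma> + 2 * pi * n" by (simp add: u_def t_def)
  then have hi: "arc_hi \<sigma> = proj u" by (intro ext) (simp only: proj_add_2pi)
  have injs: "inj_on (\<lambda>s. proj \<theta> (x s)) S" if "\<theta> \<in> {\<alpha>, \<beta>, t, u}" for \<theta>
    using that inj[of "fst \<tau>"] inj[of "fst \<tau> + snd \<tau>"] inj[of "fst \<sigma>"] inj[of "fst \<sigma> + snd \<sigma>"]
    unfolding lo hi \<alpha>_def \<beta>_def by blast
  have p: "\<alpha> \<le> \<beta>" "\<beta> < \<alpha> + pi" "t \<le> u" "u < t + pi"
    using prp by (auto simp: proper_def \<alpha>_def \<beta>_def u_def)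
  have "separable N (pair_bound N) S (\<lambda>s. proj \<alpha> (x s)) (\<lambda>s. proj \<beta> (x s)) (\<lambda>s. proj t (x s)) (\<lambda>s. proj u (x s))"
  proof -
    consider "\<alpha> \<le> t" "u \<le> \<beta>" | "t \<le> \<alpha>" "\<beta> \<le> u" | "u \<le> \<alpha>" "\<beta> \<le> t + 2 * pi"
      using n by (auto simp: Let_def \<alpha>_def \<beta>_def t_def u_def)
    then show ?thesis
    proof cases
      case 1
      then show ?thesis using p injs by (intro separable_nested_arcs fin N) auto
    next
      case 2
      then show ?thesis using p injs by (intro separable_swap[OF separable_nested_arcs] fin N) auto
    next
      case 3
      show ?thesis
      \<comment> \<open>The arc to be turned is chosen such that afterwards both lie in one half
        circle, with the unturned arc starting first.\<close>
      proof (cases "\<alpha> \<le> t + pi")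
        case True
        have *: "inj_on (\<lambda>s. proj \<theta> (x s)) S" if "\<theta> \<in> {\<alpha>, \<beta>, t + pi, u + pi}" for \<theta>
          using that injs[of \<alpha>] injs[of \<beta>] injs[of t] injs[of u]
            by (auto simp: proj_add_pi inj_on_def)
        have "separable N (pair_bound N) S (\<lambda>s. proj \<alpha> (x s)) (\<lambda>s. proj \<beta> (x s))
            (\<lambda>s. - proj (t + pi) (x s)) (\<lambda>s. - proj (u + pi) (x s))"
          using True 3 p by (intro separable_opposite_arcs fin N *) auto
        then show ?thesis by (simp add: proj_add_pi)
      next
        case False
        have *: "inj_on (\<lambda>s. proj \<theta> (x s)) S" if "\<theta> \<in> {t, u, \<alpha> - pi, \<beta> - pi}" for \<theta>
          using that injs[of \<alpha>] injs[of \<beta>] injs[of t] injs[of u] proj_add_pi[of "\<alpha> - pi"] proj_add_pi[of "\<beta> - pi"]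
          by (auto simp: inj_on_def)
        have "separable N (pair_bound N) S (\<lambda>s. proj t (x s)) (\<lambda>s. proj u (x s))
            (\<lambda>s. - proj (\<alpha> - pi) (x s)) (\<lambda>s. - proj (\<beta> - pi) (x s))"
          using False 3 p by (intro separable_opposite_arcs fin N *) auto
        then have "separable N (pair_bound N) S (\<lambda>s. proj t (x s)) (\<lambda>s. proj u (x s))
            (\<lambda>s. proj \<alpha> (x s)) (\<lambda>s. proj \<beta> (x s))"
          using proj_add_pi[of "\<alpha> - pi"] proj_add_pi[of "\<beta> - pi"] by simp
        then show ?thesis by (rule separable_swap)
      qed
    qed
  qed
  then show ?thesis unfolding lo hi by (simp only: \<alpha>_def \<beta>_def)
qed

section \<open>Breaking ties by a small perturbation\<close>

lemma exists_generic_direction: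
  assumes "finite \<Theta>"
  shows "\<exists>u. \<forall>\<theta>\<in>\<Theta>. proj \<theta> u \<noteq> 0"
proof -
  \<comment> \<open>Only directions with nonzero sine restrict the slope \<open>x\<close>: where the
    sine vanishes, the cosine does not.\<close>
  have "finite ((\<lambda>\<theta>. - cos \<theta> / sin \<theta>) ` \<Theta>)" using assms by simp
  then obtain x :: real where x: "x \<notin> (\<lambda>\<theta>. - cos \<theta> / sin \<theta>) ` \<Theta>"
    using ex_new_if_finite infinite_UNIV_char_0 by blast
  have "proj \<theta> (Complex 1 x) \<noteq> 0" if "\<theta> \<in> \<Theta>" for \<theta>
  proof
    assume "proj \<theta> (Complex 1 x) = 0"
    then have e: "cos \<theta> + x * sin \<theta> = 0" by (simp add: proj_def)
    then have "sin \<theta> \<noteq> 0" using sin_zero_abs_cos_one[of \<theta>] by auto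
    then have "x = - cos \<theta> / sin \<theta>" using e by (simp add: field_simps)
    then show False using x that by blast
  qed
  then show ?thesis by blast
qed

text \<open>The points are moved by distinct multiples of a vector orthogonal to none of the
  directions. For small \<open>\<epsilon>\<close> this keeps the strict inequalities and resolves
  every tie.\<close>

lemma exists_tie_breaking:
  fixes x :: "'a \<Rightarrow> complex"
  assumes fin: "finite S" "finite \<Theta>"
  shows "\<exists>y. \<forall>\<theta>\<in>\<Theta>. inj_on (\<lambda>s. proj \<theta> (y s)) S \<and>
    (\<forall>p\<in>S. \<forall>q\<in>S. proj \<theta> (x p) < proj \<theta> (x q) \<longrightarrow> proj \<theta> (y p) < proj \<theta> (y q))"
proof -
  obtain u where u: "\<And>\<theta>. \<theta> \<in> \<Theta> \<Longrightarrow> proj \<theta> u \<noteq> 0"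
    using exists_generic_direction[OF fin(2)] by blast
  obtain n :: "'a \<Rightarrow> nat" where n: "inj_on n S" using finite_imp_inj_to_nat_seg[OF fin(1)]
    by blast
  define y where "y \<epsilon> s = x s + (\<epsilon> * real (n s)) *\<^sub>R u" for \<epsilon> s
  define ok where "ok \<epsilon> \<theta> p q \<longleftrightarrow> (p \<noteq> q \<longrightarrow> proj \<theta> (y \<epsilon> p) \<noteq> proj \<theta> (y \<epsilon> q)) \<and>
      (proj \<theta> (x p) < proj \<theta> (x q) \<longrightarrow> proj \<theta> (y \<epsilon> p) < proj \<theta> (y \<epsilon> q))" for \<epsilon> \<theta> p q
  have "\<forall>\<^sub>F \<epsilon> in at_right 0. ok \<epsilon> \<theta> p q" if t: "\<theta> \<in> \<Theta>" and pq: "p \<in> S" "q \<in> S" for \<theta> p q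
  proof -
    define D where "D = proj \<theta> (x q) - proj \<theta> (x p)"
    define E where "E = (real (n q) - real (n p)) * proj \<theta> u"
    have y: "proj \<theta> (y \<epsilon> q) - proj \<theta> (y \<epsilon> p) = D + \<epsilon> * E" for \<epsilon>
      by (simp add: y_def proj_add proj_scaleR D_def E_def algebra_simps)
    have lim: "((\<lambda>\<epsilon>. D + \<epsilon> * E) \<longlongrightarrow> D) (at_right 0)"
      by (rule tendsto_eq_intros refl | simp)+
    have pos: "\<forall>\<^sub>F \<epsilon> in at_right 0. (\<epsilon> :: real) > 0"
      by (simp add: eventually_at_right_less)
    consider "D < 0" | "D > 0" | "D = 0" by linarith
    then show ?thesis
    proof cases
      case 1
      have "\<forall>\<^sub>F \<epsilon> in at_right 0. D + \<epsilon> * E < 0"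
        using order_tendstoD(2)[OF lim 1] .
      then show ?thesis
      proof eventually_elim
        case (elim \<epsilon>)
        then show ?case using y[of \<epsilon>] 1 by (auto simp: ok_def D_def)
      qed
    next
      case 2
      have "\<forall>\<^sub>F \<epsilon> in at_right 0. D + \<epsilon> * E > 0"
        using order_tendstoD(1)[OF lim 2] .
      then show ?thesis
      proof eventually_elim
        case (elim \<epsilon>)
        then show ?case using y[of \<epsilon>] by (auto simp: ok_def)
      qed
    next
      case 3
      from pos show ?thesis
      proof eventually_elim
        case (elim \<epsilon>)
        have "proj \<theta> (y \<epsilon> p) \<noteq> proj \<theta> (y \<epsilon> q)" if "p \<noteq> q"
        proof -
          have "n p \<noteq> n q" using n pq that by (auto dest: inj_onD)
          then have "E \<noteq> 0" using u[OF t] by (simp add: E_def)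
          then show ?thesis using y[of \<epsilon>] 3 elim by auto
        qed
        then show ?case using 3 by (auto simp: ok_def D_def)
      qed
    qed
  qed
  then have "\<forall>\<^sub>F \<epsilon> in at_right 0. \<forall>\<theta>\<in>\<Theta>. \<forall>p\<in>S. \<forall>q\<in>S. ok \<epsilon> \<theta> p q"
    using fin by (simp add: eventually_ball_finite)
  then have "\<exists>\<epsilon>. \<forall>\<theta>\<in>\<Theta>. \<forall>p\<in>S. \<forall>q\<in>S. ok \<epsilon> \<theta> p q"
    using eventually_happens trivial_limit_at_right_real by blast
  then obtain \<epsilon> where "\<forall>\<theta>\<in>\<Theta>. \<forall>p\<in>S. \<forall>q\<in>S. ok \<epsilon> \<theta> p q" ..
  then show ?thesis by (intro exI[of _ "y \<epsilon>"]) (auto simp: ok_def inj_on_def)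
qed

text \<open>If \<open>F'\<close> refines the order of \<open>F\<close>, all points with
  \<open>F\<close> at most \<open>a\<close> lie below the others in \<open>F'\<close>, so their
  largest value of \<open>F'\<close> is a threshold. Hence quadrants of the original points are
  quadrants of the perturbed ones.\<close>

lemma threshold_transfer:
  fixes F F' :: "'a \<Rightarrow> real"
  assumes fin: "finite S" and mono: "\<And>p q. \<lbrakk>p \<in> S; q \<in> S; F p < F q\<rbrakk> \<Longrightarrow> F' p < F' q"
  shows "\<exists>a'. \<forall>s\<in>S. a < F s \<longleftrightarrow> a' < F' s"
proof (cases "{s \<in> S. F s \<le> a} = {}")
  case True
  show ?thesis
  proof (cases "S = {}")
    case False
    then obtain z where z: "\<And>s. s \<in> S \<Longrightarrow> F' z \<le> F' s"
      using finite_has_max_image[OF fin, of "\<lambda>s. - F' s"] by auto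
    have "\<forall>s\<in>S. F' z - 1 < F' s" using z by force
    moreover have "\<forall>s\<in>S. a < F s" using True by auto
    ultimately show ?thesis by blast
  qed simp
next
  case False
  then obtain z where z: "z \<in> S" "F z \<le> a" "\<And>s. s \<in> S \<Longrightarrow> F s \<le> a \<Longrightarrow> F' s \<le> F' z"
    using finite_has_max_image[of "{s \<in> S. F s \<le> a}" F'] fin by auto
  have "a < F s \<longleftrightarrow> F' z < F' s" if "s \<in> S" for s
    using z(3)[OF that] mono[OF z(1) that] z(2) by force
  then show ?thesis by blast
qed

lemma separable_transfer:
  assumes fin: "finite S" and sep: "separable N M S F' G' f' g'"
    and m: "\<And>p q. \<lbrakk>p \<in> S; q \<in> S; F p < F q\<rbrakk> \<Longrightarrow> F' p < F' q"
      "\<And>p q. \<lbrakk>p \<in> S; q \<in> S; G p < G q\<rbrakk> \<Longrightarrow> G' p < G' q"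
      "\<And>p q. \<lbrakk>p \<in> S; q \<in> S; f p < f q\<rbrakk> \<Longrightarrow> f' p < f' q"
      "\<And>p q. \<lbrakk>p \<in> S; q \<in> S; g p < g q\<rbrakk> \<Longrightarrow> g' p < g' q"
  shows "separable N M S F G f g"
proof -
  obtain V where V: "V \<subseteq> S"
    "\<And>a b. M \<le> card (quad S F' G' a b) \<Longrightarrow> N \<le> card (quad S F' G' a b \<inter> V)"
    "\<And>a b. M \<le> card (quad S f' g' a b) \<Longrightarrow> N \<le> card (quad S f' g' a b - V)"
    by (rule separableE[OF sep]) (erule that; simp)
  have q: "\<exists>a' b'. quad S H K a b = quad S H' K' a' b'"
    if ab: "\<exists>a'. \<forall>s\<in>S. a < H s \<longleftrightarrow> a' < H' s" "\<exists>b'. \<forall>s\<in>S. b < K s \<longleftrightarrow> b' < K' s"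
    for H K H' K' :: "'a \<Rightarrow> real" and a b
  proof -
    obtain a' b' where "\<forall>s\<in>S. a < H s \<longleftrightarrow> a' < H' s" "\<forall>s\<in>S. b < K s \<longleftrightarrow> b' < K' s"
      using ab by blast
    then have "quad S H K a b = quad S H' K' a' b'" by (auto simp: quad_def)
    then show ?thesis by blast
  qed
  have 1: "\<exists>a' b'. quad S F G a b = quad S F' G' a' b'" for a b
    by (intro q threshold_transfer fin m)
  have 2: "\<exists>a' b'. quad S f g a b = quad S f' g' a' b'" for a b
    by (intro q threshold_transfer fin m)
  show ?thesis unfolding separable_def by (intro exI[of _ V] conjI V(1)) (metis 1 V(2), metis 2 V(3))
qed

lemma separable_arcs:
  fixes x :: "'a \<Rightarrow> complex"
  assumes fin: "finite S" and N: "N > 0" and prp: "proper \<tau>" "proper \<sigma>" and unc: "uncrossed \<tau> \<sigma>"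
  shows "separable N (pair_bound N) S (\<lambda>s. arc_lo \<tau> (x s)) (\<lambda>s. arc_hi \<tau> (x s))
    (\<lambda>s. arc_lo \<sigma> (x s)) (\<lambda>s. arc_hi \<sigma> (x s))"
proof -
  let ?\<Theta> = "{fst \<tau>, fst \<tau> + snd \<tau>, fst \<sigma>, fst \<sigma> + snd \<sigma>}"
  have "finite ?\<Theta>" by simp
  from exists_tie_breaking[OF fin this, of x] obtain y where y:
    "\<forall>\<theta>\<in>?\<Theta>. inj_on (\<lambda>s. proj \<theta> (y s)) S \<and>
    (\<forall>p\<in>S. \<forall>q\<in>S. proj \<theta> (x p) < proj \<theta> (x q) \<longrightarrow> proj \<theta> (y p) < proj \<theta> (y q))" ..
  have "separable N (pair_bound N) S (\<lambda>s. arc_lo \<tau> (y s)) (\<lambda>s. arc_hi \<tau> (y s))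
    (\<lambda>s. arc_lo \<sigma> (y s)) (\<lambda>s. arc_hi \<sigma> (y s))"
    by (rule separable_arcs_generic[OF fin N prp unc]) (use y in blast)
  then show ?thesis
    by (rule separable_transfer[OF fin]) (use y in auto)
qed

section \<open>Distributing the points among all types\<close>

definition arc_quad :: "'a set \<Rightarrow> ('a \<Rightarrow> complex) \<Rightarrow> arc \<Rightarrow> real \<Rightarrow> real \<Rightarrow> 'a set" where
  "arc_quad S x \<tau> a b = quad S (\<lambda>s. arc_lo \<tau> (x s)) (\<lambda>s. arc_hi \<tau> (x s)) a b"

lemma arc_quad_Int: "V \<subseteq> S \<Longrightarrow> arc_quad V x \<tau> a b = arc_quad S x \<tau> a b \<inter> V"
  by (auto simp: arc_quad_def quad_def)

lemma arc_quad_subset: "arc_quad S x \<tau> a b \<subseteq> S"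
  by (auto simp: arc_quad_def quad_def)

lemma pair_bound_ge: "N \<le> pair_bound N"
  by (simp add: pair_bound_def)

text \<open>Induction on the types, for all \<open>N\<close> at once: the old types are first
  partitioned so as to keep \<open>pair_bound N\<close> points, which is enough to separate each of
  them from the new type within its own class.\<close>

lemma exists_arc_partition:
  assumes "finite Ts" "\<forall>\<tau>\<in>Ts. proper \<tau>"
    and "\<forall>\<tau>\<in>Ts. \<forall>\<sigma>\<in>Ts. \<tau> \<noteq> \<sigma> \<longrightarrow> uncrossed \<tau> \<sigma>" and N: "N > 0"
  shows "\<exists>M. \<forall>(S :: 'a set) x. finite S \<longrightarrow> (\<exists>P. (\<forall>\<tau>\<in>Ts. P \<tau> \<subseteq> S) \<and> disjoint_family_on P Ts \<and>
    (\<forall>\<tau>\<in>Ts. \<forall>a b. M \<le> card (arc_quad S x \<tau> a b) \<longrightarrow> N \<le> card (arc_quad (P \<tau>) x \<tau> a b)))"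
  using assms
proof (induction Ts arbitrary: N rule: finite_induct)
  case empty
  then show ?case by (auto simp: disjoint_family_on_def)
next
  case (insert \<sigma> Ts)
  define B where "B = pair_bound N"
  have B: "N \<le> B" "B > 0" using insert.prems(3) pair_bound_ge[of N] by (auto simp: B_def)
  have "\<forall>\<tau>\<in>Ts. proper \<tau>" "\<forall>\<tau>\<in>Ts. \<forall>\<sigma>\<in>Ts. \<tau> \<noteq> \<sigma> \<longrightarrow> uncrossed \<tau> \<sigma>" using insert.prems by simp_all
  from insert.IH[OF this B(2)] obtain M where M: "\<forall>(S :: 'a set) x. finite S \<longrightarrow>
    (\<exists>P. (\<forall>\<tau>\<in>Ts. P \<tau> \<subseteq> S) \<and> disjoint_family_on P Ts \<and>
    (\<forall>\<tau>\<in>Ts. \<forall>a b. M \<le> card (arc_quad S x \<tau> a b) \<longrightarrow> B \<le> card (arc_quad (P \<tau>) x \<tau> a b)))" ..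
  have "\<exists>P'. (\<forall>\<tau>\<in>insert \<sigma> Ts. P' \<tau> \<subseteq> S) \<and> disjoint_family_on P' (insert \<sigma> Ts) \<and>
    (\<forall>\<tau>\<in>insert \<sigma> Ts. \<forall>a b. M + (card Ts + 1) * B \<le> card (arc_quad S x \<tau> a b) \<longrightarrow>
       N \<le> card (arc_quad (P' \<tau>) x \<tau> a b))"
    if fin: "finite S" for S :: "'a set" and x
  proof -
    obtain P where P: "\<forall>\<tau>\<in>Ts. P \<tau> \<subseteq> S" "disjoint_family_on P Ts"
      "\<forall>\<tau>\<in>Ts. \<forall>a b. M \<le> card (arc_quad S x \<tau> a b) \<longrightarrow> B \<le> card (arc_quad (P \<tau>) x \<tau> a b)"
      using M[THEN spec, THEN spec, THEN mp, OF fin, of x] by (elim exE conjE) (rule that)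
    have finP: "finite (P \<tau>)" if "\<tau> \<in> Ts" for \<tau> using P(1) that fin finite_subset
      by blast
    have "\<exists>V\<subseteq>P \<tau>. (\<forall>a b. B \<le> card (arc_quad (P \<tau>) x \<tau> a b) \<longrightarrow> N \<le> card (arc_quad (P \<tau>) x \<tau> a b \<inter> V)) \<and>
        (\<forall>a b. B \<le> card (arc_quad (P \<tau>) x \<sigma> a b) \<longrightarrow> N \<le> card (arc_quad (P \<tau>) x \<sigma> a b - V))"
      if t: "\<tau> \<in> Ts" for \<tau>
    proof -
      have "\<tau> \<noteq> \<sigma>" using t insert.hyps by auto
      then have "uncrossed \<tau> \<sigma>" using insert.prems(2) t by simp
      moreover have "proper \<tau>" "proper \<sigma>" using insert.prems(1) t by simp_all
      ultimately show ?thesis using separable_arcs[OF finP[OF t] insert.prems(3), of \<tau> \<sigma> x]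
        by (simp add: separable_def arc_quad_def B_def)
    qed
    then obtain V where V: "\<And>\<tau>. \<tau> \<in> Ts \<Longrightarrow> V \<tau> \<subseteq> P \<tau>"
      "\<And>\<tau> a b. \<tau> \<in> Ts \<Longrightarrow> B \<le> card (arc_quad (P \<tau>) x \<tau> a b) \<Longrightarrow> N \<le> card (arc_quad (P \<tau>) x \<tau> a b \<inter> V \<tau>)"
      "\<And>\<tau> a b. \<tau> \<in> Ts \<Longrightarrow> B \<le> card (arc_quad (P \<tau>) x \<sigma> a b) \<Longrightarrow> N \<le> card (arc_quad (P \<tau>) x \<sigma> a b - V \<tau>)"
      by metis
    \<comment> \<open>The new type receives everything that no old type keeps, including the points
      outside all old classes.\<close>
    define P' where "P' \<tau> = (if \<tau> = \<sigma> then S - (\<Union>\<tau>\<in>Ts. V \<tau>) else V \<tau>)" for \<tau>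
    have P't: "P' \<tau> = V \<tau>" if "\<tau> \<in> Ts" for \<tau> using that insert.hyps
      by (auto simp: P'_def)
    have P's: "P' \<sigma> = S - (\<Union>\<tau>\<in>Ts. V \<tau>)" by (simp add: P'_def)
    have VS: "V \<tau> \<subseteq> S" if "\<tau> \<in> Ts" for \<tau> using V(1)[OF that] P(1) that by blast
    have "disjoint_family_on P' (insert \<sigma> Ts)"
      unfolding disjoint_family_on_def
    proof (intro ballI impI)
      fix \<tau> \<tau>' assume t: "\<tau> \<in> insert \<sigma> Ts" "\<tau>' \<in> insert \<sigma> Ts" "\<tau> \<noteq> \<tau>'"
      show "P' \<tau> \<inter> P' \<tau>' = {}"
      proof (cases "\<tau> = \<sigma> \<or> \<tau>' = \<sigma>")
        case True
        then consider "\<tau> = \<sigma>" "\<tau>' \<in> Ts" | "\<tau>' = \<sigma>" "\<tau> \<in> Ts"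
          using t by blast
        then show ?thesis by cases (simp add: P's P't, blast)+
      next
        case False
        then have "V \<tau> \<inter> V \<tau>' \<subseteq> P \<tau> \<inter> P \<tau>'" using t V(1)
          by blast
        moreover have "\<tau> \<in> Ts" "\<tau>' \<in> Ts" using False t by auto
        ultimately show ?thesis using P't t(3) P(2) unfolding disjoint_family_on_def by (metis subset_empty)
      qed
    qed
    moreover have "\<forall>\<tau>\<in>insert \<sigma> Ts. P' \<tau> \<subseteq> S" using P't P's VS
      by (metis Diff_subset insertE)
    moreover have "N \<le> card (arc_quad (P' \<tau>) x \<tau> a b)"
      if t: "\<tau> \<in> insert \<sigma> Ts" and big: "M + (card Ts + 1) * B \<le> card (arc_quad S x \<tau> a b)" for \<tau> a b
    proof (cases "\<tau> = \<sigma>")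
      case False
      then have t': "\<tau> \<in> Ts" using t by simp
      have "M \<le> card (arc_quad S x \<tau> a b)" using big by simp
      then have "B \<le> card (arc_quad (P \<tau>) x \<tau> a b)" using P(3) t' by blast
      then have "N \<le> card (arc_quad (P \<tau>) x \<tau> a b \<inter> V \<tau>)" using V(2)[OF t']
        by blast
      also have "arc_quad (P \<tau>) x \<tau> a b \<inter> V \<tau> = arc_quad (P' \<tau>) x \<tau> a b"
        using arc_quad_Int[OF V(1)[OF t'], of x \<tau> a b] P't[OF t'] by simp
      finally show ?thesis .
    next
      case True
      let ?A = "arc_quad S x \<sigma> a b"
      have fA: "finite ?A" using fin by (simp add: arc_quad_def)
      have A': "arc_quad (P' \<sigma>) x \<sigma> a b = ?A - (\<Union>\<tau>\<in>Ts. V \<tau>)"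
        using arc_quad_Int[of "P' \<sigma>" S x \<sigma> a b] arc_quad_subset[of S x \<sigma> a b] P's
          by auto
      show ?thesis
      \<comment> \<open>Either some class holds \<open>B\<close> points of the quadrant, and its
        separation releases \<open>N\<close> of them; or all classes together hold at most
        \<open>card Ts * B\<close>, and the remaining \<open>B\<close> points were kept by
        nobody.\<close>
      proof (cases "\<exists>\<tau>\<in>Ts. B \<le> card (arc_quad (P \<tau>) x \<sigma> a b)")
        case True
        then obtain \<rho> where r: "\<rho> \<in> Ts" "B \<le> card (arc_quad (P \<rho>) x \<sigma> a b)"
          by blast
        have "arc_quad (P \<rho>) x \<sigma> a b - V \<rho> \<subseteq> ?A - (\<Union>\<tau>\<in>Ts. V \<tau>)"
        proof
          fix z assume z: "z \<in> arc_quad (P \<rho>) x \<sigma> a b - V \<rho>"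
          have zP: "z \<in> P \<rho>" "z \<in> ?A"
            using z arc_quad_Int[of "P \<rho>" S x \<sigma> a b] P(1) r(1) by auto
          have "z \<notin> V \<tau>" if "\<tau> \<in> Ts" for \<tau>
          proof (cases "\<tau> = \<rho>")
            case False
            then have "P \<tau> \<inter> P \<rho> = {}"
              using P(2) that r(1) unfolding disjoint_family_on_def by blast
            then show ?thesis using zP(1) V(1)[OF that] by auto
          qed (use z in auto)
          then show "z \<in> ?A - (\<Union>\<tau>\<in>Ts. V \<tau>)" using zP by auto
        qed
        then have "card (arc_quad (P \<rho>) x \<sigma> a b - V \<rho>) \<le> card (?A - (\<Union>\<tau>\<in>Ts. V \<tau>))"
          using fA by (intro card_mono) auto
        then show ?thesis using V(3)[OF r] A' \<open>\<tau> = \<sigma>\<close> by simp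
      next
        case False
        have "?A \<subseteq> (\<Union>\<tau>\<in>Ts. arc_quad (P \<tau>) x \<sigma> a b) \<union> (?A - (\<Union>\<tau>\<in>Ts. V \<tau>))"
        proof
          fix z assume z: "z \<in> ?A"
          show "z \<in> (\<Union>\<tau>\<in>Ts. arc_quad (P \<tau>) x \<sigma> a b) \<union> (?A - (\<Union>\<tau>\<in>Ts. V \<tau>))"
          proof (cases "\<exists>\<tau>\<in>Ts. z \<in> V \<tau>")
            case True
            then obtain \<tau> where "\<tau> \<in> Ts" "z \<in> P \<tau>" using V(1) by blast
            then have "z \<in> arc_quad (P \<tau>) x \<sigma> a b"
              using arc_quad_Int[of "P \<tau>" S x \<sigma> a b] P(1) z by auto
            then show ?thesis using \<open>\<tau> \<in> Ts\<close> by blast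
          qed (use z in auto)
        qed
        moreover have fU: "finite (\<Union>\<tau>\<in>Ts. arc_quad (P \<tau>) x \<sigma> a b)"
          using insert.hyps(1) finP by (auto simp: arc_quad_def)
        ultimately have "card ?A \<le> card ((\<Union>\<tau>\<in>Ts. arc_quad (P \<tau>) x \<sigma> a b) \<union> (?A - (\<Union>\<tau>\<in>Ts. V \<tau>)))"
          using fA by (intro card_mono) auto
        also have "\<dots> \<le> card (\<Union>\<tau>\<in>Ts. arc_quad (P \<tau>) x \<sigma> a b) + card (?A - (\<Union>\<tau>\<in>Ts. V \<tau>))"
          by (rule card_Un_le)
        also have "card (\<Union>\<tau>\<in>Ts. arc_quad (P \<tau>) x \<sigma> a b) \<le> (\<Sum>\<tau>\<in>Ts. card (arc_quad (P \<tau>) x \<sigma> a b))"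
          by (rule card_UN_le[OF insert.hyps(1)])
        also have "\<dots> \<le> card Ts * B"
          using sum_bounded_above[of Ts "\<lambda>\<tau>. card (arc_quad (P \<tau>) x \<sigma> a b)" B] False by force
        finally have "card ?A \<le> card Ts * B + card (?A - (\<Union>\<tau>\<in>Ts. V \<tau>))" by simp
        then have "B \<le> card (?A - (\<Union>\<tau>\<in>Ts. V \<tau>))" using big True by simp
        then show ?thesis using A' B(1) True by simp
      qed
    qed
    ultimately show ?thesis by blast
  qed
  then show ?case by blast
qed

text \<open>Each class is coloured for its own type only, which suffices because it keeps
  \<open>k\<close> points of every large quadrant of that type.\<close>

lemma exists_arc_colouring:
  assumes Ts: "finite Ts" "\<forall>\<tau>\<in>Ts. proper \<tau>"
    and unc: "\<forall>\<tau>\<in>Ts. \<forall>\<sigma>\<in>Ts. \<tau> \<noteq> \<sigma> \<longrightarrow> uncrossed \<tau> \<sigma>" and k: "k > 0"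
  shows "\<exists>M. \<forall>(S :: 'a set) x. finite S \<longrightarrow> (\<exists>col :: 'a \<Rightarrow> nat. \<forall>\<tau>\<in>Ts. \<forall>a b.
    M \<le> card (arc_quad S x \<tau> a b) \<longrightarrow> {..<k} \<subseteq> col ` arc_quad S x \<tau> a b)"
proof -
  obtain M where M: "\<forall>(S :: 'a set) x. finite S \<longrightarrow> (\<exists>P. (\<forall>\<tau>\<in>Ts. P \<tau> \<subseteq> S) \<and> disjoint_family_on P Ts \<and>
    (\<forall>\<tau>\<in>Ts. \<forall>a b. M \<le> card (arc_quad S x \<tau> a b) \<longrightarrow> k \<le> card (arc_quad (P \<tau>) x \<tau> a b)))"
    using exists_arc_partition[OF Ts unc k] by (elim exE) (rule that)
  have "\<exists>col :: 'a \<Rightarrow> nat. \<forall>\<tau>\<in>Ts. \<forall>a b. M \<le> card (arc_quad S x \<tau> a b) \<longrightarrow> {..<k} \<subseteq> col ` arc_quad S x \<tau> a b"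
    if fin: "finite S" for S :: "'a set" and x
  proof -
    obtain P where P: "\<forall>\<tau>\<in>Ts. P \<tau> \<subseteq> S" "disjoint_family_on P Ts"
      "\<forall>\<tau>\<in>Ts. \<forall>a b. M \<le> card (arc_quad S x \<tau> a b) \<longrightarrow> k \<le> card (arc_quad (P \<tau>) x \<tau> a b)"
      using M[THEN spec, THEN spec, THEN mp, OF fin, of x] by (elim exE conjE) (rule that)
    have "\<exists>col :: 'a \<Rightarrow> nat. \<forall>a b. k \<le> card (arc_quad (P \<tau>) x \<tau> a b) \<longrightarrow> {..<k} \<subseteq> col ` arc_quad (P \<tau>) x \<tau> a b"
      if "\<tau> \<in> Ts" for \<tau>
    proof -
      have "finite (P \<tau>)" using P(1) that fin finite_subset by blast
      then show ?thesis unfolding arc_quad_def by (rule quad_colouring[OF _ k])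
    qed
    then obtain col :: "arc \<Rightarrow> 'a \<Rightarrow> nat" where col: "\<And>\<tau> a b. \<tau> \<in> Ts \<Longrightarrow> k \<le> card (arc_quad (P \<tau>) x \<tau> a b) \<Longrightarrow>
        {..<k} \<subseteq> col \<tau> ` arc_quad (P \<tau>) x \<tau> a b" by metis
    \<comment> \<open>The class of a point is unique by disjointness; points outside all classes get
      an arbitrary colour.\<close>
    define c where "c s = col (THE \<tau>. \<tau> \<in> Ts \<and> s \<in> P \<tau>) s" for s
    have c: "c s = col \<tau> s" if "\<tau> \<in> Ts" "s \<in> P \<tau>" for \<tau> s
    proof -
      have "(THE \<tau>. \<tau> \<in> Ts \<and> s \<in> P \<tau>) = \<tau>"
      proof (rule the_equality)
        show "\<rho> = \<tau>" if "\<rho> \<in> Ts \<and> s \<in> P \<rho>" for \<rho>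
          using that \<open>\<tau> \<in> Ts\<close> \<open>s \<in> P \<tau>\<close> P(2)
            unfolding disjoint_family_on_def by blast
      qed (use that in simp)
      then show ?thesis by (simp add: c_def)
    qed
    have "{..<k} \<subseteq> c ` arc_quad S x \<tau> a b" if t: "\<tau> \<in> Ts" and big: "M \<le> card (arc_quad S x \<tau> a b)" for \<tau> a b
    proof -
      have "{..<k} \<subseteq> col \<tau> ` arc_quad (P \<tau>) x \<tau> a b" using col[OF t] P(3) t big
        by blast
      also have "\<dots> = c ` arc_quad (P \<tau>) x \<tau> a b"
        using c[OF t] arc_quad_subset[of "P \<tau>" x \<tau> a b] by (intro image_cong) auto
      also have "\<dots> \<subseteq> c ` arc_quad S x \<tau> a b"
        using arc_quad_Int[of "P \<tau>" S x \<tau> a b] P(1) t by (intro image_mono) auto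
      finally show ?thesis .
    qed
    then show ?thesis by blast
  qed
  then show ?thesis by (intro exI[of _ M]) simp
qed

section \<open>Sectors of Jordan curves\<close>

lemma exists_angle_shift: "\<exists>n :: int. a \<le> x + 2 * pi * n \<and> x + 2 * pi * n < a + 2 * pi"
proof -
  define n where "n = \<lceil>(a - x) / (2 * pi)\<rceil>"
  have "(a - x) / (2 * pi) \<le> n" "n < (a - x) / (2 * pi) + 1" unfolding n_def by linarith+
  then have "a - x \<le> 2 * pi * n" "2 * pi * n < a - x + 2 * pi" by (simp_all add: field_simps)
  then show ?thesis by (intro exI[of _ n]) linarith
qed

lemma cis_add_2pi_int: "cis (t + 2 * pi * of_int n) = cis t"
proof -
  have "cos (t + 2 * pi * of_int n) = cos t" "sin (t + 2 * pi * of_int n) = sin t"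
    using sin_integer_2pi[of "of_int n"] cos_integer_2pi[of "of_int n"] by (simp_all add: sin_add cos_add)
  then show ?thesis by (simp add: complex_eq_iff)
qed

lemma exists_rcis_from:
  assumes "z \<noteq> 0"
  shows "\<exists>r t. 0 < r \<and> s \<le> t \<and> t < s + 2 * pi \<and> z = rcis r t"
proof -
  obtain n :: int where n: "s \<le> Arg z + 2 * pi * n" "Arg z + 2 * pi * n < s + 2 * pi"
    using exists_angle_shift by blast
  have "z = rcis (norm z) (Arg z + 2 * pi * n)"
    using rcis_cmod_Arg[of z] by (simp only: rcis_def cis_add_2pi_int)
  then show ?thesis using n assms by (intro exI[of _ "norm z"] exI[of _ "Arg z + 2 * pi * n"]) auto
qed

lemma proj_start: "proj (s + pi / 2) (rcis r t) = r * sin (t - s)"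
  by (simp add: proj_rcis cos_diff sin_diff cos_add sin_add algebra_simps)

lemma proj_end: "proj (s + \<phi> - pi / 2) (rcis r t) = r * sin (s + \<phi> - t)"
proof -
  have "cos (t - (s + \<phi> - pi / 2)) = sin (s + \<phi> - t)"
    using cos_sin_eq[of "t - (s + \<phi> - pi / 2)"] by (simp add: algebra_simps)
  then show ?thesis by (simp add: proj_rcis)
qed

lemma sin_nonpos_below: "- pi \<le> x \<Longrightarrow> x \<le> 0 \<Longrightarrow> sin x \<le> 0"
  using sin_ge_zero[of "- x"] by simp

lemma sin_nonpos_above: "pi \<le> x \<Longrightarrow> x \<le> 2 * pi \<Longrightarrow> sin x \<le> 0"
  using sin_ge_zero[of "x - pi"] by simp

text \<open>The two directions are the inner normals of the sides: a convex wedge is the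
  intersection of the half-planes they define.\<close>

lemma cone_of_iff_convex:
  assumes "0 < \<phi>" "\<phi> < pi"
  shows "z \<in> cone_of {s<..<s + \<phi>} \<longleftrightarrow> 0 < proj (s + pi / 2) z \<and> 0 < proj (s + \<phi> - pi / 2) z"
proof
  assume "z \<in> cone_of {s<..<s + \<phi>}"
  then obtain r t where z: "0 < r" "s < t" "t < s + \<phi>" "z = rcis r t" by (auto simp: cone_of_def)
  have "0 < sin (t - s)" "0 < sin (s + \<phi> - t)" using z assms by (auto intro!: sin_gt_zero)
  then show "0 < proj (s + pi / 2) z \<and> 0 < proj (s + \<phi> - pi / 2) z"
    using z by (simp add: proj_start proj_end)
next
  assume z: "0 < proj (s + pi / 2) z \<and> 0 < proj (s + \<phi> - pi / 2) z"
  then have "z \<noteq> 0" by (auto simp: proj_def)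
  then obtain r t where rt: "0 < r" "s \<le> t" "t < s + 2 * pi" "z = rcis r t"
    using exists_rcis_from[of z s] by blast
  then have s: "0 < sin (t - s)" "0 < sin (s + \<phi> - t)"
    using z by (auto simp: proj_start proj_end zero_less_mult_iff)
  have "t - s < pi" using s(1) sin_nonpos_above[of "t - s"] rt by linarith
  then have "t < s + \<phi>" using s(2) sin_nonpos_below[of "s + \<phi> - t"] assms by linarith
  moreover have "t \<noteq> s" using s(1) by auto
  ultimately show "z \<in> cone_of {s<..<s + \<phi>}" using rt by (force simp: cone_of_def)
qed

text \<open>From angle \<open>pi\<close> on, the wedge is the union of these half-planes; at
  \<open>pi\<close> itself they coincide.\<close>

lemma cone_of_iff_reflex:
  assumes "pi \<le> \<phi>" "\<phi> < 2 * pi"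
  shows "z \<in> cone_of {s<..<s + \<phi>} \<longleftrightarrow> 0 < proj (s + pi / 2) z \<or> 0 < proj (s + \<phi> - pi / 2) z"
proof
  assume "z \<in> cone_of {s<..<s + \<phi>}"
  then obtain r t where z: "0 < r" "s < t" "t < s + \<phi>" "z = rcis r t" by (auto simp: cone_of_def)
  have "0 < sin (t - s) \<or> 0 < sin (s + \<phi> - t)"
  proof (cases "t - s < pi")
    case True
    then show ?thesis using z by (auto intro!: sin_gt_zero)
  next
    case False
    then show ?thesis using z assms by (auto intro!: sin_gt_zero)
  qed
  then show "0 < proj (s + pi / 2) z \<or> 0 < proj (s + \<phi> - pi / 2) z"
    using z by (auto simp: proj_start proj_end zero_less_mult_iff)
next
  assume z: "0 < proj (s + pi / 2) z \<or> 0 < proj (s + \<phi> - pi / 2) z"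
  then have "z \<noteq> 0" by (auto simp: proj_def)
  then obtain r t where rt: "0 < r" "s \<le> t" "t < s + 2 * pi" "z = rcis r t"
    using exists_rcis_from[of z s] by blast
  then have s: "0 < sin (t - s) \<or> 0 < sin (s + \<phi> - t)"
    using z by (auto simp: proj_start proj_end zero_less_mult_iff)
  have "s < t \<and> t < s + \<phi>"
  proof (cases "0 < sin (t - s)")
    case True
    then have "t \<noteq> s" by auto
    moreover have "t - s < pi" using True sin_nonpos_above[of "t - s"] rt by linarith
    ultimately show ?thesis using assms rt by linarith
  next
    case False
    then have 1: "0 < sin (s + \<phi> - t)" using s by blast
    then have "s + \<phi> - t < pi" using sin_nonpos_above[of "s + \<phi> - t"] rt assms by linarith
    moreover have "0 < s + \<phi> - t" using 1 sin_nonpos_below[of "s + \<phi> - t"] rt assms by linarith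
    ultimately show ?thesis using assms rt False 1 by (cases "t = s") auto
  qed
  then show "z \<in> cone_of {s<..<s + \<phi>}" using rt by (force simp: cone_of_def)
qed

lemma halfline_scaleR:
  assumes "0 < c"
  shows "halfline v (c *\<^sub>R d) = halfline v d"
proof (intro subset_antisym subsetI)
  fix z assume "z \<in> halfline v (c *\<^sub>R d)"
  then obtain r where "0 \<le> r" "z = v + r *\<^sub>R (c *\<^sub>R d)" by (auto simp: halfline_def)
  then show "z \<in> halfline v d" using assms unfolding halfline_def
    by (intro CollectI exI[of _ "r * c"]) simp
next
  fix z assume "z \<in> halfline v d"
  then obtain r where "0 \<le> r" "z = v + r *\<^sub>R d" by (auto simp: halfline_def)
  then show "z \<in> halfline v (c *\<^sub>R d)"
    using assms unfolding halfline_def by (intro CollectI exI[of _ "r / c"]) simp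
qed

lemma cone_of_avoids_sides:
  assumes "0 < \<phi>" "\<phi> < 2 * pi" "0 \<le> c"
  shows "rcis c s \<notin> cone_of {s<..<s + \<phi>}" "rcis c (s + \<phi>) \<notin> cone_of {s<..<s + \<phi>}"
proof -
  have "rcis c s \<notin> cone_of {s<..<s + \<phi>} \<and> rcis c (s + \<phi>) \<notin> cone_of {s<..<s + \<phi>}"
  proof (cases "\<phi> < pi")
    case True
    then show ?thesis using assms by (simp add: cone_of_iff_convex proj_start proj_end)
  next
    case False
    then have "sin \<phi> \<le> 0" using sin_nonpos_above[of \<phi>] assms by simp
    then have "c * sin \<phi> \<le> 0" using assms by (simp add: mult_nonneg_nonpos)
    then show ?thesis using assms False by (simp add: cone_of_iff_reflex proj_start proj_end)
  qed
  then show "rcis c s \<notin> cone_of {s<..<s + \<phi>}" "rcis c (s + \<phi>) \<notin> cone_of {s<..<s + \<phi>}" by auto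
qed

lemma connected_sector: "connected ((\<lambda>z. v + z) ` cone_of {a<..<b} \<inter> ball v e)"
proof -
  have "(\<lambda>z. v + z) ` cone_of {a<..<b} \<inter> ball v e = (\<lambda>(r, t). v + rcis r t) ` ({0<..<e} \<times> {a<..<b})"
    by (auto simp: cone_of_def dist_norm image_iff Bex_def) (force simp: dist_norm)+
  moreover have "connected ({0<..<e} \<times> {a<..<b} :: (real \<times> real) set)"
    by (intro connected_Times) auto
  moreover have "continuous_on ({0<..<e} \<times> {a<..<b}) (\<lambda>(r, t). v + rcis r t)"
    unfolding rcis_def case_prod_beta cis_conv_exp by (intro continuous_intros)
  ultimately show ?thesis by (metis connected_continuous_image)
qed

text \<open>Two halflines cut a small disc about a point of a Jordan curve into two sectors.  Each of them
  lies on one side of the curve, and both sides occur, since the point is on the frontier of both.\<close>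

lemma jordan_sector:
  assumes g: "simple_path g" "pathfinish g = pathstart g" and e: "0 < e" and \<phi>: "0 < \<phi>" "\<phi> < 2 * pi"
    and loc: "path_image g \<inter> ball v e = (halfline v (cis s) \<union> halfline v (cis (s + \<phi>))) \<inter> ball v e"
  shows "\<exists>W. apex W = v \<and> (start W = s \<and> angle W = \<phi> \<or> start W = s + \<phi> \<and> angle W = 2 * pi - \<phi>) \<and>
    inside (path_image g) \<inter> ball v e = wedge_region W \<inter> ball v e"
proof -
  define C1 where "C1 = (\<lambda>z. v + z) ` cone_of {s<..<s + \<phi>} \<inter> ball v e"
  \<comment> \<open>The upper end keeps the form start plus angle, so that the complementary sector
    is literally the region of a wedge.\<close>
  define C2 where "C2 = (\<lambda>z. v + z) ` cone_of {s + \<phi><..<s + \<phi> + (2 * pi - \<phi>)} \<inter> ball v e"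
  let ?J = "path_image g"
  note J = Jordan_inside_outside[OF g]
  have hl: "z \<in> halfline v (cis t) \<longleftrightarrow> (\<exists>c\<ge>0. z - v = rcis c t)" for z t
    by (auto simp: halfline_def rcis_def scaleR_conv_of_real algebra_simps)
  have c2pi: "rcis c (s + \<phi> + (2 * pi - \<phi>)) = rcis c s" for c
    using cis_add_2pi_int[of s 1] by (simp add: rcis_def)
  have av: "C1 \<inter> ?J = {}" "C2 \<inter> ?J = {}"
  proof -
    have "z \<notin> ?J" if "z \<in> C1" for z
    proof -
      have "z - v \<in> cone_of {s<..<s + \<phi>}" "z \<in> ball v e" using that by (auto simp: C1_def)
      then show ?thesis using cone_of_avoids_sides(1)[OF \<phi>] cone_of_avoids_sides(2)[OF \<phi>] loc hl
        by (metis Int_iff Un_iff)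
    qed
    then show "C1 \<inter> ?J = {}" by blast
    have \<phi>': "0 < 2 * pi - \<phi>" "2 * pi - \<phi> < 2 * pi" using \<phi> by auto
    have "z \<notin> ?J" if "z \<in> C2" for z
    proof -
      have "z - v \<in> cone_of {s + \<phi><..<s + \<phi> + (2 * pi - \<phi>)}" "z \<in> ball v e"
        using that by (auto simp: C2_def)
      then show ?thesis
        using cone_of_avoids_sides(1)[OF \<phi>', of _ "s + \<phi>"] cone_of_avoids_sides(2)[OF \<phi>', of _ "s + \<phi>"] loc hl c2pi
        by (metis Int_iff Un_iff)
    qed
    then show "C2 \<inter> ?J = {}" by blast
  qed
  have cover: "ball v e - ?J \<subseteq> C1 \<union> C2"
  proof
    fix z assume z: "z \<in> ball v e - ?J"
    then have nh: "z \<notin> halfline v (cis s)" "z \<notin> halfline v (cis (s + \<phi>))" using loc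
      by blast+
    then have "z - v \<noteq> 0" using hl[of z s] by (metis order_refl rcis_zero_mod)
    then obtain r t where rt: "0 < r" "s \<le> t" "t < s + 2 * pi" "z - v = rcis r t"
      using exists_rcis_from by blast
    have "t \<noteq> s" "t \<noteq> s + \<phi>" using nh hl rt by (metis less_imp_le)+
    then have "z - v \<in> cone_of {s<..<s + \<phi>} \<or> z - v \<in> cone_of {s + \<phi><..<s + \<phi> + (2 * pi - \<phi>)}"
      unfolding cone_of_def using rt by (force simp: not_less)
    then have "v + (z - v) \<in> (\<lambda>z. v + z) ` cone_of {s<..<s + \<phi>} \<or>
        v + (z - v) \<in> (\<lambda>z. v + z) ` cone_of {s + \<phi><..<s + \<phi> + (2 * pi - \<phi>)}" by blast
    then show "z \<in> C1 \<union> C2" using z by (auto simp: C1_def C2_def)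
  qed
  have side: "C \<subseteq> inside ?J \<or> C \<subseteq> outside ?J" if "connected C" "C \<inter> ?J = {}" for C
  proof (rule ccontr)
    assume neg: "\<not> ?thesis"
    have sub: "C \<subseteq> inside ?J \<union> outside ?J" using J that(2) by blast
    then have "inside ?J \<inter> C \<noteq> {}" "outside ?J \<inter> C \<noteq> {}" using neg by blast+
    moreover have "inside ?J \<inter> outside ?J \<inter> C = {}" using J by blast
    ultimately show False using connectedD[OF that(1), of "inside ?J" "outside ?J"] J sub by blast
  qed
  have "v \<in> ?J"
  proof -
    have "v \<in> halfline v (cis s)" using hl by (auto intro: exI[of _ 0])
    then show ?thesis using loc e by (metis Int_iff Un_iff centre_in_ball)
  qed
  then have "v \<in> closure (inside ?J)" "v \<in> closure (outside ?J)" using J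
    by (auto simp: frontier_def)
  then have meet: "inside ?J \<inter> ball v e \<noteq> {}" "outside ?J \<inter> ball v e \<noteq> {}"
    using e by (metis Int_commute centre_in_ball closure_iff_nhds_not_empty open_ball open_contains_ball_eq subset_refl)+
  have io: "inside ?J \<inter> ?J = {}" "outside ?J \<inter> ?J = {}" "inside ?J \<inter> outside ?J = {}"
    using J by blast+
  have C12: "C1 \<subseteq> ball v e" "C2 \<subseteq> ball v e" by (auto simp: C1_def C2_def)
  have s1: "C1 \<subseteq> inside ?J \<or> C1 \<subseteq> outside ?J" and s2: "C2 \<subseteq> inside ?J \<or> C2 \<subseteq> outside ?J"
    using side av connected_sector unfolding C1_def C2_def by blast+
  have "inside ?J \<inter> ball v e = C1 \<or> inside ?J \<inter> ball v e = C2"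
  proof -
    have a: "inside ?J \<inter> ball v e \<subseteq> C1 \<union> C2" "outside ?J \<inter> ball v e \<subseteq> C1 \<union> C2" using cover io by blast+
    have "\<not> (C1 \<subseteq> inside ?J \<and> C2 \<subseteq> inside ?J)" using a(2) meet(2) io(3)
      by blast
    moreover have "\<not> (C1 \<subseteq> outside ?J \<and> C2 \<subseteq> outside ?J)"
      using a(1) meet(1) io(3) by blast
    ultimately consider "C1 \<subseteq> inside ?J" "C2 \<subseteq> outside ?J" | "C1 \<subseteq> outside ?J" "C2 \<subseteq> inside ?J"
      using s1 s2 by blast
    then show ?thesis
    proof cases
      case 1
      then have "inside ?J \<inter> ball v e = C1" using a(1) io(3) C12 by blast
      then show ?thesis ..
    next
      case 2
      then have "inside ?J \<inter> ball v e = C2" using a(1) io(3) C12 by blast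
      then show ?thesis ..
    qed
  qed
  then show ?thesis
  proof
    assume "inside ?J \<inter> ball v e = C1"
    then show ?thesis by (intro exI[of _ "Wedge v s \<phi>"]) (simp add: wedge_region_def C1_def)
  next
    assume "inside ?J \<inter> ball v e = C2"
    then show ?thesis by (intro exI[of _ "Wedge v (s + \<phi>) (2 * pi - \<phi>)"]) (simp add: wedge_region_def C2_def)
  qed
qed

lemma closed_segment_ball:
  fixes v p :: complex
  assumes "e \<le> dist v p"
  shows "closed_segment v p \<inter> ball v e = halfline v (p - v) \<inter> ball v e"
proof -
  have "r \<le> 1" if "0 \<le> r" "v + r *\<^sub>R (p - v) \<in> ball v e" for r
  proof (rule ccontr)
    assume "\<not> r \<le> 1"
    then have "norm (p - v) \<le> r * norm (p - v)" by (simp add: mult_le_cancel_right1)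
    also have "\<dots> = dist v (v + r *\<^sub>R (p - v))" using that(1) by (simp add: dist_norm)
    also have "\<dots> < e" using that(2) by simp
    finally show False using assms by (simp add: dist_norm norm_minus_commute)
  qed
  moreover have "closed_segment v p = {v + r *\<^sub>R (p - v) | r. 0 \<le> r \<and> r \<le> 1}"
    by (auto simp: closed_segment_def algebra_simps)
  ultimately show ?thesis by (auto simp: halfline_def)
qed

text \<open>The rest \<open>R\<close> of the curve is closed and misses \<open>v\<close>, so near
  \<open>v\<close> only the two segments remain. The last conclusion serves inner points of a side,
  where the segments are opposite.\<close>

lemma two_segment_sector:
  assumes g: "simple_path g" "pathfinish g = pathstart g"
    and img: "path_image g = closed_segment v p \<union> closed_segment v q \<union> R" and R: "closed R" "v \<notin> R"
    and pq: "p \<noteq> v" "q \<noteq> v" "\<And>c. 0 < c \<Longrightarrow> q - v \<noteq> c *\<^sub>R (p - v)"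
  shows "\<exists>W e. 0 < e \<and> apex W = v \<and> 0 < angle W \<and> angle W < 2 * pi \<and>
    boundary_halflines W = {halfline v (p - v), halfline v (q - v)} \<and>
    inside (path_image g) \<inter> ball v e = wedge_region W \<inter> ball v e \<and>
    ((\<exists>c>0. q - v = - c *\<^sub>R (p - v)) \<longrightarrow> angle W = pi)"
proof -
  obtain d where d: "0 < d" "ball v d \<inter> R = {}"
    using R open_contains_ball_eq[of "- R" v] by (auto simp: open_Compl)
  define e where "e = min d (min (dist v p) (dist v q))"
  have e: "0 < e" "e \<le> d" "e \<le> dist v p" "e \<le> dist v q" using d pq by (auto simp: e_def)
  obtain r s where rs: "0 < r" "p - v = rcis r s" using exists_rcis_from[of "p - v" 0] pq(1) by auto
  obtain r' t where rt: "0 < r'" "s \<le> t" "t < s + 2 * pi" "q - v = rcis r' t"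
    using exists_rcis_from[of "q - v" s] pq(2) by auto
  define \<phi> where "\<phi> = t - s"
  have sc: "rcis x y = x *\<^sub>R cis y" for x y by (simp add: rcis_def scaleR_conv_of_real)
  have "t \<noteq> s"
  proof
    assume "t = s"
    then have "q - v = (r' / r) *\<^sub>R (p - v)" using rs rt by (simp add: sc)
    then show False using pq(3)[of "r' / r"] rs rt by simp
  qed
  then have \<phi>: "0 < \<phi>" "\<phi> < 2 * pi" using rt by (auto simp: \<phi>_def)
  have h: "halfline v (p - v) = halfline v (cis s)" "halfline v (q - v) = halfline v (cis (s + \<phi>))"
    using halfline_scaleR rs rt by (simp_all add: sc \<phi>_def)
  have "path_image g \<inter> ball v e = (closed_segment v p \<inter> ball v e) \<union> (closed_segment v q \<inter> ball v e)"
  proof -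
    have "ball v e \<inter> R = {}" using d(2) subset_ball[OF e(2), of v] by blast
    then show ?thesis using img by blast
  qed
  then have loc: "path_image g \<inter> ball v e = (halfline v (cis s) \<union> halfline v (cis (s + \<phi>))) \<inter> ball v e"
    using closed_segment_ball[OF e(3)] closed_segment_ball[OF e(4)] h by blast
  obtain W where W: "apex W = v" "start W = s \<and> angle W = \<phi> \<or> start W = s + \<phi> \<and> angle W = 2 * pi - \<phi>"
    "inside (path_image g) \<inter> ball v e = wedge_region W \<inter> ball v e"
    using jordan_sector[OF g e(1) \<phi> loc] by blast
  have "cis (s + \<phi> + (2 * pi - \<phi>)) = cis s" using cis_add_2pi_int[of s 1] by simp
  then have "boundary_halflines W = {halfline v (p - v), halfline v (q - v)}"
    using W(1,2) h by (auto simp: boundary_halflines_def)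
  moreover have "angle W = pi" if "\<exists>c>0. q - v = - c *\<^sub>R (p - v)"
  proof -
    obtain c where c: "0 < c" "q - v = - c *\<^sub>R (p - v)" using \<open>\<exists>c>0. _\<close> by blast
    have "cis t = (- c * r / r') *\<^sub>R cis s"
    proof -
      have "r' *\<^sub>R cis t = (- c * r) *\<^sub>R cis s" using c(2) rs rt by (simp add: sc)
      then have "(1 / r') *\<^sub>R (r' *\<^sub>R cis t) = (1 / r') *\<^sub>R ((- c * r) *\<^sub>R cis s)"
        by simp
      then show ?thesis using rt(1) by (simp add: field_simps)
    qed
    \<comment> \<open>Both directions are unit vectors, so the factor is -1, and
      \<open>\<phi>\<close> is an odd multiple of \<open>pi\<close> strictly between 0 and
      \<open>2 * pi\<close>.\<close>
    moreover have "norm (cis t) = 1" "norm (cis s) = 1" by simp_all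
    ultimately have "c * r / r' = 1"
      using c(1) rs rt by (metis abs_minus_cancel abs_of_pos divide_pos_pos minus_divide_left minus_mult_left mult.right_neutral mult_pos_pos norm_scaleR)
    then have "- c * r / r' = - 1" by (metis minus_divide_left minus_mult_left)
    with \<open>cis t = _\<close> have "cis t = (- 1) *\<^sub>R cis s" by (simp only:)
    then have "cis t = - cis s" by simp
    then have "cis \<phi> = - 1" by (simp add: \<phi>_def flip: cis_divide)
    then have "cos \<phi> = - 1" by (simp add: complex_eq_iff)
    then have "cos (\<phi> - pi) = 1" by simp
    then obtain n :: int where n: "\<phi> - pi = real_of_int n * 2 * pi" using cos_one_2pi_int by blast
    have "\<bar>\<phi> - pi\<bar> < pi" using \<phi> by linarith
    then have "\<bar>real_of_int n\<bar> * 2 * pi < pi" using n by (simp add: abs_mult)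
    moreover have "1 * (2 * pi) \<le> \<bar>real_of_int n\<bar> * (2 * pi)" if "n \<noteq> 0"
      using that by (intro mult_right_mono) auto
    ultimately have "n = 0" using pi_gt_zero by (auto simp: mult.assoc)
    then have "\<phi> = pi" using n by simp
    then show ?thesis using W(2) by auto
  qed
  ultimately show ?thesis using e(1) W \<phi> by (intro exI[of _ W] exI[of _ e]) auto
qed

section \<open>Polygons\<close>

lemma UN_lessThan_Suc_shift: "(\<Union>i<Suc n. A i) = A 0 \<union> (\<Union>i<n. A (Suc i))"
  by (simp add: lessThan_Suc_eq_insert_0)

lemma pathstart_polygonal_path: "xs \<noteq> [] \<Longrightarrow> pathstart (polygonal_path xs) = hd xs"
  by (cases xs rule: polygonal_path.cases) auto

lemma pathfinish_polygonal_path: "xs \<noteq> [] \<Longrightarrow> pathfinish (polygonal_path xs) = last xs"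
  by (induction xs rule: polygonal_path.induct) auto

lemma path_image_polygonal_path:
  "2 \<le> length xs \<Longrightarrow> path_image (polygonal_path xs) = (\<Union>i<length xs - 1. closed_segment (xs ! i) (xs ! Suc i))"
proof (induction xs rule: polygonal_path.induct)
  case (4 a b c xs)
  have "path_image (polygonal_path (a # b # c # xs)) =
      closed_segment a b \<union> path_image (polygonal_path (b # c # xs))"
    using pathstart_polygonal_path[of "b # c # xs"] by (simp add: path_image_join)
  also have "path_image (polygonal_path (b # c # xs)) =
      (\<Union>i<Suc (length xs). closed_segment ((b # c # xs) ! i) ((b # c # xs) ! Suc i))"
    using 4 by simp
  also have "closed_segment a b \<union> \<dots> =
      (\<Union>i<Suc (Suc (length xs)). closed_segment ((a # b # c # xs) ! i) ((a # b # c # xs) ! Suc i))"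
    by (subst (2) UN_lessThan_Suc_shift) simp
  finally show ?case by simp
qed auto

text \<open>The first segment meets the rest of the arc only at their junction \<open>b\<close>, and
  by induction \<open>b\<close> lies on no segment of the rest but the first.\<close>

lemma arc_polygonal_path:
  assumes "arc (polygonal_path xs)" "2 \<le> length xs"
  shows "(\<forall>i<length xs - 1. xs ! i \<noteq> xs ! Suc i) \<and>
    (\<forall>i j x. i < j \<longrightarrow> j < length xs - 1 \<longrightarrow> x \<in> closed_segment (xs ! i) (xs ! Suc i) \<longrightarrow>
       x \<in> closed_segment (xs ! j) (xs ! Suc j) \<longrightarrow> j = Suc i \<and> x = xs ! j)"
  using assms
proof (induction xs rule: polygonal_path.induct)
  case (3 a b)
  then show ?case using arc_distinct_ends[of "linepath a b"] by simp
next
  case (4 a b c xs)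
  define ys where "ys = b # c # xs"
  have pf: "pathfinish (linepath a b) = pathstart (polygonal_path ys)"
    using pathstart_polygonal_path[of ys] by (simp add: ys_def)
  have "arc (linepath a b +++ polygonal_path ys)" using 4(2) by (simp add: ys_def)
  then have A: "arc (linepath a b)" "arc (polygonal_path ys)"
    "path_image (linepath a b) \<inter> path_image (polygonal_path ys) \<subseteq> {b}"
    using arc_join_eq[OF pf] pathstart_polygonal_path[of ys] by (simp_all add: ys_def)
  have ab: "a \<noteq> b" using arc_distinct_ends[OF A(1)] by simp
  have len: "2 \<le> length ys" by (simp add: ys_def)
  have IH: "\<And>i. i < length ys - 1 \<Longrightarrow> ys ! i \<noteq> ys ! Suc i"
    "\<And>i j x. \<lbrakk>i < j; j < length ys - 1; x \<in> closed_segment (ys ! i) (ys ! Suc i);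
       x \<in> closed_segment (ys ! j) (ys ! Suc j)\<rbrakk> \<Longrightarrow> j = Suc i \<and> x = ys ! j"
    using 4(1) A(2) len unfolding ys_def by blast+
  have xs: "a # b # c # xs = a # ys" by (simp add: ys_def)
  have y0: "ys ! 0 = b" by (simp add: ys_def)
  have "(a # ys) ! i \<noteq> (a # ys) ! Suc i" if "i < length ys" for i
    using that IH(1)[of "i - 1"] ab y0 by (cases i) auto
  moreover have "j = Suc i \<and> x = (a # ys) ! j"
    if ij: "i < j" "j < length ys" and x: "x \<in> closed_segment ((a # ys) ! i) ((a # ys) ! Suc i)"
      "x \<in> closed_segment ((a # ys) ! j) ((a # ys) ! Suc j)" for i j x
  proof -
    obtain j' where j': "j = Suc j'" using ij by (cases j) auto
    show ?thesis
    proof (cases i)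
      case (Suc i')
      then show ?thesis using IH(2)[of i' j' x] ij x j' by simp
    next
      case 0
      have xj: "x \<in> closed_segment (ys ! j') (ys ! Suc j')" using x(2) j' by simp
      then have "x \<in> path_image (polygonal_path ys)"
        using path_image_polygonal_path[OF len] ij j' by force
      moreover have "x \<in> path_image (linepath a b)" using x(1) 0 y0 by simp
      ultimately have xb: "x = b" using A(3) by blast
      have "j' = 0"
      proof (rule ccontr)
        assume "j' \<noteq> 0"
        moreover have "x \<in> closed_segment (ys ! 0) (ys ! Suc 0)" using xb y0 by simp
        ultimately have "j' = Suc 0 \<and> x = ys ! j'" using IH(2)[of 0 j' x] xj ij j' by simp
        then show False using IH(1)[of 0] xb y0 len by simp
      qed
      then show ?thesis using 0 j' xb y0 by simp
    qed
  qed
  ultimately show ?case unfolding xs by simp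
qed auto

definition side :: "complex list \<Rightarrow> nat \<Rightarrow> complex set" where
  "side vs i = closed_segment (vs ! i) (next_vertex vs i)"

text \<open>Removing the first side from the loop leaves an arc, to which
  \<open>arc_polygonal_path\<close> applies. The pair 0 and \<open>n - 1\<close> is the closing
  corner.\<close>

lemma boundary_sides:
  assumes "simple_polygon vs"
  defines "n \<equiv> length vs"
  shows "path_image (boundary_path vs) = (\<Union>i<n. side vs i)"
    and "\<And>i. i < n \<Longrightarrow> vs ! i \<noteq> next_vertex vs i"
    and "\<And>i j x. \<lbrakk>i < j; j < n; x \<in> side vs i; x \<in> side vs j\<rbrakk> \<Longrightarrow>
          (j = Suc i \<and> x = vs ! j) \<or> (i = 0 \<and> j = n - 1 \<and> x = vs ! 0)"
proof -
  have sp: "3 \<le> n" "simple_path (boundary_path vs)" using assms by (auto simp: simple_polygon_def)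
  obtain a b c r where vs: "vs = a # b # c # r"
    using sp(1) unfolding n_def by (auto simp: numeral_3_eq_3 Suc_le_length_iff)
  define ys where "ys = b # c # r @ [a]"
  define bs where "bs = a # ys"
  have bs: "bs = vs @ [a]" by (simp add: bs_def ys_def vs)
  have len: "length ys = n" "2 \<le> length ys" "length bs = Suc n"
    by (simp_all add: ys_def bs_def n_def vs)
  have nth: "bs ! i = vs ! i" if "i < n" for i using that by (simp add: bs nth_append n_def)
  have nxt: "bs ! Suc i = next_vertex vs i" if "i < n" for i
  proof (cases "Suc i = n")
    case True
    then show ?thesis by (simp add: bs next_vertex_def nth_append n_def vs)
  next
    case False
    then show ?thesis using that by (simp add: bs next_vertex_def nth_append n_def)
  qed
  have side: "side vs i = closed_segment (bs ! i) (bs ! Suc i)" if "i < n" for i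
    using that nth nxt by (simp add: side_def)
  have ysS: "bs ! Suc i = ys ! i" for i by (simp add: bs_def)
  have bp: "boundary_path vs = polygonal_path bs" by (simp add: boundary_path_def bs vs)
  show "path_image (boundary_path vs) = (\<Union>i<n. side vs i)"
    unfolding bp using path_image_polygonal_path[of bs] len side by simp
  have bp': "boundary_path vs = linepath a b +++ polygonal_path ys"
    by (simp add: bp bs_def ys_def)
  have ends: "pathfinish (polygonal_path ys) = pathstart (linepath a b)"
    "pathfinish (linepath a b) = pathstart (polygonal_path ys)"
    using pathfinish_polygonal_path[of ys] pathstart_polygonal_path[of ys] by (simp_all add: ys_def)
  have A: "arc (linepath a b)" "arc (polygonal_path ys)"
    "path_image (linepath a b) \<inter> path_image (polygonal_path ys) \<subseteq> {a, b}"
    using sp(2) simple_path_join_loop_eq[OF ends] ends by (simp_all add: bp')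
  have ab: "a \<noteq> b" using arc_distinct_ends[OF A(1)] by simp
  have Y: "\<And>i. i < n - 1 \<Longrightarrow> ys ! i \<noteq> ys ! Suc i"
    "\<And>i j x. \<lbrakk>i < j; j < n - 1; x \<in> closed_segment (ys ! i) (ys ! Suc i);
       x \<in> closed_segment (ys ! j) (ys ! Suc j)\<rbrakk> \<Longrightarrow> j = Suc i \<and> x = ys ! j"
    using arc_polygonal_path[OF A(2) len(2)] unfolding len(1) by blast+
  have y0: "ys ! 0 = b" by (simp add: ys_def)
  have yl: "ys ! (n - 1) = a" by (simp add: ys_def n_def vs nth_append)
  have b0: "bs ! 0 = a" by (simp add: bs_def)
  show "vs ! i \<noteq> next_vertex vs i" if i: "i < n" for i
  proof -
    have "bs ! i \<noteq> bs ! Suc i" using i Y(1)[of "i - 1"] ab y0 b0 ysS by (cases i) auto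
    then show ?thesis using nth[OF i] nxt[OF i] by simp
  qed
  show "(j = Suc i \<and> x = vs ! j) \<or> (i = 0 \<and> j = n - 1 \<and> x = vs ! 0)"
    if ij: "i < j" "j < n" and x: "x \<in> side vs i" "x \<in> side vs j" for i j x
  proof -
    obtain j' where j': "j = Suc j'" using ij by (cases j) auto
    have xj: "x \<in> closed_segment (ys ! j') (ys ! Suc j')" using x(2) side[OF ij(2)] j' ysS by simp
    have j'n: "j' < n - 1" using ij j' by simp
    have vj: "vs ! j = ys ! j'" using nth[OF ij(2)] ysS j' by simp
    show ?thesis
    proof (cases i)
      case (Suc i')
      then have "x \<in> closed_segment (ys ! i') (ys ! Suc i')" using x(1) side[of i] ij ysS by simp
      then show ?thesis using Y(2)[of i' j' x] xj j'n ij j' Suc vj by simp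
    next
      case 0
      \<comment> \<open>The first side meets the rest only in its ends; \<open>b\<close> occurs
        there only on the next side and \<open>a\<close> only on the last one.\<close>
      have "x \<in> path_image (polygonal_path ys)"
        using path_image_polygonal_path[OF len(2)] xj j'n len(1) by force
      moreover have "x \<in> path_image (linepath a b)" using x(1) side[of 0] 0 ij b0 ysS[of 0] y0 by simp
      ultimately consider "x = b" | "x = a" using A(3) by blast
      then show ?thesis
      proof cases
        case 1
        have "j' = 0"
        proof (rule ccontr)
          assume "j' \<noteq> 0"
          moreover have "x \<in> closed_segment (ys ! 0) (ys ! Suc 0)" using 1 y0 by simp
          ultimately have "j' = Suc 0 \<and> x = ys ! j'" using Y(2)[of 0 j' x] xj j'n by simp
          then show False using Y(1)[of 0] 1 y0 sp(1) by simp
        qed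
        then show ?thesis using 0 j' vj 1 y0 by simp
      next
        case 2
        have "j' = n - 2"
        proof (rule ccontr)
          assume "j' \<noteq> n - 2"
          then have lt: "j' < n - 2" "n - 2 < n - 1" "Suc (n - 2) = n - 1" using j'n sp(1) by auto
          have "x \<in> closed_segment (ys ! (n - 2)) (ys ! Suc (n - 2))" using 2 yl lt(3) by simp
          then have "x = ys ! (n - 2)" using Y(2)[OF lt(1,2) xj] by simp
          then show False using Y(1)[OF lt(2)] 2 yl lt(3) by simp
        qed
        then show ?thesis using 0 j' 2 sp(1) by (simp add: vs)
      qed
    qed
  qed
qed

lemma boundary_path_closed: "vs \<noteq> [] \<Longrightarrow> pathfinish (boundary_path vs) = pathstart (boundary_path vs)"
  using pathstart_polygonal_path[of "vs @ [hd vs]"] pathfinish_polygonal_path[of "vs @ [hd vs]"]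
  by (simp add: boundary_path_def)

text \<open>At a vertex, exactly two sides meet, and noncollinearity separates their halflines. At
  an inner point, the side is split into two opposite segments; then the angle is \<open>pi\<close>
  and the last clause is vacuous.\<close>

lemma polygon_sector:
  assumes vs: "simple_polygon vs" and x: "x \<in> path_image (boundary_path vs)"
  shows "\<exists>W e. 0 < e \<and> apex W = x \<and> 0 < angle W \<and> angle W < 2 * pi \<and>
    open_polygon vs \<inter> ball x e = wedge_region W \<inter> ball x e \<and>
    (angle W < pi \<longrightarrow> (\<exists>i<length vs. x = vs ! i \<and> vertex_wedge vs i W))"
proof -
  define n where "n = length vs"
  note B = boundary_sides[OF vs, folded n_def]
  have n3: "3 \<le> n" using vs by (simp add: simple_polygon_def n_def)
  have g: "simple_path (boundary_path vs)" "pathfinish (boundary_path vs) = pathstart (boundary_path vs)"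
  proof -
    have "vs \<noteq> []" using n3 by (auto simp: n_def)
    then show "pathfinish (boundary_path vs) = pathstart (boundary_path vs)" by (rule boundary_path_closed)
  qed (use vs in \<open>simp add: simple_polygon_def\<close>)
  have closedR: "closed (\<Union>j\<in>J. side vs j)" if "finite J" for J
    using that by (intro closed_UN) (auto simp: side_def)
  show ?thesis
  proof (cases "\<exists>i<n. x = vs ! i")
    case True
    then obtain i where i: "i < n" "x = vs ! i" by blast
    define k where "k = (i + n - 1) mod n"
    have k: "k < n" using n3 by (simp add: k_def)
    have ki: "k = (if i = 0 then n - 1 else i - 1)"
      using i n3 by (cases i) (auto simp: k_def)
    have nk: "next_vertex vs k = x" using i ki n3 by (auto simp: next_vertex_def n_def[symmetric])
    have pk: "prev_vertex vs i = vs ! k" by (simp add: prev_vertex_def k_def n_def)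
    have only: "x \<notin> side vs j" if j: "j < n" "j \<noteq> i" "j \<noteq> k" for j
    proof
      assume xj: "x \<in> side vs j"
      have xi: "x \<in> side vs i" using i by (simp add: side_def)
      consider "i < j" | "j < i" using j by linarith
      then show False
      proof cases
        case 1
        from B(3)[OF 1 j(1) xi xj] show False
        proof
          assume a: "j = Suc i \<and> x = vs ! j"
          then have "next_vertex vs i = vs ! j" using j(1) by (simp add: next_vertex_def n_def)
          then show False using B(2)[OF i(1)] a i(2) by simp
        next
          assume "i = 0 \<and> j = n - 1 \<and> x = vs ! 0"
          then show False using j ki by simp
        qed
      next
        case 2
        from B(3)[OF 2 i(1) xj xi] show False
        proof
          assume "i = Suc j \<and> x = vs ! i"
          then show False using j ki by simp
        next
          assume a: "j = 0 \<and> i = n - 1 \<and> x = vs ! 0"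
          then have "next_vertex vs i = vs ! 0" using n3 by (simp add: next_vertex_def n_def[symmetric])
          then show False using B(2)[OF i(1)] a i(2) by metis
        qed
      qed
    qed
    define R where "R = (\<Union>j\<in>{..<n} - {i, k}. side vs j)"
    have "path_image (boundary_path vs) = side vs k \<union> side vs i \<union> R"
      unfolding B(1) R_def using i(1) k by blast
    then have img: "path_image (boundary_path vs) =
        closed_segment x (prev_vertex vs i) \<union> closed_segment x (next_vertex vs i) \<union> R"
      using nk pk i by (simp add: side_def closed_segment_commute)
    have R: "closed R" "x \<notin> R" using closedR only by (auto simp: R_def)
    have pq: "prev_vertex vs i \<noteq> x" "next_vertex vs i \<noteq> x"
      using B(2)[OF k] B(2)[OF i(1)] nk pk i by auto
    have "next_vertex vs i - x \<noteq> c *\<^sub>R (prev_vertex vs i - x)" for c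
    proof
      assume e: "next_vertex vs i - x = c *\<^sub>R (prev_vertex vs i - x)"
      have "collinear {0, prev_vertex vs i - x, next_vertex vs i - x}"
        using e collinear_lemma by blast
      then have "collinear {prev_vertex vs i, x, next_vertex vs i}"
        by (simp add: collinear_3[of "prev_vertex vs i" x "next_vertex vs i"] NO_MATCH_def)
      then show False using vs i by (simp add: simple_polygon_def n_def)
    qed
    then obtain W e where W: "0 < e" "apex W = x" "0 < angle W" "angle W < 2 * pi"
      "boundary_halflines W = {halfline x (prev_vertex vs i - x), halfline x (next_vertex vs i - x)}"
      "inside (path_image (boundary_path vs)) \<inter> ball x e = wedge_region W \<inter> ball x e"
      using two_segment_sector[OF g img R pq] by blast
    have "vertex_wedge vs i W" unfolding vertex_wedge_def open_polygon_def using W i(2) by auto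
    then show ?thesis using W i unfolding open_polygon_def n_def by blast
  next
    case False
    obtain i where i: "i < n" "x \<in> side vs i" using x B(1) by blast
    let ?p = "vs ! i" and ?q = "next_vertex vs i"
    have nx: "\<exists>j<n. ?q = vs ! j" using n3 unfolding next_vertex_def n_def[symmetric]
      by (intro exI[of _ "Suc i mod n"]) auto
    have ne: "x \<noteq> ?p" "x \<noteq> ?q" using False i(1) nx by metis+
    have only: "x \<notin> side vs j" if j: "j < n" "j \<noteq> i" for j
    proof
      assume xj: "x \<in> side vs j"
      have v: "x \<noteq> vs ! j" "x \<noteq> vs ! i" "x \<noteq> vs ! 0" using False j(1) i(1) n3 by auto
      consider "i < j" | "j < i" using j by linarith
      then show False using B(3)[of i j x] B(3)[of j i x] i xj j v by cases auto
    qed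
    define R where "R = (\<Union>j\<in>{..<n} - {i}. side vs j)"
    have "path_image (boundary_path vs) = side vs i \<union> R" unfolding B(1) R_def using i(1) by blast
    moreover have "side vs i = closed_segment x ?p \<union> closed_segment x ?q"
      using Un_closed_segment[of x ?p ?q] i(2) by (simp add: side_def closed_segment_commute)
    ultimately have img: "path_image (boundary_path vs) = closed_segment x ?p \<union> closed_segment x ?q \<union> R" by simp
    have R: "closed R" "x \<notin> R" using closedR only by (auto simp: R_def)
    obtain u where u: "0 \<le> u" "u \<le> 1" "x = (1 - u) *\<^sub>R ?p + u *\<^sub>R ?q"
      using i(2) by (auto simp: side_def closed_segment_def)
    have u01: "u \<noteq> 0" "u \<noteq> 1" using u(3) ne by auto
    have px: "?p - x = u *\<^sub>R (?p - ?q)" and qx: "?q - x = (u - 1) *\<^sub>R (?p - ?q)"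
      using u(3) by (simp_all add: algebra_simps)
    have "- ((1 - u) / u) * u = u - 1" using u01 by simp
    then have opp: "?q - x = - ((1 - u) / u) *\<^sub>R (?p - x)" unfolding px qx
      by (simp only: scaleR_scaleR)
    have cpos: "(1 - u) / u > 0" using u u01 by simp
    have "?q - x \<noteq> c *\<^sub>R (?p - x)" if c: "0 < c" for c
    proof
      assume "?q - x = c *\<^sub>R (?p - x)"
      then have "(c + (1 - u) / u) *\<^sub>R (?p - x) = 0" using opp
        by (metis add.right_inverse add.commute scaleR_add_left scaleR_minus_left)
      then show False using c cpos ne by simp
    qed
    then obtain W e where W: "0 < e" "apex W = x" "0 < angle W" "angle W < 2 * pi"
      "inside (path_image (boundary_path vs)) \<inter> ball x e = wedge_region W \<inter> ball x e"
      "(\<exists>c>0. ?q - x = - c *\<^sub>R (?p - x)) \<longrightarrow> angle W = pi"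
      using two_segment_sector[OF g img R ne[symmetric]] by blast
    have "angle W = pi" using W(6) opp cpos by blast
    then show ?thesis using W unfolding open_polygon_def by (intro exI[of _ W] exI[of _ e]) auto
  qed
qed

section \<open>Wedges as quadrants, dual arcs and special pairs\<close>

definition in_quadrant :: "arc \<Rightarrow> real \<Rightarrow> real \<Rightarrow> complex \<Rightarrow> bool" where
  "in_quadrant \<tau> a b z \<longleftrightarrow> a < arc_lo \<tau> z \<and> b < arc_hi \<tau> z"

text \<open>It runs from the inner normal of the terminal side to that of the initial side.\<close>

definition dual_arc :: "wedge \<Rightarrow> arc" where
  "dual_arc W = (start W + angle W - pi / 2, pi - angle W)"

text \<open>A wedge of angle at least \<open>pi\<close> is the union of two half-planes.\<close>

definition wedge_arcs :: "wedge \<Rightarrow> arc set" where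
  "wedge_arcs W = (if angle W < pi then {dual_arc W}
     else {(start W + pi / 2, 0), (start W + angle W - pi / 2, 0)})"

lemma dual_arc_proj:
  "arc_lo (dual_arc W) = proj (start W + angle W - pi / 2)" "arc_hi (dual_arc W) = proj (start W + pi / 2)"
proof -
  have e: "start W + angle W - pi / 2 + (pi - angle W) = start W + pi / 2" by simp
  show "arc_lo (dual_arc W) = proj (start W + angle W - pi / 2)" by (simp add: dual_arc_def)
  show "arc_hi (dual_arc W) = proj (start W + pi / 2)"
    unfolding dual_arc_def fst_conv snd_conv e ..
qed

lemma wedge_region_iff: "z \<in> wedge_region W \<longleftrightarrow> z - apex W \<in> cone_of {start W<..<start W + angle W}"
proof
  assume "z - apex W \<in> cone_of {start W<..<start W + angle W}"
  then have "apex W + (z - apex W) \<in> wedge_region W" unfolding wedge_region_def by (rule imageI)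
  then show "z \<in> wedge_region W" by simp
qed (auto simp: wedge_region_def)

lemma wedge_region_iff_convex:
  assumes "0 < angle W" "angle W < pi"
  shows "z \<in> wedge_region W \<longleftrightarrow> 0 < arc_lo (dual_arc W) (z - apex W) \<and> 0 < arc_hi (dual_arc W) (z - apex W)"
  using cone_of_iff_convex[OF assms] by (auto simp: wedge_region_iff dual_arc_proj)

text \<open>A convex wedge uses the same quadrant twice, so that all boundary points are described
  in one form.\<close>

lemma wedge_region_quadrants:
  assumes "0 < angle W" "angle W < 2 * pi"
  shows "\<exists>\<tau>1\<in>wedge_arcs W. \<exists>\<tau>2\<in>wedge_arcs W. \<exists>a1 b1 a2 b2. \<forall>z.
    z \<in> wedge_region W \<longleftrightarrow> in_quadrant \<tau>1 a1 b1 z \<or> in_quadrant \<tau>2 a2 b2 z"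
proof (cases "angle W < pi")
  case True
  let ?\<tau> = "dual_arc W"
  have "z \<in> wedge_region W \<longleftrightarrow> in_quadrant ?\<tau> (arc_lo ?\<tau> (apex W)) (arc_hi ?\<tau> (apex W)) z" for z
    using wedge_region_iff_convex[OF assms(1) True] by (simp add: in_quadrant_def proj_diff)
  moreover have "?\<tau> \<in> wedge_arcs W" using True by (simp add: wedge_arcs_def)
  ultimately show ?thesis by blast
next
  case False
  define \<theta> where "\<theta> = start W + pi / 2"
  define \<theta>' where "\<theta>' = start W + angle W - pi / 2"
  have "z \<in> wedge_region W \<longleftrightarrow> in_quadrant (\<theta>, 0) (proj \<theta> (apex W)) (proj \<theta> (apex W)) z \<or>
      in_quadrant (\<theta>', 0) (proj \<theta>' (apex W)) (proj \<theta>' (apex W)) z" for z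
    using cone_of_iff_reflex[of "angle W" "z - apex W" "start W"] False assms
    by (simp add: wedge_region_iff in_quadrant_def proj_diff \<theta>_def \<theta>'_def)
  moreover have "(\<theta>, 0) \<in> wedge_arcs W" "(\<theta>', 0) \<in> wedge_arcs W"
    using False by (simp_all add: wedge_arcs_def \<theta>_def \<theta>'_def)
  ultimately show ?thesis by blast
qed

lemma proper_wedge_arcs: "0 < angle W \<Longrightarrow> \<tau> \<in> wedge_arcs W \<Longrightarrow> proper \<tau>"
  by (auto simp: wedge_arcs_def dual_arc_def proper_def split: if_splits)

text \<open>A degenerate arc is a single direction, which lies either in the other arc or outside
  it; in the second case it has to be moved back by a full turn.\<close>

lemma uncrossed_half_plane_right:
  assumes "proper \<tau>"
  shows "uncrossed \<tau> (\<theta>, 0)"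
proof -
  obtain n :: int where n: "fst \<tau> \<le> \<theta> + 2 * pi * n" "\<theta> + 2 * pi * n < fst \<tau> + 2 * pi"
    using exists_angle_shift by blast
  show ?thesis
  proof (cases "\<theta> + 2 * pi * n \<le> fst \<tau> + snd \<tau>")
    case True
    then show ?thesis using n unfolding uncrossed_def Let_def by (intro exI[of _ n]) simp
  next
    case False
    have "\<theta> + 2 * pi * (n - 1) = \<theta> + 2 * pi * n - 2 * pi" by (simp add: algebra_simps)
    then show ?thesis using n False unfolding uncrossed_def Let_def
      by (intro exI[of _ "n - 1"]) simp
  qed
qed

lemma uncrossed_half_plane_left:
  shows "uncrossed (\<theta>, 0) \<sigma>"
proof -
  obtain n :: int where n: "\<theta> - 2 * pi \<le> fst \<sigma> + 2 * pi * n" "fst \<sigma> + 2 * pi * n < \<theta> - 2 * pi + 2 * pi"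
    using exists_angle_shift by blast
  then show ?thesis unfolding uncrossed_def Let_def by (intro exI[of _ n]) auto
qed

lemma cis_in_cone_of: "t + 2 * pi * of_int n \<in> T \<Longrightarrow> cis t \<in> cone_of T"
proof -
  assume "t + 2 * pi * of_int n \<in> T"
  moreover have "cis t = rcis 1 (t + 2 * pi * of_int n)" by (simp only: rcis_def cis_add_2pi_int) simp
  ultimately show ?thesis unfolding cone_of_def by force
qed

text \<open>Dual arcs are nested if the wedges are, and do not overlap if the closed wedge
  \<open>W\<close> meets the opposite of the closed wedge \<open>V\<close>. If neither happens, the
  positions of the two boundary directions of \<open>W\<close> always fit one of the clauses of
  \<open>special_for W V\<close>.\<close>

lemma uncrossed_if_not_special:
  assumes V: "0 < angle V" "angle V < pi" and W: "0 < angle W" "angle W < pi"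
    and nsp: "\<not> special_for W V"
  shows "uncrossed (dual_arc V) (dual_arc W)"
proof (rule ccontr)
  assume neg: "\<not> ?thesis"
  define s where "s = start V"
  define \<phi> where "\<phi> = angle V"
  define \<psi> where "\<psi> = angle W"
  obtain n :: int where n: "s \<le> start W + 2 * pi * n" "start W + 2 * pi * n < s + 2 * pi"
    using exists_angle_shift by blast
  define t where "t = start W + 2 * pi * n"
  have t: "s \<le> t" "t < s + 2 * pi" using n by (simp_all add: t_def)
  have neg': "\<not> (let T = t + \<psi> - pi / 2 + 2 * pi * real_of_int k in
     (s + \<phi> - pi / 2 \<le> T \<and> T + (pi - \<psi>) \<le> s + pi / 2) \<or>
     (T \<le> s + \<phi> - pi / 2 \<and> s + pi / 2 \<le> T + (pi - \<psi>)) \<or>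
     (T + (pi - \<psi>) \<le> s + \<phi> - pi / 2 \<and> s + pi / 2 \<le> T + 2 * pi))" for k :: int
  proof -
    have "start W + angle W - pi / 2 + 2 * pi * real_of_int (n + k) = t + \<psi> - pi / 2 + 2 * pi * real_of_int k"
      by (simp add: t_def \<psi>_def algebra_simps)
    moreover have "s + \<phi> - pi / 2 + (pi - \<phi>) = s + pi / 2" by simp
    ultimately show ?thesis using neg unfolding uncrossed_def dual_arc_def s_def \<phi>_def \<psi>_def fst_conv snd_conv
      by metis
  qed
  \<comment> \<open>Shift 0 rules out containment in either direction. Shift -1 rules out that
    \<open>W\<close>, read past \<open>s + 2 * pi\<close>, contains \<open>V\<close>, and that it
    meets the opposite of \<open>V\<close>.\<close>
  have a: "\<not> (s + \<phi> \<le> t + \<psi> \<and> t \<le> s)" "\<not> t + \<psi> \<le> s + \<phi>"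
    using neg'[of 0] t by (auto simp: Let_def)
  have b: "\<not> (s + \<phi> + 2 * pi \<le> t + \<psi>)" "\<not> (t \<le> s + \<phi> + pi \<and> s + pi \<le> t + \<psi>)"
    using neg'[of "- 1"] t by (auto simp: Let_def)
  define p where "p = cis (start W)"
  define q where "q = cis (start W + angle W)"
  have p: "p \<in> cone_of T" if "t + 2 * pi * of_int k \<in> T" for T k
    unfolding p_def using that by (intro cis_in_cone_of[of _ "n + k"]) (simp add: t_def algebra_simps)
  have q: "q \<in> cone_of T" if "t + \<psi> + 2 * pi * of_int k \<in> T" for T k
    unfolding q_def using that by (intro cis_in_cone_of[of _ "n + k"]) (simp add: t_def \<psi>_def algebra_simps)
  have p0: "p \<in> cone_of T" if "t \<in> T" for T using p[of 0 T] that by simp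
  have q0: "q \<in> cone_of T" if "t + \<psi> \<in> T" for T using q[of 0 T] that by simp
  have q1: "q \<in> cone_of T" if "t + \<psi> - 2 * pi \<in> T" for T using q[of "- 1" T] that by simp
  have pos: "0 < \<phi>" "\<phi> < pi" "0 < \<psi>" "\<psi> < pi" using V W
    by (simp_all add: \<phi>_def \<psi>_def)
  have reg: "region_right V = cone_of {s<..<s + \<phi>}" "region_upper V = cone_of {s + \<phi><..<s + pi}"
    "region_lower V = cone_of {s + \<phi> + pi<..<s + 2 * pi}"
    by (simp_all add: region_right_def region_upper_def region_lower_def s_def \<phi>_def)
  have sp: "special_for W V \<longleftrightarrow>
        (p \<in> region_right V \<and> q \<in> region_upper V \<union> region_lower V) \<or>
        (q \<in> region_right V \<and> p \<in> region_upper V \<union> region_lower V) \<or>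
        {p, q} \<subseteq> region_upper V \<union> cone_of {s + \<phi>} \<or>
        {p, q} \<subseteq> region_lower V \<union> cone_of {s}"
    by (simp add: special_for_def p_def q_def s_def \<phi>_def Let_def)
  have "special_for W V"
  proof (cases "t + \<psi> < s + pi")
    case True
    then have qu: "q \<in> region_upper V" unfolding reg using a by (intro q0) auto
    have ts: "s < t" using a t by linarith
    consider "t < s + \<phi>" | "t = s + \<phi>" | "s + \<phi> < t" by linarith
    then show ?thesis
    proof cases
      case 1
      then have "p \<in> region_right V" unfolding reg using ts by (intro p0) auto
      then show ?thesis using qu sp by blast
    next
      case 2
      then have "p \<in> cone_of {s + \<phi>}" by (intro p0) auto
      then show ?thesis using qu sp by blast
    next
      case 3
      then have "p \<in> region_upper V" unfolding reg using True pos by (intro p0) auto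
      then show ?thesis using qu sp by blast
    qed
  next
    case False
    then have tl: "s + \<phi> + pi < t" using b by linarith
    then have pl: "p \<in> region_lower V" unfolding reg using t by (intro p0) auto
    consider "t + \<psi> < s + 2 * pi" | "t + \<psi> = s + 2 * pi" | "s + 2 * pi < t + \<psi>" by linarith
    then show ?thesis
    proof cases
      case 1
      then have "q \<in> region_lower V" unfolding reg using tl pos by (intro q0) auto
      then show ?thesis using pl sp by blast
    next
      case 2
      then have "q \<in> cone_of {s}" by (intro q1) auto
      then show ?thesis using pl sp by blast
    next
      case 3
      then have "q \<in> region_right V" unfolding reg using b by (intro q1) auto
      then show ?thesis using pl sp by blast
    qed
  qed
  then show False using nsp by blast
qed

lemma cos_neg_between: "pi / 2 < x \<Longrightarrow> x < 3 * pi / 2 \<Longrightarrow> cos x < 0"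
  using cos_gt_zero_pi[of "x - pi"] by simp

text \<open>The direction from one apex to the other lies in the first closed wedge, and the opposite
  direction in the second.\<close>

lemma uncrossed_if_opposite:
  assumes prp: "proper \<tau>" "proper \<sigma>" and d: "d \<noteq> 0"
    and pos: "0 \<le> arc_lo \<tau> d" "0 \<le> arc_hi \<tau> d" and neg: "arc_lo \<sigma> d \<le> 0" "arc_hi \<sigma> d \<le> 0"
  shows "uncrossed \<tau> \<sigma>"
proof -
  \<comment> \<open>The range of angles starts where the closed half-plane of
    \<open>fst \<tau>\<close> does, so that this half-plane is its first half.\<close>
  obtain r \<eta> where r: "0 < r" "fst \<tau> - pi / 2 \<le> \<eta>" "\<eta> < fst \<tau> - pi / 2 + 2 * pi" "d = rcis r \<eta>"
    using exists_rcis_from[OF d] by blast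
  have w: "0 \<le> snd \<tau>" "snd \<tau> < pi" "0 \<le> snd \<sigma>" "snd \<sigma> < pi" using prp
    by (auto simp: proper_def)
  have c1: "0 \<le> cos (\<eta> - fst \<tau>)" "0 \<le> cos (\<eta> - (fst \<tau> + snd \<tau>))"
    using pos r by (auto simp: proj_rcis zero_le_mult_iff)
  have e1: "\<eta> \<le> fst \<tau> + pi / 2" using c1(1) cos_neg_between[of "\<eta> - fst \<tau>"] r
    by argo
  have e2: "fst \<tau> + snd \<tau> - pi / 2 \<le> \<eta>"
  proof (rule ccontr)
    assume "\<not> ?thesis"
    then have "cos (- (\<eta> - (fst \<tau> + snd \<tau>))) < 0" using r w by (intro cos_neg_between) argo+
    then show False using c1(2) unfolding cos_minus by linarith
  qed
  obtain n :: int where n: "\<eta> - 2 * pi \<le> fst \<sigma> + 2 * pi * n" "fst \<sigma> + 2 * pi * n < \<eta> - 2 * pi + 2 * pi"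
    using exists_angle_shift by blast
  define t where "t = fst \<sigma> + 2 * pi * n"
  have lo: "arc_lo \<sigma> d = proj t d" by (simp only: t_def proj_add_2pi)
  have "t + snd \<sigma> = fst \<sigma> + snd \<sigma> + 2 * pi * n" by (simp add: t_def)
  then have hi: "arc_hi \<sigma> d = proj (t + snd \<sigma>) d" by (simp only: proj_add_2pi)
  have c2: "cos (\<eta> - t) \<le> 0" "cos (\<eta> - (t + snd \<sigma>)) \<le> 0"
  proof -
    have "proj t d \<le> 0" "proj (t + snd \<sigma>) d \<le> 0" using neg unfolding lo hi by blast+
    then show "cos (\<eta> - t) \<le> 0" "cos (\<eta> - (t + snd \<sigma>)) \<le> 0"
      using r(1) unfolding r(4) proj_rcis by (auto simp: mult_le_0_iff)
  qed
  have t: "\<eta> - 2 * pi \<le> t" "t < \<eta>" using n by (simp_all add: t_def)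
  have f1: "\<eta> - t \<le> 3 * pi / 2"
  proof (rule ccontr)
    assume "\<not> ?thesis"
    then have "0 < cos (\<eta> - t - 2 * pi)" using t by (intro cos_gt_zero_pi) argo+
    then show False using c2(1) cos_periodic[of "\<eta> - t - 2 * pi"] by simp
  qed
  have f0: "pi / 2 \<le> \<eta> - t"
    using c2(1) cos_gt_zero_pi[of "\<eta> - t"] t pi_gt_zero by argo
  have f2: "pi / 2 \<le> \<eta> - (t + snd \<sigma>)"
    using c2(2) cos_gt_zero_pi[of "\<eta> - (t + snd \<sigma>)"] f0 w by argo
  \<comment> \<open>The arc of \<open>\<tau>\<close> stays within \<open>pi / 2\<close> of
    \<open>\<eta>\<close>, whereas the arc of \<open>\<sigma>\<close>, moved to just before
    \<open>\<eta>\<close>, keeps at least \<open>pi / 2\<close> away from it on both sides of the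
    circle.\<close>
  have "t + snd \<sigma> \<le> fst \<tau> \<and> fst \<tau> + snd \<tau> \<le> t + 2 * pi" using f1 f2 e1 e2
    by argo
  then show ?thesis unfolding uncrossed_def Let_def by (intro exI[of _ n]) (simp add: t_def)
qed

text \<open>Shrinking towards the apex, which lies in the closure, keeps a point of the convex set
  in it and brings it into the ball, where the set is the wedge; cones are invariant under scaling.
  The closed conditions then pass to the closure.\<close>

lemma convex_subset_wedge:
  assumes P: "convex P" "open P" and x: "apex W \<in> closure P" and e: "0 < e"
    and ang: "0 < angle W" "angle W < pi"
    and loc: "P \<inter> ball (apex W) e = wedge_region W \<inter> ball (apex W) e" and y: "y \<in> closure P"
  shows "0 \<le> arc_lo (dual_arc W) (y - apex W)" "0 \<le> arc_hi (dual_arc W) (y - apex W)"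
proof -
  let ?v = "apex W"
  have "0 < arc_lo (dual_arc W) (z - ?v) \<and> 0 < arc_hi (dual_arc W) (z - ?v)" if z: "z \<in> P" for z
  proof (cases "z = ?v")
    case True
    then have "?v \<in> P \<inter> ball ?v e" using z e by simp
    then have "?v \<in> wedge_region W" using loc by blast
    then show ?thesis using wedge_region_iff_convex[OF ang] True by simp
  next
    case False
    define u where "u = min (1 / 2) (e / (2 * norm (z - ?v)))"
    have u: "0 < u" "u < 1" using e False by (auto simp: u_def)
    have "u * norm (z - ?v) \<le> e / (2 * norm (z - ?v)) * norm (z - ?v)"
      by (intro mult_right_mono) (auto simp: u_def)
    also have "\<dots> < e" using e False by simp
    finally have un: "u * norm (z - ?v) < e" .
    define w where "w = ?v + u *\<^sub>R (z - ?v)"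
    have "w \<in> open_segment z ?v"
      using u False by (auto simp: in_segment w_def algebra_simps intro!: exI[of _ "1 - u"])
    then have "w \<in> P" using in_interior_closure_convex_segment[OF P(1) _ x, of z] z P(2)
      by (auto simp: interior_open)
    moreover have "w \<in> ball ?v e" using un u by (simp add: w_def dist_norm)
    ultimately have "w \<in> wedge_region W" using loc by blast
    then have "0 < arc_lo (dual_arc W) (u *\<^sub>R (z - ?v)) \<and> 0 < arc_hi (dual_arc W) (u *\<^sub>R (z - ?v))"
      using wedge_region_iff_convex[OF ang] by (simp add: w_def)
    then show ?thesis using u by (simp add: proj_scaleR zero_less_mult_iff)
  qed
  then have "P \<subseteq> {z. 0 \<le> arc_lo (dual_arc W) (z - ?v)}" "P \<subseteq> {z. 0 \<le> arc_hi (dual_arc W) (z - ?v)}"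
    by (auto intro: less_imp_le)
  moreover have "closed {z. 0 \<le> proj \<theta> (z - ?v)}" for \<theta>
    unfolding proj_def by (intro closed_Collect_le continuous_intros)
  ultimately have "closure P \<subseteq> {z. 0 \<le> arc_lo (dual_arc W) (z - ?v)}"
      "closure P \<subseteq> {z. 0 \<le> arc_hi (dual_arc W) (z - ?v)}"
    by (meson closure_minimal)+
  then show "0 \<le> arc_lo (dual_arc W) (y - ?v)" "0 \<le> arc_hi (dual_arc W) (y - ?v)" using y by auto
qed

section \<open>Local shape of the polygon\<close>

lemma polygon_basic:
  assumes "simple_polygon vs"
  shows "open (open_polygon vs)" "bounded (open_polygon vs)"
    "frontier (open_polygon vs) = path_image (boundary_path vs)"
proof -
  have "vs \<noteq> []" using assms by (auto simp: simple_polygon_def)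
  then have "simple_path (boundary_path vs)" "pathfinish (boundary_path vs) = pathstart (boundary_path vs)"
    using assms boundary_path_closed by (auto simp: simple_polygon_def)
  from Jordan_inside_outside[OF this] show "open (open_polygon vs)" "bounded (open_polygon vs)"
    "frontier (open_polygon vs) = path_image (boundary_path vs)" by (simp_all add: open_polygon_def)
qed

text \<open>In the convex case each closed wedge contains the other apex, so
  \<open>uncrossed_if_opposite\<close> applies to the difference of the apices; otherwise the
  absence of special pairs decides.\<close>

lemma vertex_wedges_uncrossed:
  assumes vs: "simple_polygon vs" and P: "P = open_polygon vs"
    and cond: "convex P \<or> (\<not> convex P \<and> \<not> has_special_pair vs)"
    and V: "apex V \<in> path_image (boundary_path vs)" "0 < angle V" "angle V < pi" "0 < e"
      "P \<inter> ball (apex V) e = wedge_region V \<inter> ball (apex V) e" "i < length vs" "vertex_wedge vs i V"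
    and W: "apex W \<in> path_image (boundary_path vs)" "0 < angle W" "angle W < pi" "0 < e'"
      "P \<inter> ball (apex W) e' = wedge_region W \<inter> ball (apex W) e'" "j < length vs" "vertex_wedge vs j W"
    and ne: "apex V \<noteq> apex W"
  shows "uncrossed (dual_arc V) (dual_arc W)"
proof (cases "convex P")
  case False
  have "apex V = vs ! i" "apex W = vs ! j" using V(7) W(7) by (auto simp: vertex_wedge_def)
  then have "i \<noteq> j" using ne by auto
  then have "\<not> special_pair W V" using cond False V(6,7) W(6,7) unfolding has_special_pair_def by blast
  then have "\<not> special_for W V" using V(3) W(3) by (simp add: special_pair_def)
  then show ?thesis by (rule uncrossed_if_not_special[OF V(2,3) W(2,3)])
next
  case True
  have oP: "open P" using polygon_basic[OF vs] P by simp
  have cl: "apex V \<in> closure P" "apex W \<in> closure P"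
    using V(1) W(1) polygon_basic(3)[OF vs] P by (auto simp: frontier_def)
  let ?d = "apex W - apex V"
  have pos: "0 \<le> arc_lo (dual_arc V) ?d" "0 \<le> arc_hi (dual_arc V) ?d"
    using convex_subset_wedge[OF True oP cl(1) V(4,2,3,5) cl(2)] by auto
  have "0 \<le> arc_lo (dual_arc W) (- ?d)" "0 \<le> arc_hi (dual_arc W) (- ?d)"
    using convex_subset_wedge[OF True oP cl(2) W(4,2,3,5) cl(1)] by auto
  then have neg: "arc_lo (dual_arc W) ?d \<le> 0" "arc_hi (dual_arc W) ?d \<le> 0"
    unfolding proj_minus by auto
  have prp: "proper (dual_arc V)" "proper (dual_arc W)" using V(2,3) W(2,3)
    by (auto simp: proper_def dual_arc_def)
  show ?thesis using uncrossed_if_opposite[OF prp _ pos neg] ne by simp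
qed

text \<open>A Lebesgue number argument on the compact closure: a ball of radius
  \<open>\<delta>\<close> misses the polygon, lies inside it, or lies in the neighbourhood of a
  boundary point where the polygon is a wedge. Finitely many centres give finitely many
  types.\<close>

lemma polygon_quadrants:
  assumes vs: "simple_polygon vs" and P: "P = open_polygon vs"
    and cond: "convex P \<or> (\<not> convex P \<and> \<not> has_special_pair vs)"
  shows "\<exists>Ts \<delta>. finite Ts \<and> 0 < \<delta> \<and> (\<forall>\<tau>\<in>Ts. proper \<tau>) \<and>
    (\<forall>\<tau>\<in>Ts. \<forall>\<sigma>\<in>Ts. \<tau> \<noteq> \<sigma> \<longrightarrow> uncrossed \<tau> \<sigma>) \<and>
    (\<forall>y. \<exists>\<tau>1\<in>Ts. \<exists>\<tau>2\<in>Ts. \<exists>a1 b1 a2 b2. \<forall>z\<in>ball y \<delta>.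
       z \<in> P \<longleftrightarrow> in_quadrant \<tau>1 a1 b1 z \<or> in_quadrant \<tau>2 a2 b2 z)"
proof -
  let ?J = "path_image (boundary_path vs)"
  note pb = polygon_basic[OF vs, folded P]
  define Q where "Q x W e \<longleftrightarrow> 0 < e \<and> apex W = x \<and> 0 < angle W \<and> angle W < 2 * pi \<and>
    P \<inter> ball x e = wedge_region W \<inter> ball x e \<and>
    (angle W < pi \<longrightarrow> (\<exists>i<length vs. x = vs ! i \<and> vertex_wedge vs i W))" for x W e
  have "\<forall>x. \<exists>W e. x \<in> ?J \<longrightarrow> Q x W e"
    using polygon_sector[OF vs] unfolding Q_def P by blast
  then obtain W e where Q: "\<And>x. x \<in> ?J \<Longrightarrow> Q x (W x) (e x)" by metis
  have "\<forall>x. \<exists>h. x \<in> P \<longrightarrow> 0 < h \<and> ball x h \<subseteq> P"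
    using pb(1) open_contains_ball by blast
  then obtain h where h: "\<And>x. x \<in> P \<Longrightarrow> 0 < h x \<and> ball x (h x) \<subseteq> P"
    by metis
  define r where "r x = (if x \<in> P then h x else e x)" for x
  have cl: "closure P = P \<union> ?J" using pb(3) closure_Un_frontier by metis
  have r: "0 < r x" if "x \<in> closure P" for x using that h Q cl by (auto simp: r_def Q_def)
  have comp: "compact (closure P)" using pb(2) by (simp add: compact_closure)
  have "closure P \<subseteq> (\<Union>x\<in>closure P. ball x (r x / 2))" using r by force
  then obtain X where X: "X \<subseteq> closure P" "finite X" "closure P \<subseteq> (\<Union>x\<in>X. ball x (r x / 2))"
    using compactE_image[OF comp, of "closure P" "\<lambda>x. ball x (r x / 2)"] by blast
  \<comment> \<open>Balls of half the radius \<open>r x\<close> already cover, so the quarter is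
    chosen to make \<open>r x / 2 + 2 * \<delta> \<le> r x\<close>. The 1 keeps the minimum defined
    for empty \<open>X\<close>.\<close>
  define \<delta> where "\<delta> = Min (insert 1 ((\<lambda>x. r x / 4) ` X))"
  have \<delta>: "0 < \<delta>" "\<And>x. x \<in> X \<Longrightarrow> \<delta> \<le> r x / 4"
  proof -
    have "0 < r x / 4" if "x \<in> X" for x using r X(1) that by fastforce
    then show "0 < \<delta>" unfolding \<delta>_def using X(2) by (subst Min_gr_iff) auto
    show "\<delta> \<le> r x / 4" if "x \<in> X" for x
      unfolding \<delta>_def by (rule Min_le) (use X(2) that in auto)
  qed
  \<comment> \<open>The extra type \<open>(0, 0)\<close> describes balls that miss the polygon or
    lie inside it: a half-plane whose boundary passes beyond the ball contains none or all of
    it.\<close>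
  define Ts where "Ts = insert (0, 0) (\<Union>x\<in>X - P. wedge_arcs (W x))"
  have XJ: "x \<in> ?J" if "x \<in> X - P" for x using that X(1) cl by auto
  have fin: "finite Ts" using X(2) by (auto simp: Ts_def wedge_arcs_def)
  have prp: "proper \<tau>" if "\<tau> \<in> Ts" for \<tau>
  proof -
    have "0 < angle (W x)" if "x \<in> X - P" for x using Q[OF XJ[OF that]] by (simp add: Q_def)
    moreover have "proper (0, 0)" by (simp add: proper_def)
    ultimately show ?thesis using that proper_wedge_arcs unfolding Ts_def by blast
  qed
  have flat: "\<tau> \<in> Ts \<Longrightarrow> snd \<tau> = 0 \<or> (\<exists>x\<in>X - P. angle (W x) < pi \<and> \<tau> = dual_arc (W x))" for \<tau>
    unfolding Ts_def wedge_arcs_def by (auto split: if_splits)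
  have unc: "uncrossed \<tau> \<sigma>" if t: "\<tau> \<in> Ts" "\<sigma> \<in> Ts" "\<tau> \<noteq> \<sigma>" for \<tau> \<sigma>
  proof -
    consider "snd \<tau> = 0" | "snd \<sigma> = 0" | x y where "x \<in> X - P" "angle (W x) < pi" "\<tau> = dual_arc (W x)"
        "y \<in> X - P" "angle (W y) < pi" "\<sigma> = dual_arc (W y)"
      using flat[OF t(1)] flat[OF t(2)] by blast
    then show ?thesis
    proof cases
      case 1
      then show ?thesis using uncrossed_half_plane_left[of "fst \<tau>" \<sigma>] by (metis prod.collapse)
    next
      case 2
      then show ?thesis using uncrossed_half_plane_right[OF prp[OF t(1)], of "fst \<sigma>"]
        by (metis prod.collapse)
    next
      case 3
      note q = Q[OF XJ[OF 3(1)], unfolded Q_def] and q' = Q[OF XJ[OF 3(4)], unfolded Q_def]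
      obtain i where i: "i < length vs" "vertex_wedge vs i (W x)" using q 3(2) by blast
      obtain j where j: "j < length vs" "vertex_wedge vs j (W y)" using q' 3(5) by blast
      have ap: "apex (W x) = x" "apex (W y) = y" using q q' by blast+
      have "x \<noteq> y" using t(3) 3 by auto
      then have ne: "apex (W x) \<noteq> apex (W y)" using ap by simp
      have J: "apex (W x) \<in> ?J" "apex (W y) \<in> ?J" using XJ 3(1,4) ap by simp_all
      have b: "P \<inter> ball (apex (W x)) (e x) = wedge_region (W x) \<inter> ball (apex (W x)) (e x)"
        "P \<inter> ball (apex (W y)) (e y) = wedge_region (W y) \<inter> ball (apex (W y)) (e y)"
        unfolding ap using q q' by blast+
      have a: "0 < angle (W x)" "0 < angle (W y)" "0 < e x" "0 < e y" using q q' by blast+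
      show ?thesis unfolding 3(3,6)
        by (rule vertex_wedges_uncrossed[OF vs P cond J(1) a(1) 3(2) a(3) b(1) i J(2) a(2) 3(5) a(4) b(2) j ne])
    qed
  qed
  have far: "\<bar>proj \<theta> z\<bar> < norm y + \<delta>" if "z \<in> ball y \<delta>" for \<theta> z y
  proof -
    have "norm z \<le> norm y + norm (z - y)" using norm_triangle_sub by blast
    then show ?thesis using that abs_proj_le[of \<theta> z] by (simp add: dist_norm norm_minus_commute)
  qed
  have "\<exists>\<tau>1\<in>Ts. \<exists>\<tau>2\<in>Ts. \<exists>a1 b1 a2 b2. \<forall>z\<in>ball y \<delta>.
       z \<in> P \<longleftrightarrow> in_quadrant \<tau>1 a1 b1 z \<or> in_quadrant \<tau>2 a2 b2 z" for y
  proof -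
    have flat: ?thesis if "\<And>z. z \<in> ball y \<delta> \<Longrightarrow> z \<in> P \<longleftrightarrow> a < proj 0 z" for a
    proof -
      have "(0, 0) \<in> Ts" by (simp add: Ts_def)
      moreover have "\<forall>z\<in>ball y \<delta>. z \<in> P \<longleftrightarrow> in_quadrant (0, 0) a a z \<or> in_quadrant (0, 0) a a z"
        using that by (simp add: in_quadrant_def)
      ultimately show ?thesis by blast
    qed
    consider "ball y \<delta> \<inter> P = {}" | "ball y \<delta> \<subseteq> P" |
      x where "x \<in> X - P" "ball y \<delta> \<subseteq> ball x (e x)"
    proof (cases "ball y \<delta> \<inter> P = {}")
      case False
      then obtain z where z: "z \<in> ball y \<delta>" "z \<in> P" by blast
      then have "z \<in> closure P" using closure_subset by blast
      then obtain x where x: "x \<in> X" "z \<in> ball x (r x / 2)" using X(3) by blast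
      have "ball y \<delta> \<subseteq> ball x (r x)"
      proof
        fix u assume u: "u \<in> ball y \<delta>"
        have "dist x u \<le> dist x z + dist z y + dist y u"
          using dist_triangle[of x u y] dist_triangle[of x y z] by linarith
        also have "\<dots> < r x / 2 + \<delta> + \<delta>" using u z(1) x(2) by (simp add: dist_commute)
        also have "\<dots> \<le> r x" using \<delta>(2)[OF x(1)] by linarith
        finally show "u \<in> ball x (r x)" by simp
      qed
      then show ?thesis
      proof (cases "x \<in> P")
        case True
        then have "ball y \<delta> \<subseteq> P"
          using \<open>ball y \<delta> \<subseteq> ball x (r x)\<close> h[OF True] by (auto simp: r_def)
        then show ?thesis by (rule that(2))
      next
        case False
        then show ?thesis using \<open>ball y \<delta> \<subseteq> ball x (r x)\<close> x(1)
          by (intro that(3)[of x]) (auto simp: r_def)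
      qed
    qed
    then show ?thesis
    proof cases
      case 1
      then show ?thesis using far[of _ y 0] by (intro flat[of "norm y + \<delta>"]) force
    next
      case 2
      then show ?thesis using far[of _ y 0] by (intro flat[of "- (norm y + \<delta>)"]) force
    next
      case 3
      note q = Q[OF XJ[OF 3(1)], unfolded Q_def]
      have ang: "0 < angle (W x)" "angle (W x) < 2 * pi" using q by blast+
      obtain \<tau>1 \<tau>2 a1 b1 a2 b2 where w: "\<tau>1 \<in> wedge_arcs (W x)" "\<tau>2 \<in> wedge_arcs (W x)"
        "\<forall>z. z \<in> wedge_region (W x) \<longleftrightarrow> in_quadrant \<tau>1 a1 b1 z \<or> in_quadrant \<tau>2 a2 b2 z"
        using wedge_region_quadrants[OF ang] by blast
      have loc: "P \<inter> ball x (e x) = wedge_region (W x) \<inter> ball x (e x)" using q by blast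
      have "\<forall>z\<in>ball y \<delta>. z \<in> P \<longleftrightarrow> in_quadrant \<tau>1 a1 b1 z \<or> in_quadrant \<tau>2 a2 b2 z"
        using loc 3(2) w(3) by blast
      moreover have "\<tau>1 \<in> Ts" "\<tau>2 \<in> Ts" using w(1,2) 3(1) unfolding Ts_def by blast+
      ultimately show ?thesis by blast
    qed
  qed
  then show ?thesis using fin \<delta>(1) prp unc by (intro exI[of _ Ts] exI[of _ \<delta>]) simp
qed

section \<open>Coverings\<close>

lemma mem_translate_iff: "x \<in> translate P v \<longleftrightarrow> x - v \<in> P"
proof
  assume "x - v \<in> P"
  then have "v + (x - v) \<in> translate P v" unfolding translate_def by (rule imageI)
  then show "x \<in> translate P v" by simp
qed (auto simp: translate_def)

text \<open>The \<open>m\<close> translates chosen for a point cover a neighbourhood of it, as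
  \<open>P\<close> is open, so finitely many choices suffice on each compact ring. As
  \<open>P\<close> is bounded, centres in a bounded region come from finitely many rings
  only.\<close>

lemma locally_finite_subcovering:
  assumes P: "open P" "bounded P" and cov: "fold_covering m P I c"
  shows "\<exists>I'\<subseteq>I. fold_covering m P I' c \<and> (\<forall>R. finite {i \<in> I'. norm (c i) \<le> R})"
proof -
  obtain A where A: "\<And>x. A x \<subseteq> {i \<in> I. x \<in> translate P (c i)} \<and> finite (A x) \<and> card (A x) = m"
    using cov unfolding fold_covering_def by metis
  define ring :: "nat \<Rightarrow> complex set" where "ring n = cball 0 (real n + 1) - ball 0 (real n)" for n
  define Ox where "Ox x = (\<Inter>i\<in>A x. translate P (c i))" for x
  have "open (Ox x)" for x
    unfolding Ox_def using A[of x] P(1) by (intro open_INT) (auto simp: translate_def intro: open_translation)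
  moreover have "x \<in> Ox x" for x using A[of x] by (auto simp: Ox_def)
  moreover have "compact (ring n)" for n unfolding ring_def by (intro compact_diff) auto
  ultimately have "\<exists>D\<subseteq>ring n. finite D \<and> ring n \<subseteq> (\<Union>x\<in>D. Ox x)" for n
    using compactE_image[of "ring n" "ring n" Ox] by (metis UN_I subsetI)
  then obtain D where D: "\<And>n. D n \<subseteq> ring n \<and> finite (D n) \<and> ring n \<subseteq> (\<Union>x\<in>D n. Ox x)" by metis
  define I' where "I' = (\<Union>n. \<Union>x\<in>D n. A x)"
  have "I' \<subseteq> I" using A by (auto simp: I'_def)
  moreover have "fold_covering m P I' c"
    unfolding fold_covering_def
  proof
    fix y :: complex
    define n where "n = nat \<lfloor>norm y\<rfloor>"
    have "real n \<le> norm y" "norm y \<le> real n + 1" unfolding n_def using norm_ge_zero[of y]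
      by linarith+
    then have "y \<in> ring n" by (simp add: ring_def)
    then obtain x where x: "x \<in> D n" "y \<in> Ox x" using D[of n] by blast
    have "A x \<subseteq> {i \<in> I'. y \<in> translate P (c i)}" using x by (auto simp: I'_def Ox_def)
    then show "\<exists>A. A \<subseteq> {i \<in> I'. y \<in> translate P (c i)} \<and> finite A \<and> card A = m" using A[of x] by blast
  qed
  moreover have "finite {i \<in> I'. norm (c i) \<le> R}" for R
  proof -
    obtain B where B: "\<And>z. z \<in> P \<Longrightarrow> norm z \<le> B" using P(2) bounded_iff by blast
    have "{i \<in> I'. norm (c i) \<le> R} \<subseteq> (\<Union>n\<in>{..nat \<lfloor>R + B\<rfloor>}. \<Union>x\<in>D n. A x)"
    proof
      fix i assume i: "i \<in> {i \<in> I'. norm (c i) \<le> R}"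
      then obtain n x where nx: "x \<in> D n" "i \<in> A x" by (auto simp: I'_def)
      have "x - c i \<in> P" using A[of x] nx(2) by (auto simp: mem_translate_iff)
      then have "norm x \<le> R + B" using B[of "x - c i"] i norm_triangle_sub[of x "c i"] by auto
      moreover have "real n \<le> norm x" using D[of n] nx(1) by (auto simp: ring_def)
      ultimately have "real n \<le> R + B" by linarith
      then have "n \<le> nat \<lfloor>R + B\<rfloor>" by linarith
      then show "i \<in> (\<Union>n\<in>{..nat \<lfloor>R + B\<rfloor>}. \<Union>x\<in>D n. A x)" using nx
        by blast
    qed
    moreover have "finite (\<Union>n\<in>{..nat \<lfloor>R + B\<rfloor>}. \<Union>x\<in>D n. A x)" using A D
      by blast
    ultimately show ?thesis by (rule finite_subset)
  qed
  ultimately show ?thesis by blast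
qed

section \<open>Square cells and the final colouring\<close>

definition cell :: "real \<Rightarrow> complex \<Rightarrow> int \<times> int" where
  "cell \<eta> z = (\<lfloor>Re z / \<eta>\<rfloor>, \<lfloor>Im z / \<eta>\<rfloor>)"

lemma floor_div_eqD:
  fixes a b \<eta> :: real
  assumes "0 < \<eta>" "\<lfloor>a / \<eta>\<rfloor> = \<lfloor>b / \<eta>\<rfloor>"
  shows "\<bar>a - b\<bar> < \<eta>"
proof -
  have "\<bar>a / \<eta> - b / \<eta>\<bar> < 1" using assms(2) by linarith
  then have "\<bar>a - b\<bar> / \<eta> < 1" using assms(1)
    by (simp add: abs_divide flip: diff_divide_distrib)
  then show ?thesis using assms(1) by simp
qed

lemma cell_eq_dist:
  assumes "0 < \<eta>" "cell \<eta> z = cell \<eta> w"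
  shows "dist z w < 2 * \<eta>"
proof -
  have "\<bar>Re z - Re w\<bar> < \<eta>" "\<bar>Im z - Im w\<bar> < \<eta>"
    using assms by (auto simp: cell_def intro!: floor_div_eqD)
  then show ?thesis using cmod_le[of "z - w"] by (simp add: dist_norm)
qed

text \<open>The bound has to be uniform in the centre, since it becomes a factor of the required
  multiplicity.\<close>

lemma cells_of_ball:
  assumes "0 < \<eta>"
  shows "\<exists>D. \<forall>x. finite (cell \<eta> ` ball x R) \<and> card (cell \<eta> ` ball x R) \<le> D"
proof -
  define d where "d = nat (\<lceil>2 * R / \<eta>\<rceil> + 2)"
  have I: "card {\<lfloor>(u - R) / \<eta>\<rfloor>..\<lfloor>(u + R) / \<eta>\<rfloor>} \<le> d" for u
  proof -
    have "(u + R) / \<eta> - (u - R) / \<eta> = 2 * R / \<eta>" by (simp flip: diff_divide_distrib)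
    then have "\<lfloor>(u + R) / \<eta>\<rfloor> - \<lfloor>(u - R) / \<eta>\<rfloor> + 1 \<le> \<lceil>2 * R / \<eta>\<rceil> + 2" by linarith
    then show ?thesis by (simp add: d_def)
  qed
  have "finite (cell \<eta> ` ball x R) \<and> card (cell \<eta> ` ball x R) \<le> d * d" for x
  proof -
    let ?B = "{\<lfloor>(Re x - R) / \<eta>\<rfloor>..\<lfloor>(Re x + R) / \<eta>\<rfloor>} \<times> {\<lfloor>(Im x - R) / \<eta>\<rfloor>..\<lfloor>(Im x + R) / \<eta>\<rfloor>}"
    have sub: "cell \<eta> ` ball x R \<subseteq> ?B"
    proof
      fix n assume "n \<in> cell \<eta> ` ball x R"
      then obtain z where z: "n = cell \<eta> z" "norm (x - z) < R" by (auto simp: dist_norm)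
      have "\<bar>Re x - Re z\<bar> < R" "\<bar>Im x - Im z\<bar> < R"
        using z(2) abs_Re_le_cmod[of "x - z"] abs_Im_le_cmod[of "x - z"] by auto
      then have "Re x - R \<le> Re z" "Re z \<le> Re x + R" "Im x - R \<le> Im z" "Im z \<le> Im x + R"
        by linarith+
      then show "n \<in> ?B" using assms unfolding z(1) cell_def
        by (auto intro!: floor_mono divide_right_mono)
    qed
    have "card (cell \<eta> ` ball x R) \<le> card ?B" by (rule card_mono[OF _ sub]) simp
    also have "\<dots> \<le> d * d" unfolding card_cartesian_product using I by (intro mult_le_mono)
    finally show ?thesis using finite_subset[OF sub] by simp
  qed
  then show ?thesis by blast
qed

theorem theoremA:
  fixes vs :: "complex list" and P :: "complex set"
  assumes "simple_polygon vs" and "P = open_polygon vs"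
    and "convex P \<or> (\<not> convex P \<and> \<not> has_special_pair vs)"
  shows "\<forall>k\<ge>2. \<exists>m. \<forall>(I :: (complex \<times> nat) set) (c :: complex \<times> nat \<Rightarrow> complex).
           fold_covering m P I c \<longrightarrow> decomposable k P I c"
proof (intro allI impI)
  fix k :: nat assume k: "2 \<le> k"
  then have k0: "0 < k" by simp
  obtain Ts \<delta> where Ts: "finite Ts" "0 < \<delta>" "\<forall>\<tau>\<in>Ts. proper \<tau>"
    "\<forall>\<tau>\<in>Ts. \<forall>\<sigma>\<in>Ts. \<tau> \<noteq> \<sigma> \<longrightarrow> uncrossed \<tau> \<sigma>"
    "\<forall>y. \<exists>\<tau>1\<in>Ts. \<exists>\<tau>2\<in>Ts. \<exists>a1 b1 a2 b2. \<forall>z\<in>ball y \<delta>.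
       z \<in> P \<longleftrightarrow> in_quadrant \<tau>1 a1 b1 z \<or> in_quadrant \<tau>2 a2 b2 z"
    using polygon_quadrants[OF assms] by (elim exE conjE) (rule that)
  obtain M where M: "\<forall>(S :: (complex \<times> nat) set) x. finite S \<longrightarrow>
    (\<exists>col :: complex \<times> nat \<Rightarrow> nat. \<forall>\<tau>\<in>Ts. \<forall>a b.
    M \<le> card (arc_quad S x \<tau> a b) \<longrightarrow> {..<k} \<subseteq> col ` arc_quad S x \<tau> a b)"
    using exists_arc_colouring[OF Ts(1) Ts(3,4) k0] by (elim exE) (rule that)
  note P = polygon_basic[OF assms(1), folded assms(2)]
  obtain R where R: "\<And>z. z \<in> P \<Longrightarrow> norm z < R" using P(2) bounded_pos_less by blast
  \<comment> \<open>Then points in a common cell are less than \<open>\<delta>\<close> apart, so one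
    local description of \<open>P\<close> serves the whole cell.\<close>
  define \<eta> where "\<eta> = \<delta> / 2"
  have \<eta>: "0 < \<eta>" using Ts(2) by (simp add: \<eta>_def)
  obtain D where D: "\<And>x. finite (cell \<eta> ` ball x R) \<and> card (cell \<eta> ` ball x R) \<le> D"
    using cells_of_ball[OF \<eta>] by blast
  \<comment> \<open>The relevant centres fall into at most \<open>D\<close> cells, so one cell
    contains more than \<open>2 * M\<close> of them; there \<open>P\<close> is a union of two
    quadrants, one of which receives at least \<open>M\<close>.\<close>
  have "decomposable k P I c" if cov: "fold_covering (D * (2 * M) + 1) P I c"
    for I :: "(complex \<times> nat) set" and c
  proof -
    obtain I' where I': "I' \<subseteq> I" "fold_covering (D * (2 * M) + 1) P I' c"
      "\<And>R. finite {i \<in> I'. norm (c i) \<le> R}"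
      using locally_finite_subcovering[OF P(1,2) cov] by blast
    define S where "S n = {i \<in> I'. cell \<eta> (c i) = n}" for n
    have finS: "finite (S n)" for n
    proof (cases "S n = {}")
      case False
      then obtain i0 where i0: "cell \<eta> (c i0) = n" by (auto simp: S_def)
      have "S n \<subseteq> {i \<in> I'. norm (c i) \<le> norm (c i0) + \<delta>}"
      proof
        fix i assume i: "i \<in> S n"
        then have "dist (c i) (c i0) < 2 * \<eta>" using i0
          by (intro cell_eq_dist[OF \<eta>]) (simp add: S_def)
        then have "norm (c i) \<le> norm (c i0) + \<delta>"
          using norm_triangle_sub[of "c i" "c i0"] by (simp add: dist_norm \<eta>_def)
        then show "i \<in> {i \<in> I'. norm (c i) \<le> norm (c i0) + \<delta>}" using i
          by (simp add: S_def)
      qed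
      then show ?thesis using I'(3) finite_subset by blast
    qed simp
    have "\<exists>col :: complex \<times> nat \<Rightarrow> nat. \<forall>\<tau>\<in>Ts. \<forall>a b.
        M \<le> card (arc_quad (S n) (\<lambda>i. - c i) \<tau> a b) \<longrightarrow> {..<k} \<subseteq> col ` arc_quad (S n) (\<lambda>i. - c i) \<tau> a b" for n
      using M finS by blast
    then obtain col :: "int \<times> int \<Rightarrow> complex \<times> nat \<Rightarrow> nat" where col: "\<And>n \<tau> a b. \<tau> \<in> Ts \<Longrightarrow>
        M \<le> card (arc_quad (S n) (\<lambda>i. - c i) \<tau> a b) \<Longrightarrow> {..<k} \<subseteq> col n ` arc_quad (S n) (\<lambda>i. - c i) \<tau> a b"
      by metis
    define colour where "colour i = col (cell \<eta> (c i)) i" for i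
    \<comment> \<open>Members outside the subcovering and members with a colour of at least
      \<open>k\<close> join class 0, so that the classes exhaust \<open>I\<close>.\<close>
    define J where "J j = {i \<in> I. if i \<in> I' \<and> colour i < k then colour i = j else j = 0}" for j
    have "disjoint_family_on J {..<k}" by (auto simp: disjoint_family_on_def J_def split: if_splits)
    moreover have "(\<Union>j<k. J j) = I"
    proof (intro subset_antisym subsetI)
      fix i assume "i \<in> I"
      then have "i \<in> J (if i \<in> I' \<and> colour i < k then colour i else 0)" by (simp add: J_def)
      moreover have "(if i \<in> I' \<and> colour i < k then colour i else 0) < k" using k by simp
      ultimately show "i \<in> (\<Union>j<k. J j)" by blast
    qed (auto simp: J_def)
    moreover have "(\<Union>i\<in>J j. translate P (c i)) = UNIV" if j: "j < k" for j
    proof -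
      have "\<exists>i\<in>J j. x \<in> translate P (c i)" for x
      proof -
        obtain A where A: "A \<subseteq> {i \<in> I'. x \<in> translate P (c i)}" "finite A" "card A = D * (2 * M) + 1"
          using I'(2) unfolding fold_covering_def by blast
        have near: "cell \<eta> (c i) \<in> cell \<eta> ` ball x R" if "i \<in> A" for i
        proof -
          have "x - c i \<in> P" using A(1) that by (auto simp: mem_translate_iff)
          then show ?thesis using R by (intro imageI) (simp add: dist_norm)
        qed
        have "card (cell \<eta> ` ball x R) * (2 * M) < card A" using D[of x] A(3) mult_le_mono1
          by (metis less_Suc_eq_le Suc_eq_plus1)
        then obtain n where n: "2 * M < card {i \<in> A. cell \<eta> (c i) = n}"
          using pigeonhole_fibre[OF A(2), of "\<lambda>i. cell \<eta> (c i)" "cell \<eta> ` ball x R" "2 * M"] near D[of x] by blast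
        then have "{i \<in> A. cell \<eta> (c i) = n} \<noteq> {}" by force
        then obtain i0 where i0: "cell \<eta> (c i0) = n" by blast
        obtain \<tau>1 \<tau>2 a1 b1 a2 b2 where q: "\<tau>1 \<in> Ts" "\<tau>2 \<in> Ts" "\<forall>z\<in>ball (x - c i0) \<delta>.
            z \<in> P \<longleftrightarrow> in_quadrant \<tau>1 a1 b1 z \<or> in_quadrant \<tau>2 a2 b2 z"
          using Ts(5)[THEN spec, of "x - c i0"] by (elim bexE exE) (rule that)
        \<comment> \<open>Passing from the points \<open>x - c i\<close> to the points
          \<open>- c i\<close> shifts both thresholds by the projections of
          \<open>x\<close>.\<close>
        define Q where "Q \<tau> a b = arc_quad (S n) (\<lambda>i. - c i) \<tau> (a - arc_lo \<tau> x) (b - arc_hi \<tau> x)" for \<tau> a b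
        have Q: "i \<in> Q \<tau> a b \<longleftrightarrow> in_quadrant \<tau> a b (x - c i)" if "i \<in> S n" for i \<tau> a b
          using that by (auto simp: Q_def arc_quad_def quad_def in_quadrant_def proj_diff proj_minus)
        have mem: "x \<in> translate P (c i) \<longleftrightarrow> i \<in> Q \<tau>1 a1 b1 \<union> Q \<tau>2 a2 b2" if i: "i \<in> S n" for i
        proof -
          have "dist (c i) (c i0) < 2 * \<eta>" using i i0
            by (intro cell_eq_dist[OF \<eta>]) (simp add: S_def)
          then have "x - c i \<in> ball (x - c i0) \<delta>" by (simp add: dist_norm \<eta>_def)
          then show ?thesis using q(3) Q[OF i] by (simp add: mem_translate_iff)
        qed
        have QS: "Q \<tau> a b \<subseteq> S n" for \<tau> a b unfolding Q_def by (rule arc_quad_subset)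
        have "{i \<in> A. cell \<eta> (c i) = n} \<subseteq> Q \<tau>1 a1 b1 \<union> Q \<tau>2 a2 b2"
        proof
          fix i assume i: "i \<in> {i \<in> A. cell \<eta> (c i) = n}"
          then have "i \<in> S n" "x \<in> translate P (c i)" using A(1) by (auto simp: S_def)
          then show "i \<in> Q \<tau>1 a1 b1 \<union> Q \<tau>2 a2 b2" using mem by blast
        qed
        then have "card {i \<in> A. cell \<eta> (c i) = n} \<le> card (Q \<tau>1 a1 b1 \<union> Q \<tau>2 a2 b2)"
          using QS finite_subset[OF QS finS] by (intro card_mono) auto
        also have "\<dots> \<le> card (Q \<tau>1 a1 b1) + card (Q \<tau>2 a2 b2)" by (rule card_Un_le)
        finally have "M \<le> card (Q \<tau>1 a1 b1) \<or> M \<le> card (Q \<tau>2 a2 b2)" using n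
          by linarith
        then have "\<exists>i\<in>Q \<tau>1 a1 b1 \<union> Q \<tau>2 a2 b2. col n i = j"
          using col[OF q(1)] col[OF q(2)] j unfolding Q_def by blast
        then obtain i where i: "i \<in> Q \<tau>1 a1 b1 \<union> Q \<tau>2 a2 b2" "col n i = j" ..
        have iS: "i \<in> S n" using i(1) QS by blast
        then have "colour i = j" "i \<in> I'" using i(2) by (auto simp: colour_def S_def)
        then have "i \<in> J j" using j I'(1) by (auto simp: J_def)
        then show ?thesis using mem[OF iS] i(1) by blast
      qed
      then show ?thesis by blast
    qed
    ultimately show ?thesis unfolding decomposable_def by blast
  qed
  then show "\<exists>m. \<forall>(I :: (complex \<times> nat) set) c. fold_covering m P I c \<longrightarrow> decomposable k P I c" by blast
qed

end
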